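(* Let $A\to B$ be a morphism of admissible $\mathbb{Z}$-sets admitting a section. Let $I$ be a directed set and, for each $d\in I$, let $U_d$ be an admissible $\mathbb{Z}$-set and $\mathrm{ev}_d:U_d\times B\to A$ a morphism of admissible $\mathbb{Z}$-sets over $B$. Suppose $(U_d,\mathrm{ev}_d)$ equidistributes on $A/B$. Then for any $\mathcal{X}\in C(A,W(\mathbb{C}))$, setting $$\mathcal{X}_d:=\mathrm{ev}_d^*\mathcal{X}\in C(U_d\times B,W(\mathbb{C})),\qquad X_d:=\int_{U_d\times B/U_d}\mathcal{X}_d,$$ we have $$\lim_{d\in I}\mathbb{E}_{U_d}[\mathrm{Exp}_\sigma(X_dh_1)]=\lim_{d\in I}\mathbb{E}_{U_d}\Bigl[\prod_{U_d\times B/U_d}\mathrm{Exp}_\sigma(\mathcal{X}_dh_1)\Bigr]=\prod_B\lim_{d\in I}\mathbb{E}_{U_d\times B/B}[\mathrm{Exp}_\sigma(\mathcal{X}_dh_1)]=\prod_B\mathbb{E}_{A/B}[\mathrm{Exp}_\sigma(\mathcal{X}h_1)].$$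
   Context: **Admissible $\mathbb{Z}$-sets.** An admissible $\mathbb{Z}$-set is a set $V$ with an action of the group $\mathbb{Z}$ such that $V=\bigcup_{k\ge1}V^{k\mathbb{Z}}$ and each $V^{k\mathbb{Z}}$ is finite; morphisms are equivariant maps. $|V|$ is the set of orbits; $\deg(v)$ is the size of the orbit $|v|$ of $v$. $\mathbf{1}$ is the one-point $\mathbb{Z}$-set and $V(\mathbf 1)=V^{\mathbb{Z}}$. $V_{\mathbf k}$ is the set $V$ with the action multiplied by $k$ ($j$ acts as $kj$ did). For $\varphi:V\to B$ and $b\in B$, the fiber $V_b$ is an admissible $\mathbb{Z}$-set with the action multiplied by $\deg(b)$. **Witt vectors.** $W(\mathbb{C})$ is the ring of big Witt vectors. Its additive group is $1+t\mathbb{C}[[t]]$ under multiplication. The ghost components $w_k$ ($k\ge1$) are defined by $t\frac{d}{dt}\log w=\sum_{k\ge1}w_kt^k$, and $w\mapsto(w_k)_k$ is a ring isomorphism $W(\mathbb{C})\cong\prod_{k\ge1}\mathbb{C}$. Convergence in $W(\mathbb{C})$ is convergence of each ghost component. The Adams operations are $p_i\circ(w_k)_k=(w_{ik})_k$. $w(t^i)$ denotes substitution of $t^i$ for $t$ in the power series. $[V]=\prod_{|v|\in|V|}\frac1{1-t^{\deg|v|}}\in W(\mathbb{C})$. **Functions.** $C(V,W(\mathbb{C}))$ is the ring of functions $V\to W(\mathbb{C})$ constant on orbits, with pointwise operations (including Adams operations). For $\varphi:V\to B$: pullback is $(\varphi^*g)(v)=p_{\deg(v)/\deg(\varphi(v))}\circ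 g(\varphi(v))$; integration over fibers is $\bigl(\int_{V/B}f\bigr)(b)=\sum_{|v|\in|V_b|}f(|v|)(t^{\deg(|v|)})$ (sum in $W(\mathbb{C})$, degrees computed in $V_b$); $[V/B]\in C(B,W(\mathbb{C}))$ is $b\mapsto[V_b]$. If $V\to B$ has a section, $\mathbb{E}_{V/B}[f]=\int_{V/B}f/[V/B]\in C(B,W(\mathbb{C}))$. When $B=\mathbf 1$ one writes $\int_V$, $\mathbb{E}_V$ (defined when $V(\mathbf1)\ne\emptyset$). All are applied coefficient-wise to power series. **Power series.** For $R=C(V,W(\mathbb{C}))$, $R[[\underline t_{\mathbb{N}}]]=\varprojlim_nR[[t_1,\dots,t_n]]$ carries Adams operations (ring endomorphisms) extending those on $R$ with $p_i\circ t_j=t_j^i$; $\mathrm{Fil}^1$ is the set of series with zero constant term; $\mathrm{Exp}_\sigma(F)=\sum_{k\ge0}h_k\circ F=\exp\bigl(\sum_{j\ge1}\frac{p_j\circ F}{j}\bigr)$ is a bijection $\mathrm{Fil}^1\to1+\mathrm{Fil}^1$ with inverse $\mathrm{Log}_\sigma$. $h_1=t_1+t_2+\cdots$. Limits are coefficient-wise, and pointwise for coefficients in $C(B,W(\mathbb{C}))$. **Motivic Euler products.** For $V\to B$ and $H\in1+\mathrm{Fil}^1C(V,W(\mathbb{C}))[[\underline t_{\mathbb{N}}]]$, $\prod_{V/B}H:=\mathrm{Exp}_\sigma\bigl(\int_{V/B}\mathrm{Log}_\sigma(H)\bigr)\in C(B,W(\mathbb{C}))[[\underline t_{\mathbb{N}}]]$,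 and $\prod_V=\prod_{V/\mathbf 1}$. **Equidistribution.** For $k\ge1$ and an admissible $\mathbb{Z}$-subset $B'\subseteq B_{\mathbf k}$, let $\mathrm{ev}_{d,B'}:U_{d,\mathbf k}(\mathbf1)\to\mathrm{Hom}_{B_{\mathbf k}}(B',A_{\mathbf k})$ (equivariant maps over $B_{\mathbf k}$) be $u\mapsto(b\mapsto\mathrm{ev}_d(u,b))$, where $U_{d,\mathbf k}(\mathbf1)=U_d^{k\mathbb{Z}}$. $(U_d,\mathrm{ev}_d)$ equidistributes on $A/B$ if for every $k\ge1$ and every non-empty finite admissible $\mathbb{Z}$-subset $B'\subseteq B_{\mathbf k}$, $\lim_{d\in I}(\mathrm{ev}_{d,B'})_*\mu_{U_{d,\mathbf k}(\mathbf1)}=\mu_{\mathrm{Hom}_{B_{\mathbf k}}(B',A_{\mathbf k})}$, where $\mu_Z$ is the uniform probability measure on a finite set $Z$. It is implicit that $U_d(\mathbf1)\neq\emptyset$ for $d$ sufficiently large, so that these measures and the expectations over $U_d$ make sense. *)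

theory Defs
  imports
    "HOL-Probability.Probability"
    "HOL-Library.Multiset"
    "HOL-Algebra.Group_Action"
    "HOL-Algebra.Elementary_Groups"
begin

section \<open>Admissible \<open>\<int>\<close>-sets\<close>

record 'v zset =
  pts :: "'v set"
  act :: "int \<Rightarrow> 'v \<Rightarrow> 'v"

definition fixed_pts :: "nat \<Rightarrow> 'v zset \<Rightarrow> 'v set" where
  "fixed_pts k V = {v \<in> pts V. \<forall>j. act V (int k * j) v = v}"

text \<open>The library's group actions are by extensional functions; restricting here leaves the values of
  \<^const>\<open>act\<close> outside of \<^const>\<open>pts\<close> arbitrary.\<close>

definition admissible :: "'v zset \<Rightarrow> bool" where
  "admissible V \<longleftrightarrow>
     group_action integer_group (pts V) (\<lambda>j. restrict (act V j) (pts V)) \<and>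
     pts V = (\<Union>k\<in>{1..}. fixed_pts k V) \<and>
     (\<forall>k\<ge>1. finite (fixed_pts k V))"

definition zmorphism :: "'v zset \<Rightarrow> 'w zset \<Rightarrow> ('v \<Rightarrow> 'w) \<Rightarrow> bool" where
  "zmorphism V W f \<longleftrightarrow>
     f \<in> pts V \<rightarrow> pts W \<and> (\<forall>j. \<forall>v\<in>pts V. f (act V j v) = act W j (f v))"

definition has_section :: "'v zset \<Rightarrow> 'b zset \<Rightarrow> ('v \<Rightarrow> 'b) \<Rightarrow> bool" where
  "has_section V B \<phi> \<longleftrightarrow> (\<exists>s. zmorphism B V s \<and> (\<forall>b\<in>pts B. \<phi> (s b) = b))"

definition zorbit :: "'v zset \<Rightarrow> 'v \<Rightarrow> 'v set" where
  "zorbit V v = Group_Action.orbit integer_group (act V) v"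

definition zorbits :: "'v zset \<Rightarrow> 'v set set" where
  "zorbits V = orbits integer_group (pts V) (act V)"

definition zdeg :: "'v zset \<Rightarrow> 'v \<Rightarrow> nat" where
  "zdeg V v = card (zorbit V v)"

definition scale :: "nat \<Rightarrow> 'v zset \<Rightarrow> 'v zset" where
  "scale k V = \<lparr>pts = pts V, act = (\<lambda>j. act V (int k * j))\<rparr>"

definition fiber :: "'v zset \<Rightarrow> 'b zset \<Rightarrow> ('v \<Rightarrow> 'b) \<Rightarrow> 'b \<Rightarrow> 'v zset" where
  "fiber V B \<phi> b = (scale (zdeg B b) V)\<lparr>pts := {v \<in> pts V. \<phi> v = b}\<rparr>"

definition zpoint :: "unit zset" where
  "zpoint = \<lparr>pts = UNIV, act = (\<lambda>j v. v)\<rparr>"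

definition zprod :: "'u zset \<Rightarrow> 'v zset \<Rightarrow> ('u \<times> 'v) zset" where
  "zprod U V = \<lparr>pts = pts U \<times> pts V, act = (\<lambda>j. map_prod (act U j) (act V j))\<rparr>"


section \<open>Big Witt vectors of \<open>\<complex>\<close>\<close>

typedef witt = "{w :: complex fps. fps_nth w 0 = 1}"
  morphisms witt_series Witt
  by (rule exI[of _ 1]) simp

definition ghost :: "witt \<Rightarrow> nat \<Rightarrow> complex" where
  "ghost w k = fps_nth (fps_X * fps_deriv (witt_series w) / witt_series w) k"

definition of_ghost :: "(nat \<Rightarrow> complex) \<Rightarrow> witt" where
  "of_ghost c = (THE w. \<forall>k\<ge>1. ghost w k = c k)"

lemma witt_series_0 [simp]: "fps_nth (witt_series w) 0 = 1"
  using witt_series by auto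

lemma witt_series_nz [simp]: "witt_series w \<noteq> 0"
  by (metis fps_zero_nth witt_series_0 zero_neq_one)

lemma ghost_series:
  "fps_X * fps_deriv (witt_series w) = Abs_fps (ghost w) * witt_series w"
proof -
  have "Abs_fps (ghost w) = fps_X * fps_deriv (witt_series w) / witt_series w"
    by (simp add: fps_eq_iff ghost_def)
  moreover have "is_unit (witt_series w)"
    by simp
  ultimately show ?thesis
    by simp
qed

lemma ghost_0 [simp]: "ghost w 0 = 0"
  using arg_cong[OF ghost_series[of w], of "\<lambda>f. fps_nth f 0"] by simp

lemma ghost_unique:
  assumes "fps_X * fps_deriv (witt_series w) = g * witt_series w"
  shows "ghost w = fps_nth g"
  using assms ghost_series[of w] by (metis fps_nth_Abs_fps mult_cancel_right witt_series_nz ext)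

lemma ghost_eqI:
  assumes "\<And>k. k \<ge> 1 \<Longrightarrow> ghost w k = ghost v k"
  shows "w = v"
proof -
  let ?w = "witt_series w" and ?v = "witt_series v"
  have "ghost w k = ghost v k" for k
    using assms by (cases k) auto
  then have g: "ghost w = ghost v" by auto
  have "fps_X * (fps_deriv ?w * ?v) = Abs_fps (ghost v) * ?w * ?v"
    by (simp only: ghost_series g flip: mult.assoc)
  also have "\<dots> = (fps_X * fps_deriv ?v) * ?w"
    unfolding ghost_series by (simp only: mult_ac)
  finally have "fps_X * (fps_deriv ?w * ?v) = fps_X * (fps_deriv ?v * ?w)"
    by (simp only: mult.assoc)
  then have d: "fps_deriv ?w * ?v = fps_deriv ?v * ?w"
    by (rule mult_left_cancel[THEN iffD1, rotated]) (rule fps_X_neq_zero)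
  define u where "u = inverse ?v"
  have iv: "u * ?v = 1"
    by (simp add: u_def inverse_mult_eq_1)
  have "fps_deriv (?w * u) = ?w * (- fps_deriv ?v * u\<^sup>2) + fps_deriv ?w * u"
    by (simp add: u_def fps_inverse_deriv)
  also have "\<dots> = - (fps_deriv ?v * ?w) * u\<^sup>2 + fps_deriv ?w * u * (u * ?v)"
    by (simp add: iv)
  also have "\<dots> = (fps_deriv ?w * ?v - fps_deriv ?v * ?w) * u\<^sup>2"
    by (simp add: power2_eq_square algebra_simps)
  finally have "fps_deriv (?w * u) = 0"
    using d by (simp del: fps_deriv_mult)
  then have "?w * u = fps_const (fps_nth (?w * u) 0)"
    by (rule fps_deriv_eq_0_iff[THEN iffD1])
  then have "?w * u = 1"
    by (simp add: u_def)
  then have "?w * (u * ?v) = ?v"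
    by (simp flip: mult.assoc)
  then have "?w = ?v"
    by (simp add: iv)
  then show ?thesis by (simp add: witt_series_inject)
qed

lemma ghost_ex: "\<exists>w. \<forall>k\<ge>1. ghost w k = c k"
proof -
  define g where "g = Abs_fps (\<lambda>k. c k / of_nat k)"
  have g0: "fps_nth g 0 = 0" by (simp add: g_def)
  define e where "e = fps_compose (fps_exp 1) g"
  have e0: "fps_nth e 0 = 1" by (simp add: e_def)
  have "fps_deriv e = e * fps_deriv g"
    by (simp add: e_def fps_compose_deriv[OF g0])
  then have "fps_X * fps_deriv (witt_series (Witt e)) = (fps_X * fps_deriv g) * witt_series (Witt e)"
    using e0 by (simp add: Witt_inverse mult_ac)
  then have "ghost (Witt e) = fps_nth (fps_X * fps_deriv g)"
    by (rule ghost_unique)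
  then have "\<forall>k\<ge>1. ghost (Witt e) k = c k"
    by (simp add: g_def)
  then show ?thesis by blast
qed

lemma ghost_of_ghost [simp]: "k \<ge> 1 \<Longrightarrow> ghost (of_ghost c) k = c k"
proof -
  have "\<exists>!w. \<forall>k\<ge>1. ghost w k = c k"
    using ghost_ex[of c] ghost_eqI by (metis (no_types, lifting))
  from theI'[OF this] show "k \<ge> 1 \<Longrightarrow> ghost (of_ghost c) k = c k"
    by (simp add: of_ghost_def)
qed

text \<open>Addition is multiplication of power series and \<open>1\<close> is \<open>1/(1-t)\<close>. Multiplication is
  transported along the ghost components, and so is division, which is the inverse of
  multiplication wherever the denominator is a unit.\<close>

instantiation witt :: comm_ring_1
begin

definition "0 = Witt 1"
definition "1 = Witt (inverse (1 - fps_X))"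
definition "w + v = Witt (witt_series w * witt_series v)"
definition "- w = Witt (inverse (witt_series w))"
definition "(w::witt) - v = w + - v"
definition "w * v = of_ghost (\<lambda>k. ghost w k * ghost v k)"

lemma ghost_zero [simp]: "ghost 0 k = 0"
proof -
  have "ghost 0 = fps_nth 0"
    by (rule ghost_unique) (simp add: zero_witt_def Witt_inverse)
  then show ?thesis by simp
qed

lemma ghost_one [simp]: "k \<ge> 1 \<Longrightarrow> ghost 1 k = 1"
proof -
  let ?s = "1 - fps_X :: complex fps"
  have i: "inverse ?s * ?s = 1"
    by (simp add: inverse_mult_eq_1)
  have "ghost 1 = fps_nth (fps_X * inverse ?s)"
    by (rule ghost_unique) (simp add: one_witt_def Witt_inverse fps_inverse_deriv power2_eq_square mult_ac)
  then show "k \<ge> 1 \<Longrightarrow> ghost 1 k = 1"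
    by (simp add: fps_inverse_gp'[symmetric] flip: fps_divide_unit)
qed

lemma ghost_add [simp]: "ghost (w + v) k = ghost w k + ghost v k"
proof -
  have "ghost (w + v) = fps_nth (Abs_fps (ghost w) + Abs_fps (ghost v))"
  proof (rule ghost_unique)
    show "fps_X * fps_deriv (witt_series (w + v))
        = (Abs_fps (ghost w) + Abs_fps (ghost v)) * witt_series (w + v)"
      using ghost_series[of w] ghost_series[of v]
      by (simp add: plus_witt_def Witt_inverse) algebra
  qed
  then show ?thesis by simp
qed

lemma ghost_uminus [simp]: "ghost (- w) k = - ghost w k"
proof -
  have "w + - w = 0"
    by (simp add: plus_witt_def uminus_witt_def zero_witt_def Witt_inverse inverse_mult_eq_1')
  then have "ghost w k + ghost (- w) k = 0"
    by (metis ghost_add ghost_zero)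
  then show ?thesis by (simp add: add_eq_0_iff)
qed

lemma ghost_diff [simp]: "ghost (w - v) k = ghost w k - ghost v k"
  by (simp add: minus_witt_def)

lemma ghost_mult [simp]: "ghost (w * v) k = ghost w k * ghost v k"
  by (cases k) (simp_all add: times_witt_def)

instance
proof
  show "(0::witt) \<noteq> 1"
    by (metis ghost_one ghost_zero order_refl zero_neq_one)
qed (auto intro!: ghost_eqI simp: algebra_simps)

end

instantiation witt :: inverse
begin

definition "inverse w = of_ghost (\<lambda>k. inverse (ghost w k))"
definition "(w::witt) div v = of_ghost (\<lambda>k. ghost w k / ghost v k)"

instance ..

end

text \<open>The coarsest topology for which every ghost component is continuous.\<close>

instantiation witt :: t2_space
begin

definition open_witt :: "witt set \<Rightarrow> bool" where
  "open_witt = generate_topology {{w. ghost w k \<in> S} |k S. k \<ge> 1 \<and> open S}"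

instance
proof
  show "open (UNIV :: witt set)"
    unfolding open_witt_def by (rule generate_topology.UNIV)
  show "open S \<Longrightarrow> open T \<Longrightarrow> open (S \<inter> T)" for S T :: "witt set"
    unfolding open_witt_def by (rule generate_topology.Int)
  show "\<forall>S\<in>K. open S \<Longrightarrow> open (\<Union>K)" for K :: "witt set set"
    unfolding open_witt_def by (rule generate_topology.UN) auto
  fix w v :: witt
  assume "w \<noteq> v"
  then obtain k where k: "k \<ge> 1" "ghost w k \<noteq> ghost v k"
    using ghost_eqI by blast
  then obtain S T where "open S" "open T" "ghost w k \<in> S" "ghost v k \<in> T" "S \<inter> T = {}"
    by (metis hausdorff)
  then show "\<exists>S T. open S \<and> open T \<and> w \<in> S \<and> v \<in> T \<and> S \<inter> T = {}"
    unfolding open_witt_def using k(1)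
    by (intro exI[of _ "{w. ghost w k \<in> S}"] exI[of _ "{w. ghost w k \<in> T}"])
       (auto intro!: generate_topology.Basis)
qed

end

lemma tendsto_witt_iff:
  "(f \<longlongrightarrow> w) F \<longleftrightarrow> (\<forall>k\<ge>1. ((\<lambda>x. ghost (f x) k) \<longlongrightarrow> ghost w k) F)"
proof
  assume L: "(f \<longlongrightarrow> w) F"
  show "\<forall>k\<ge>1. ((\<lambda>x. ghost (f x) k) \<longlongrightarrow> ghost w k) F"
  proof (intro allI impI topological_tendstoI)
    fix k :: nat and S :: "complex set"
    assume "k \<ge> 1" "open S" "ghost w k \<in> S"
    then have "open {w. ghost w k \<in> S}"
      unfolding open_witt_def by (auto intro!: generate_topology.Basis)
    from topological_tendstoD[OF L this] \<open>ghost w k \<in> S\<close>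
    show "\<forall>\<^sub>F x in F. ghost (f x) k \<in> S" by simp
  qed
next
  assume R: "\<forall>k\<ge>1. ((\<lambda>x. ghost (f x) k) \<longlongrightarrow> ghost w k) F"
  have "eventually (\<lambda>x. f x \<in> S) F"
    if "generate_topology {{w. ghost w k \<in> S} |k S. k \<ge> 1 \<and> open S} S" "w \<in> S" for S
    using that
  proof (induction rule: generate_topology.induct)
    case (Int a b)
    then show ?case by (auto intro: eventually_conj)
  next
    case (UN K)
    then obtain a where "a \<in> K" "w \<in> a" by blast
    with UN have "\<forall>\<^sub>F x in F. f x \<in> a" by blast
    then show ?case by eventually_elim (use \<open>a \<in> K\<close> in blast)
  next
    case (Basis a)
    then obtain k S where "a = {w. ghost w k \<in> S}" "k \<ge> 1" "open S" by auto
    then show ?case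
      using Basis R topological_tendstoD[of "\<lambda>x. ghost (f x) k" "ghost w k" F S] by auto
  qed auto
  then show "(f \<longlongrightarrow> w) F"
    by (intro topological_tendstoI) (auto simp: open_witt_def)
qed

definition witt_adams :: "nat \<Rightarrow> witt \<Rightarrow> witt" where
  "witt_adams i w = of_ghost (\<lambda>k. ghost w (i * k))"

definition witt_subst :: "nat \<Rightarrow> witt \<Rightarrow> witt" where
  "witt_subst i w = Witt (fps_compose (witt_series w) (fps_X ^ i))"

text \<open>The product of power series over all orbits is a sum in \<^typ>\<open>witt\<close>.\<close>

definition zclass :: "'v zset \<Rightarrow> witt" where
  "zclass V = (\<Sum>\<^sub>\<infinity>q\<in>zorbits V. Witt (inverse (1 - fps_X ^ card q)))"


section \<open>Functions on admissible \<open>\<int>\<close>-sets\<close>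

text \<open>The values outside of \<^term>\<open>pts V\<close> are irrelevant.\<close>

definition CW :: "'v zset \<Rightarrow> ('v \<Rightarrow> 'r) set" where
  "CW V = {g. \<forall>j. \<forall>v\<in>pts V. g (act V j v) = g v}"

definition pullback :: "'v zset \<Rightarrow> 'b zset \<Rightarrow> ('v \<Rightarrow> 'b) \<Rightarrow> ('b \<Rightarrow> witt) \<Rightarrow> 'v \<Rightarrow> witt" where
  "pullback V B \<phi> g v = witt_adams (zdeg V v div zdeg B (\<phi> v)) (g (\<phi> v))"

definition fiber_int :: "'v zset \<Rightarrow> 'b zset \<Rightarrow> ('v \<Rightarrow> 'b) \<Rightarrow> ('v \<Rightarrow> witt) \<Rightarrow> 'b \<Rightarrow> witt" where
  "fiber_int V B \<phi> f b =
     (\<Sum>\<^sub>\<infinity>q\<in>zorbits (fiber V B \<phi> b). witt_subst (card q) (the_elem (f ` q)))"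

definition expect :: "'v zset \<Rightarrow> 'b zset \<Rightarrow> ('v \<Rightarrow> 'b) \<Rightarrow> ('v \<Rightarrow> witt) \<Rightarrow> 'b \<Rightarrow> witt" where
  "expect V B \<phi> f b = fiber_int V B \<phi> f b / zclass (fiber V B \<phi> b)"


section \<open>Power series in \<open>t\<^sub>1, t\<^sub>2, \<dots>\<close>\<close>

text \<open>A monomial is the multiset of the indices of its variables; the indices start at \<open>0\<close>.\<close>

typedef 'r mps = "UNIV :: (nat multiset \<Rightarrow> 'r) set"
  morphisms mcoeff Mps ..

lemma mcoeff_Mps [simp]: "mcoeff (Mps f) = f"
  by (simp add: Mps_inverse)

lemma mps_eqI: "(\<And>m. mcoeff F m = mcoeff G m) \<Longrightarrow> F = G"
  by (simp add: mcoeff_inject[symmetric] fun_eq_iff)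

lemma finite_mset_splits: "finite {(a, b). a + b = (m :: 'a multiset)}"
proof (induction m)
  case empty
  then show ?case by simp
next
  case (add x m)
  have "{(a, b). a + b = add_mset x m} \<subseteq>
      (\<lambda>(a, b). (add_mset x a, b)) ` {(a, b). a + b = m} \<union>
      (\<lambda>(a, b). (a, add_mset x b)) ` {(a, b). a + b = m}"
  proof safe
    fix a b :: "'a multiset"
    assume ab: "a + b = add_mset x m"
      and "(a, b) \<notin> (\<lambda>(a, b). (a, add_mset x b)) ` {(a, b). a + b = m}"
    show "(a, b) \<in> (\<lambda>(a, b). (add_mset x a, b)) ` {(a, b). a + b = m}"
    proof (cases "x \<in># a")
      case True
      then obtain a' where "a = add_mset x a'" by (meson multi_member_split)
      then show ?thesis using ab by force
    next
      case False
      then have "x \<in># b" using ab by (metis union_iff union_single_eq_member)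
      then obtain b' where "b = add_mset x b'" by (meson multi_member_split)
      with ab have "(a, b) \<in> (\<lambda>(a, b). (a, add_mset x b)) ` {(a, b). a + b = m}" by force
      then show ?thesis using \<open>(a, b) \<notin> _\<close> by blast
    qed
  qed
  then show ?case
    by (rule finite_subset) (intro finite_UnI finite_imageI add)
qed

instantiation mps :: (comm_ring_1) comm_ring_1
begin

definition "0 = Mps (\<lambda>m. 0)"
definition "1 = Mps (\<lambda>m. if m = {#} then 1 else 0)"
definition "F + G = Mps (\<lambda>m. mcoeff F m + mcoeff G m)"
definition "- F = Mps (\<lambda>m. - mcoeff F m)"
definition "F - G = Mps (\<lambda>m. mcoeff F m - mcoeff G m)"
definition "F * G = Mps (\<lambda>m. \<Sum>(a, b) | a + b = m. mcoeff F a * mcoeff G b)"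

instance
proof
  fix F G H :: "'a mps"
  note defs = zero_mps_def one_mps_def plus_mps_def uminus_mps_def minus_mps_def times_mps_def
  show "F * G * H = F * (G * H)"
  proof (rule mps_eqI)
    fix m
    let ?S = "\<lambda>m :: nat multiset. {(a, b). a + b = m}"
    have "mcoeff (F * G * H) m =
        (\<Sum>((d, c), a, b) \<in> Sigma (?S m) (\<lambda>(d, c). ?S d). mcoeff F a * mcoeff G b * mcoeff H c)"
      by (simp add: defs sum_distrib_right case_prod_unfold)
         (subst sum.Sigma, auto simp: case_prod_unfold finite_mset_splits[unfolded case_prod_unfold])
    also have "\<dots> =
        (\<Sum>((a, e), b, c) \<in> Sigma (?S m) (\<lambda>(a, e). ?S e). mcoeff F a * (mcoeff G b * mcoeff H c))"
      by (rule sum.reindex_bij_witness[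
            where i = "\<lambda>((a, e), b, c). ((a + b, c), a, b)" and j = "\<lambda>((d, c), a, b). ((a, b + c), b, c)"])
         (auto simp: ac_simps)
    also have "\<dots> = mcoeff (F * (G * H)) m"
      by (simp add: defs sum_distrib_left case_prod_unfold)
         (subst sum.Sigma, auto simp: case_prod_unfold finite_mset_splits[unfolded case_prod_unfold])
    finally show "mcoeff (F * G * H) m = mcoeff (F * (G * H)) m" .
  qed
  show "F * G = G * F"
    by (rule mps_eqI, simp add: defs,
        rule sum.reindex_bij_witness[where i = prod.swap and j = prod.swap])
       (auto simp: ac_simps)
  show "1 * F = F"
  proof (rule mps_eqI)
    fix m
    have "mcoeff (1 * F) m =
        (\<Sum>(a, b) \<in> {({#} :: nat multiset, m)}. (if a = {#} then 1 else 0) * mcoeff F b)"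
      unfolding defs mcoeff_Mps
      by (rule sum.mono_neutral_right) (auto simp: finite_mset_splits split: if_splits)
    then show "mcoeff (1 * F) m = mcoeff F m" by simp
  qed
  show "(0 :: 'a mps) \<noteq> 1"
    by (metis (mono_tags) mcoeff_Mps one_mps_def zero_mps_def zero_neq_one)
  show "(F + G) * H = F * H + G * H"
    by (rule mps_eqI) (simp add: defs distrib_right case_prod_unfold sum.distrib)
qed (auto intro!: mps_eqI simp: zero_mps_def plus_mps_def uminus_mps_def minus_mps_def)

end

definition mps_const :: "'r::zero \<Rightarrow> 'r mps" where
  "mps_const c = Mps (\<lambda>m. if m = {#} then c else 0)"

definition h1 :: "'r::zero_neq_one mps" where
  "h1 = Mps (\<lambda>m. if size m = 1 then 1 else 0)"

definition Fil1 :: "'r::zero mps set" where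
  "Fil1 = {F. mcoeff F {#} = 0}"

text \<open>\<open>p\<^sub>i \<circ> (\<Sum>\<^sub>n c\<^sub>n t\<^sup>n) = \<Sum>\<^sub>n (p\<^sub>i \<circ> c\<^sub>n) t\<^bsup>i n\<^esup>\<close>; for \<open>i \<ge> 1\<close> at most one \<open>n\<close> contributes to a monomial.\<close>

definition mps_adams :: "nat \<Rightarrow> witt mps \<Rightarrow> witt mps" where
  "mps_adams i F = Mps (\<lambda>m. \<Sum>n | repeat_mset i n = m. witt_adams i (mcoeff F n))"

text \<open>On \<^const>\<open>Fil1\<close> only finitely many terms of these series contribute to a given coefficient.\<close>

definition mps_exp :: "witt mps \<Rightarrow> witt mps" where
  "mps_exp G = Mps (\<lambda>m. \<Sum>n. mcoeff (G ^ n) m / of_nat (fact n))"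

definition Exp_sigma :: "witt mps \<Rightarrow> witt mps" where
  "Exp_sigma F = mps_exp (Mps (\<lambda>m. \<Sum>j. mcoeff (mps_adams (Suc j) F) m / of_nat (Suc j)))"

definition Log_sigma :: "witt mps \<Rightarrow> witt mps" where
  "Log_sigma = the_inv_into Fil1 Exp_sigma"

text \<open>A power series with coefficients in \<open>C(V, W(\<complex>))\<close> is represented by the function
  sending \<^term>\<open>v\<close> to the series of the values of its coefficients at \<^term>\<open>v\<close>, an element of
  \<^term>\<open>CW V :: ('v \<Rightarrow> witt mps) set\<close>. Since the operations on \<open>C(V, W(\<complex>))\<close> are pointwise,
  so are the ring operations, the Adams operations, \<^const>\<open>Exp_sigma\<close> and \<^const>\<open>Log_sigma\<close>.\<close>

definition coeffwise :: "(('v \<Rightarrow> 'r) \<Rightarrow> 'b \<Rightarrow> 's) \<Rightarrow> ('v \<Rightarrow> 'r mps) \<Rightarrow> 'b \<Rightarrow> 's mps" where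
  "coeffwise T F b = Mps (\<lambda>m. T (\<lambda>v. mcoeff (F v) m) b)"

definition euler_prod ::
    "'v zset \<Rightarrow> 'b zset \<Rightarrow> ('v \<Rightarrow> 'b) \<Rightarrow> ('v \<Rightarrow> witt mps) \<Rightarrow> 'b \<Rightarrow> witt mps" where
  "euler_prod V B \<phi> H b = Exp_sigma (coeffwise (fiber_int V B \<phi>) (\<lambda>v. Log_sigma (H v)) b)"


section \<open>Limits and equidistribution\<close>

definition directed_set :: "'i set \<Rightarrow> ('i \<Rightarrow> 'i \<Rightarrow> bool) \<Rightarrow> bool" where
  "directed_set I r \<longleftrightarrow> I \<noteq> {} \<and> reflp_on I r \<and> transp_on I r \<and>
     (\<forall>i\<in>I. \<forall>j\<in>I. \<exists>k\<in>I. r i k \<and> r j k)"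

definition net :: "'i set \<Rightarrow> ('i \<Rightarrow> 'i \<Rightarrow> bool) \<Rightarrow> 'i filter" where
  "net I r = (\<Sqinter>i\<in>I. principal {j \<in> I. r i j})"

lemma eventually_net:
  assumes "directed_set I r"
  shows "eventually P (net I r) \<longleftrightarrow> (\<exists>i\<in>I. \<forall>j\<in>I. r i j \<longrightarrow> P j)"
proof -
  have "\<exists>k\<in>I. principal {l \<in> I. r k l} \<le>
      principal {l \<in> I. r i l} \<sqinter> principal {l \<in> I. r j l}" if "i \<in> I" "j \<in> I" for i j
  proof -
    obtain k where k: "k \<in> I" "r i k" "r j k"
      using assms \<open>i \<in> I\<close> \<open>j \<in> I\<close> unfolding directed_set_def by blast
    have "transp_on I r"
      using assms by (simp add: directed_set_def)
    then have "{l \<in> I. r k l} \<subseteq> {l \<in> I. r i l} \<inter> {l \<in> I. r j l}"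
      using k \<open>i \<in> I\<close> \<open>j \<in> I\<close> by (blast dest: transp_onD)
    then show ?thesis
      using k(1) by (intro bexI[of _ k]) simp_all
  qed
  moreover have "I \<noteq> {}"
    using assms by (simp add: directed_set_def)
  ultimately have "eventually P (net I r) \<longleftrightarrow>
      (\<exists>i\<in>I. eventually P (principal {j \<in> I. r i j}))"
    unfolding net_def by (intro eventually_INF_base)
  then show ?thesis
    by (auto simp: eventually_principal)
qed

definition series_tendsto ::
    "'b zset \<Rightarrow> ('i \<Rightarrow> 'b \<Rightarrow> witt mps) \<Rightarrow> ('b \<Rightarrow> witt mps) \<Rightarrow> 'i filter \<Rightarrow> bool" where
  "series_tendsto B F L \<F> \<longleftrightarrow>
     (\<forall>b\<in>pts B. \<forall>m. ((\<lambda>d. mcoeff (F d b) m) \<longlongrightarrow> mcoeff (L b) m) \<F>)"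

text \<open>\<open>Hom\<^bsub>B\<^esub>(B', A)\<close> for a sub-\<open>\<int>\<close>-set of \<^term>\<open>B\<close> with underlying set \<^term>\<open>B'\<close>.\<close>

definition sections_on :: "'a zset \<Rightarrow> 'b zset \<Rightarrow> ('a \<Rightarrow> 'b) \<Rightarrow> 'b set \<Rightarrow> ('b \<Rightarrow> 'a) set" where
  "sections_on A B \<pi> B' =
     {s \<in> extensional B'. zmorphism (B\<lparr>pts := B'\<rparr>) A s \<and> (\<forall>b\<in>B'. \<pi> (s b) = b)}"

text \<open>The first clause makes the fixed-point sets non-empty, so that \<^const>\<open>pmf_of_set\<close> is the uniform
  measure. Since \<^const>\<open>sections_on\<close> is a finite set, measures on it converge iff the
  masses of all its points do.\<close>

definition equidistributes ::
    "'i set \<Rightarrow> ('i \<Rightarrow> 'i \<Rightarrow> bool) \<Rightarrow> ('i \<Rightarrow> 'u zset) \<Rightarrow> ('i \<Rightarrow> 'u \<times> 'b \<Rightarrow> 'a) \<Rightarrow>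
     'a zset \<Rightarrow> 'b zset \<Rightarrow> ('a \<Rightarrow> 'b) \<Rightarrow> bool" where
  "equidistributes I r U evd A B \<pi> \<longleftrightarrow>
     (\<forall>\<^sub>F d in net I r. fixed_pts 1 (U d) \<noteq> {}) \<and>
     (\<forall>k\<ge>1. \<forall>B'. B' \<subseteq> pts B \<and> B' \<noteq> {} \<and> finite B' \<and> admissible ((scale k B)\<lparr>pts := B'\<rparr>) \<longrightarrow>
        (\<forall>s \<in> sections_on (scale k A) (scale k B) \<pi> B'.
           ((\<lambda>d. pmf (map_pmf (\<lambda>u. restrict (\<lambda>b. evd d (u, b)) B') (pmf_of_set (fixed_pts k (U d)))) s)
              \<longlongrightarrow> pmf (pmf_of_set (sections_on (scale k A) (scale k B) \<pi> B')) s) (net I r)))"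

end

theory Submission
  imports Defs
begin

text \<open>
  Everything is computed in ghost components, where the objects of the theorem become finite sums over
  points. For a multiple \<open>K\<close> of \<open>deg v\<close> write \<open>f[K](v)\<close> for the component of \<open>f(v)\<close> with index \<open>K / deg v\<close>. Then
  \<open>(\<phi>\<^sup>*g)[K](v) = g[K](\<phi>(v))\<close>, the integral \<open>(\<integral>\<^sub>V\<^sub>/\<^sub>B f)[K](b)\<close> is the sum of \<open>f[K](v)\<close> over the points \<open>v\<close> of the fiber
  that are fixed by \<open>K\<int>\<close>, and the expectation is the average over the same points (lemmas
  \<open>ghost_pullback\<close>, \<open>ghost_fiber_int\<close>, \<open>ghost_expect\<close>). The component \<open>k\<close> of \<open>Exp\<^sub>\<sigma>(F)\<close> is the ordinary exponential of
  \<open>\<Sum>\<^sub>j \<psi>\<^sub>j(F[j k]) / j\<close>, where \<open>\<psi>\<^sub>j\<close> substitutes \<open>t\<^sub>n\<^sup>j\<close> for \<open>t\<^sub>n\<close>. A coefficient of degree \<open>N\<close> involves only \<open>j \<le> N\<close>, so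
  for a fixed coefficient all sums are finite.

  The first equality holds before the limit, because \<open>Log\<^sub>\<sigma>\<close> inverts \<open>Exp\<^sub>\<sigma>\<close>. That \<open>Exp\<^sub>\<sigma>\<close> is a bijection is seen
  without Moebius inversion: in each degree it is the identity plus a function of lower degrees.

  The core is a factorization of both outer terms. Fix \<open>k\<close> and \<open>N\<close>, and let \<open>B'\<close> be the finite set of points of \<open>B\<close>
  fixed by \<open>j k \<int>\<close> for some \<open>j \<le> N\<close>. In the exponent of the component \<open>k\<close> of an integral over \<open>B\<close>, a point whose
  \<open>k\<int>\<close>-orbit has size \<open>c\<close> contributes for the multiples \<open>j = i c\<close> only, and its contribution is \<open>1/c\<close> times \<open>\<psi>\<^sub>c\<close>
  of an exponent for the component \<open>c k\<close>. Hence the exponential is a product over the \<open>k\<int>\<close>-orbits in \<open>B'\<close> of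
  factors \<open>\<psi>\<^sub>c\<close> of a value at an orbit representative (lemma \<open>Euler_factorization\<close>). On the right these values
  are means of \<open>Exp\<^sub>\<sigma>(\<X>h\<^sub>1)\<close> over the fiber of \<open>A\<close> at the representative \<open>b\<close>; on the left, for \<open>u \<in> U\<^sub>d\<close> fixed by \<open>k\<int>\<close>, they
  are its values at \<open>ev\<^sub>d(u, b)\<close>.

  It remains to average over \<open>u\<close>. By equidistribution the average tends to the one over the sections of \<open>A\<close>
  on \<open>B'\<close> that are equivariant for \<open>k\<int>\<close>. Such a section is an independent choice, for each orbit representative
  \<open>b\<close>, of a point over \<open>b\<close> fixed by the stabilizer of \<open>b\<close> (lemma \<open>bij_betw_sections_on\<close>), so the average of the product
  is the product of the means (lemma \<open>tendsto_mean_of_prod\<close>). The limit in the third term is the special case in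
  which \<open>B'\<close> is a single point.
\<close>

section \<open>Orbits and degrees in admissible \<open>\<int>\<close>-sets\<close>

lemma act_closed:
  assumes "admissible V" "v \<in> pts V"
  shows "act V j v \<in> pts V"
proof -
  interpret group_action integer_group "pts V" "\<lambda>j. restrict (act V j) (pts V)"
    using assms unfolding admissible_def by (elim conjE)
  show ?thesis using surj_prop[of j] assms(2) by auto
qed

lemma act_0:
  assumes "admissible V" "v \<in> pts V"
  shows "act V 0 v = v"
proof -
  interpret group_action integer_group "pts V" "\<lambda>j. restrict (act V j) (pts V)"
    using assms unfolding admissible_def by (elim conjE)
  show ?thesis using fun_cong[OF id_eq_one, of v] assms(2) by simp
qed

lemma act_add:
  assumes "admissible V" "v \<in> pts V"
  shows "act V (i + j) v = act V i (act V j v)"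
proof -
  interpret group_action integer_group "pts V" "\<lambda>j. restrict (act V j) (pts V)"
    using assms unfolding admissible_def by (elim conjE)
  show ?thesis using composition_rule[of v i j] assms act_closed[OF assms] by simp
qed

lemma act_cancel:
  assumes "admissible V" "v \<in> pts V"
  shows "act V (- j) (act V j v) = v" "act V j (act V (- j) v) = v"
  using act_add[OF assms, of "-j" j] act_add[OF assms, of j "-j"] act_0[OF assms] by simp_all

lemma admissibleI:
  assumes closed: "\<And>v j. v \<in> pts V \<Longrightarrow> act V j v \<in> pts V"
    and zero: "\<And>v. v \<in> pts V \<Longrightarrow> act V 0 v = v"
    and add: "\<And>v i j. v \<in> pts V \<Longrightarrow> act V (i + j) v = act V i (act V j v)"
    and per: "\<And>v. v \<in> pts V \<Longrightarrow> \<exists>k\<ge>1. v \<in> fixed_pts k V"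
    and fin: "\<And>k. k \<ge> 1 \<Longrightarrow> finite (fixed_pts k V)"
  shows "admissible V"
proof -
  let ?f = "\<lambda>j. restrict (act V j) (pts V)"
  have c: "act V (- j) (act V j v) = v" "act V j (act V (- j) v) = v" if "v \<in> pts V" for v j
    using add[OF that, of "-j" j] add[OF that, of j "-j"] zero[OF that] by simp_all
  have bij: "?f j \<in> Bij (pts V)" for j
  proof -
    have "bij_betw (?f j) (pts V) (pts V)"
      by (rule bij_betw_byWitness[where f' = "?f (- j)"]) (auto simp: c closed)
    then show ?thesis by (auto simp: Bij_def)
  qed
  have "?f (i + j) = compose (pts V) (?f i) (?f j)" for i j
    by (auto simp: compose_def fun_eq_iff add closed)
  then have "?f \<in> hom integer_group (BijGroup (pts V))"
    by (auto simp: hom_def BijGroup_def bij)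
  then have "group_action integer_group (pts V) ?f"
    by (intro group_action.intro group_hom.intro group_hom_axioms.intro
        group_integer_group group_BijGroup)
  moreover have "pts V = (\<Union>k\<in>{1..}. fixed_pts k V)"
    using per by (fastforce simp: fixed_pts_def)
  ultimately show ?thesis
    using fin unfolding admissible_def by blast
qed

lemma zorbit_eq: "zorbit V v = range (\<lambda>j. act V j v)"
  by (auto simp: zorbit_def orbit_def)

lemma zorbits_eq: "zorbits V = zorbit V ` pts V"
  by (auto simp: zorbits_def orbits_def zorbit_def)

lemma exists_period:
  assumes "admissible V" "v \<in> pts V"
  obtains p :: nat where "p \<ge> 1" "\<And>j. act V j v = v \<longleftrightarrow> int p dvd j"
proof -
  obtain k where k: "k \<ge> 1" "v \<in> fixed_pts k V"
    using assms unfolding admissible_def by blast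
  \<comment> \<open>the least positive period generates the stabilizer, by division with remainder\<close>
  define P where "P = (\<lambda>p. p \<ge> 1 \<and> act V (int p) v = v)"
  have Pk: "P k" using k by (auto simp: P_def fixed_pts_def dest: spec[of _ 1])
  define p where "p = (LEAST p. P p)"
  have Pp: "P p" unfolding p_def using Pk by (rule LeastI)
  have nat_mult: "act V (int p * int n) v = v" for n
  proof (induction n)
    case (Suc n)
    have "act V (int p * int (Suc n)) v = act V (int p) (act V (int p * int n) v)"
      by (simp add: act_add[OF assms, symmetric] algebra_simps)
    then show ?case using Suc Pp by (simp add: P_def)
  qed (use act_0[OF assms] in simp)
  have mult: "act V (int p * j) v = v" for j
  proof (cases "j \<ge> 0")
    case True
    then show ?thesis using nat_mult[of "nat j"] by simp
  next
    case False
    then have "act V (int p * - j) v = v" using nat_mult[of "nat (- j)"] by simp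
    then show ?thesis using act_cancel(1)[OF assms, of "int p * - j"] by simp
  qed
  have "int p dvd j" if "act V j v = v" for j
  proof -
    define q where "q = nat (j mod int p)"
    have q: "int q = j mod int p" "q < p"
      using Pp by (auto simp: q_def P_def nat_less_iff)
    have "j = int q + int p * (j div int p)" using q by simp
    then have "act V (int q) v = v"
      using act_add[OF assms, of "int q" "int p * (j div int p)"] mult that by simp
    then have "q = 0"
      using not_less_Least[of q P, folded p_def] q(2) by (auto simp: P_def)
    then show ?thesis using q by auto
  qed
  then have "act V j v = v \<longleftrightarrow> int p dvd j" for j
    using mult by (auto elim!: dvdE)
  then show ?thesis using that[of p] Pp by (auto simp: P_def)
qed

lemma act_eq_iff:
  assumes "admissible V" "v \<in> pts V"
  shows "act V i v = act V j v \<longleftrightarrow> act V (i - j) v = v"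
proof -
  have "act V i v = act V j (act V (i - j) v)"
    using act_add[OF assms, of j "i - j"] by simp
  then show ?thesis
    using act_cancel(1)[OF assms(1), of v j] act_cancel(1)[OF assms(1), of "act V (i - j) v" j]
      act_closed[OF assms] assms(2) by metis
qed

text \<open>The degree is the cardinality of the orbit, which is the minimal positive period because the
  orbit is in bijection with the residues modulo that period.\<close>

lemma zdeg_period:
  assumes "admissible V" "v \<in> pts V"
  shows act_fixed_iff: "act V j v = v \<longleftrightarrow> int (zdeg V v) dvd j"
    and zdeg_pos: "zdeg V v \<ge> 1"
proof -
  obtain p :: nat where p: "p \<ge> 1" "\<And>j. act V j v = v \<longleftrightarrow> int p dvd j"
    using exists_period[OF assms] by blast
  have "bij_betw (\<lambda>j. act V (int j) v) {..<p} (zorbit V v)"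
    unfolding bij_betw_def
  proof
    show "inj_on (\<lambda>j. act V (int j) v) {..<p}"
    proof (rule inj_onI)
      fix i j assume "i \<in> {..<p}" "j \<in> {..<p}" "act V (int i) v = act V (int j) v"
      then have "int p dvd int i - int j" and "\<bar>int i - int j\<bar> < int p"
        using act_eq_iff[OF assms] p(2) by auto
      then show "i = j" using zdvd_not_zless[of "\<bar>int i - int j\<bar>" "int p"] by auto
    qed
    have "act V j v \<in> (\<lambda>j. act V (int j) v) ` {..<p}" for j
    proof (rule image_eqI)
      show "nat (j mod int p) \<in> {..<p}" using p(1) by (auto simp: nat_less_iff)
      show "act V j v = act V (int (nat (j mod int p))) v"
        using p by (simp add: act_eq_iff[OF assms] minus_mod_eq_mult_div)
    qed
    then show "(\<lambda>j. act V (int j) v) ` {..<p} = zorbit V v"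
      by (auto simp: zorbit_eq)
  qed
  then have "zdeg V v = p"
    using bij_betw_same_card by (fastforce simp: zdeg_def)
  then show "act V j v = v \<longleftrightarrow> int (zdeg V v) dvd j" "zdeg V v \<ge> 1"
    using p by auto
qed

lemma fixed_pts_iff:
  assumes "admissible V"
  shows "v \<in> fixed_pts k V \<longleftrightarrow> v \<in> pts V \<and> zdeg V v dvd k"
proof -
  have "(\<forall>j. int d dvd int k * j) \<longleftrightarrow> d dvd k" for d
    by (metis dvd_mult2 int_dvd_int_iff mult.right_neutral)
  then show ?thesis
    using act_fixed_iff[OF assms] by (auto simp: fixed_pts_def)
qed

lemma finite_fixed_pts: "admissible V \<Longrightarrow> k \<ge> 1 \<Longrightarrow> finite (fixed_pts k V)"
  unfolding admissible_def by blast

lemma zorbit_act: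
  assumes "admissible V" "v \<in> pts V"
  shows "zorbit V (act V i v) = zorbit V v"
proof -
  have "act V j v = act V (j - i) (act V i v)" for j
    using act_add[OF assms, of "j - i" i] by simp
  moreover have "act V j (act V i v) = act V (j + i) v" for j
    using act_add[OF assms, of j i] by simp
  ultimately show ?thesis unfolding zorbit_eq by blast
qed

lemma zdeg_act: "admissible V \<Longrightarrow> v \<in> pts V \<Longrightarrow> zdeg V (act V i v) = zdeg V v"
  by (simp add: zdeg_def zorbit_act)

lemma zorbit_self: "admissible V \<Longrightarrow> v \<in> pts V \<Longrightarrow> v \<in> zorbit V v"
  unfolding zorbit_eq by (metis act_0 rangeI)

lemma zorbit_sub: "admissible V \<Longrightarrow> v \<in> pts V \<Longrightarrow> zorbit V v \<subseteq> pts V"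
  by (auto simp: zorbit_eq act_closed)

lemma zorbit_eq_of_mem:
  "admissible V \<Longrightarrow> v \<in> pts V \<Longrightarrow> w \<in> zorbit V v \<Longrightarrow> zorbit V w = zorbit V v"
  using zorbit_act by (fastforce simp: zorbit_eq)

lemma zdeg_dvd_of_zmorphism:
  assumes "admissible V" "admissible W" "zmorphism V W f" "v \<in> pts V"
  shows "zdeg W (f v) dvd zdeg V v"
proof -
  have "act W (int (zdeg V v)) (f v) = f v"
    using assms(3,4) act_fixed_iff[OF assms(1,4), of "int (zdeg V v)"]
    unfolding zmorphism_def by (metis dvd_refl)
  then show ?thesis
    using act_fixed_iff[OF assms(2)] assms(3,4) by (force simp: zmorphism_def)
qed

text \<open>Both the fibers of a morphism and the \<open>\<int>\<close>-sets \<open>B'\<close> in the definition of equidistribution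
  arise by multiplying the action by \<open>k\<close> and passing to an invariant subset.\<close>

lemma scaled_subset:
  assumes "admissible V" "k \<ge> 1" "W \<subseteq> pts V"
    and "\<And>v j. v \<in> W \<Longrightarrow> act V (int k * j) v \<in> W"
  shows admissible_scaled_subset: "admissible ((scale k V)\<lparr>pts := W\<rparr>)"
    and fixed_pts_scaled_subset: "fixed_pts n ((scale k V)\<lparr>pts := W\<rparr>) = fixed_pts (k * n) V \<inter> W"
    and zdeg_scaled_subset_dvd_iff:
      "v \<in> W \<Longrightarrow> zdeg ((scale k V)\<lparr>pts := W\<rparr>) v dvd n \<longleftrightarrow> zdeg V v dvd k * n"
proof -
  let ?W = "(scale k V)\<lparr>pts := W\<rparr>"
  show F: "fixed_pts n ?W = fixed_pts (k * n) V \<inter> W" for n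
    using assms(3) by (auto simp: fixed_pts_def scale_def ac_simps)
  show A: "admissible ?W"
  proof (rule admissibleI)
    fix v assume "v \<in> pts ?W"
    then have v: "v \<in> W" "v \<in> pts V" using assms(3) by auto
    show "act ?W j v \<in> pts ?W" for j using assms(4) v by (simp add: scale_def)
    show "act ?W 0 v = v" using v act_0[OF assms(1)] by (simp add: scale_def)
    show "act ?W (i + j) v = act ?W i (act ?W j v)" for i j
      using v act_add[OF assms(1)] by (simp add: scale_def algebra_simps)
    show "\<exists>n\<ge>1. v \<in> fixed_pts n ?W"
      using v zdeg_pos[OF assms(1) v(2)] unfolding F
      by (intro exI[of _ "zdeg V v"]) (simp add: fixed_pts_iff[OF assms(1)])
  next
    fix n :: nat assume "n \<ge> 1"
    then show "finite (fixed_pts n ?W)"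
      using finite_fixed_pts[OF assms(1), of "k * n"] assms(2) unfolding F by simp
  qed
  show "zdeg ?W v dvd n \<longleftrightarrow> zdeg V v dvd k * n" if "v \<in> W" for n
    using F[of n] that assms(3) fixed_pts_iff[OF A, of v n] fixed_pts_iff[OF assms(1), of v]
    by auto
qed

lemma scale_as_scaled_subset: "scale k V = (scale k V)\<lparr>pts := pts V\<rparr>"
  by (simp add: scale_def)

lemma admissible_scale: "admissible V \<Longrightarrow> k \<ge> 1 \<Longrightarrow> admissible (scale k V)"
  by (subst scale_as_scaled_subset) (simp add: admissible_scaled_subset act_closed)

lemma zdeg_scale_dvd_iff:
  "admissible V \<Longrightarrow> k \<ge> 1 \<Longrightarrow> v \<in> pts V \<Longrightarrow> zdeg (scale k V) v dvd n \<longleftrightarrow> zdeg V v dvd k * n"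
  by (subst scale_as_scaled_subset) (simp add: zdeg_scaled_subset_dvd_iff act_closed)

context
  fixes V :: "'v zset" and B :: "'b zset" and \<phi> and b
  assumes V: "admissible V" and B: "admissible B" and \<phi>: "zmorphism V B \<phi>" and b: "b \<in> pts B"
begin

private lemma fiber_invariant:
  "v \<in> {v \<in> pts V. \<phi> v = b} \<Longrightarrow> act V (int (zdeg B b) * j) v \<in> {v \<in> pts V. \<phi> v = b}"
  using \<phi> act_closed[OF V] act_fixed_iff[OF B b, of "int (zdeg B b) * j"]
  by (auto simp: zmorphism_def)

lemma admissible_fiber: "admissible (fiber V B \<phi> b)"
  unfolding fiber_def by (rule admissible_scaled_subset[OF V zdeg_pos[OF B b]])
    (use fiber_invariant in auto)

lemma fixed_pts_fiber:
  "fixed_pts n (fiber V B \<phi> b) = {v \<in> fixed_pts (n * zdeg B b) V. \<phi> v = b}"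
  unfolding fiber_def
  by (subst fixed_pts_scaled_subset[OF V zdeg_pos[OF B b]])
    (use fiber_invariant in \<open>auto simp: fixed_pts_def ac_simps\<close>)

text \<open>The stabilizer of a point is contained in that of its image, and the degree in the fiber is the index.\<close>

lemma zdeg_fiber:
  assumes "v \<in> pts V" "\<phi> v = b"
  shows "zdeg V v = zdeg B b * zdeg (fiber V B \<phi> b) v"
proof -
  have iff: "zdeg (fiber V B \<phi> b) v dvd n \<longleftrightarrow> zdeg V v dvd zdeg B b * n" for n
    unfolding fiber_def
    by (rule zdeg_scaled_subset_dvd_iff[OF V zdeg_pos[OF B b]])
      (use fiber_invariant assms in auto)
  have d: "zdeg B b dvd zdeg V v"
    using zdeg_dvd_of_zmorphism[OF V B \<phi> assms(1)] assms(2) by simp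
  then obtain e where e: "zdeg V v = zdeg B b * e" by blast
  have "zdeg (fiber V B \<phi> b) v dvd e" using iff[of e] e by simp
  moreover have "e dvd zdeg (fiber V B \<phi> b) v"
    using iff[of "zdeg (fiber V B \<phi> b) v"] e zdeg_pos[OF B b] by simp
  ultimately show ?thesis using e dvd_antisym by blast
qed

end

lemma admissible_zprod:
  assumes "admissible U" "admissible V"
  shows "admissible (zprod U V)"
    and fixed_pts_zprod: "fixed_pts k (zprod U V) = fixed_pts k U \<times> fixed_pts k V"
proof -
  show F: "fixed_pts k (zprod U V) = fixed_pts k U \<times> fixed_pts k V" for k
    by (auto simp: fixed_pts_def zprod_def)
  show "admissible (zprod U V)"
  proof (rule admissibleI)
    fix x assume "x \<in> pts (zprod U V)"
    then obtain u v where x: "x = (u, v)" "u \<in> pts U" "v \<in> pts V"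
      by (auto simp: zprod_def)
    have "u \<in> fixed_pts (zdeg U u * zdeg V v) U" "v \<in> fixed_pts (zdeg U u * zdeg V v) V"
      using x by (simp_all add: fixed_pts_iff assms)
    then have "x \<in> fixed_pts (zdeg U u * zdeg V v) (zprod U V)" by (simp add: F x)
    moreover have "zdeg U u * zdeg V v \<ge> 1"
      using zdeg_pos[OF assms(1) x(2)] zdeg_pos[OF assms(2) x(3)] by simp
    ultimately show "\<exists>k\<ge>1. x \<in> fixed_pts k (zprod U V)" by blast
  qed (auto simp: zprod_def F[unfolded zprod_def] act_closed act_0 act_add finite_fixed_pts assms)
qed

lemma zmorphism_fst: "zmorphism (zprod U V) U fst"
  and zmorphism_snd: "zmorphism (zprod U V) V snd"
  by (auto simp: zmorphism_def zprod_def)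

lemma admissible_zpoint: "admissible zpoint"
  by (rule admissibleI) (auto simp: zpoint_def fixed_pts_def)

lemma zmorphism_zpoint: "zmorphism V zpoint (\<lambda>_. ())"
  by (auto simp: zmorphism_def zpoint_def)

lemma zdeg_zpoint: "zdeg zpoint x = 1"
proof -
  have "zorbit zpoint x = {()}" by (auto simp: zorbit_eq)
  then show ?thesis by (simp add: zdeg_def)
qed


section \<open>Power series in infinitely many variables\<close>

lemma mcoeff_simps [simp]:
  "mcoeff 0 m = 0"
  "mcoeff 1 m = (if m = {#} then 1 else 0)"
  "mcoeff (F + G) m = mcoeff F m + mcoeff G m"
  "mcoeff (- F) m = - mcoeff F m"
  "mcoeff (F - G) m = mcoeff F m - mcoeff G m"
  for F G :: "'r::comm_ring_1 mps"
  by (simp_all add: zero_mps_def one_mps_def plus_mps_def uminus_mps_def minus_mps_def)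

lemma mcoeff_mult: "mcoeff (F * G) m = (\<Sum>(a, b) | a + b = m. mcoeff F a * mcoeff G b)"
  for F G :: "'r::comm_ring_1 mps"
  by (simp add: times_mps_def)

lemma mcoeff_mult_empty [simp]: "mcoeff (F * G) {#} = mcoeff F {#} * mcoeff G {#}"
  for F G :: "'r::comm_ring_1 mps"
proof -
  have "{(a :: nat multiset, b). a + b = {#}} = {({#}, {#})}" by auto
  then show ?thesis by (simp add: mcoeff_mult)
qed

lemma mcoeff_sum: "mcoeff (sum f S) m = (\<Sum>x\<in>S. mcoeff (f x) m)"
  for f :: "_ \<Rightarrow> 'r::comm_ring_1 mps"
  by (induction S rule: infinite_finite_induct) auto

lemma mcoeff_const_mult [simp]: "mcoeff (mps_const c * F) m = c * mcoeff F m"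
  for F :: "'r::comm_ring_1 mps"
proof -
  have "mcoeff (mps_const c * F) m =
      (\<Sum>(a, b) \<in> {({#} :: nat multiset, m)}. (if a = {#} then c else 0) * mcoeff F b)"
    unfolding mcoeff_mult mps_const_def mcoeff_Mps
    by (rule sum.mono_neutral_right) (auto simp: finite_mset_splits split: if_splits)
  then show ?thesis by simp
qed

lemma mcoeff_of_nat_mult: "mcoeff (of_nat n * F) m = of_nat n * mcoeff F m"
  for F :: "'r::comm_ring_1 mps"
  by (induction n) (auto simp: algebra_simps)

lemma mcoeff_h1: "mcoeff h1 m = (if size m = 1 then 1 else 0)"
  by (simp add: h1_def)

lemma mcoeff_const_h1: "mcoeff (mps_const c * h1) m = (if size m = 1 then c else 0)"
  for c :: "'r::comm_ring_1"
  by (simp add: mcoeff_h1)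

lemma const_h1_in_Fil1: "mps_const c * h1 \<in> Fil1" for c :: "'r::comm_ring_1"
  by (simp add: Fil1_def mcoeff_h1)

lemma Fil1_mult: "F \<in> Fil1 \<Longrightarrow> G * F \<in> Fil1" for F G :: "'r::comm_ring_1 mps"
  by (simp add: Fil1_def)

lemma Fil1_sum: "(\<And>x. x \<in> S \<Longrightarrow> f x \<in> Fil1) \<Longrightarrow> sum f S \<in> Fil1"
  for f :: "_ \<Rightarrow> 'r::comm_ring_1 mps"
  by (simp add: Fil1_def mcoeff_sum)

lemma mcoeff_power_empty: "mcoeff (F ^ n) {#} = mcoeff F {#} ^ n" for F :: "'r::comm_ring_1 mps"
  by (induction n) auto

lemma mcoeff_power_eq_0:
  fixes F :: "'r::comm_ring_1 mps"
  assumes "F \<in> Fil1" "size m < n"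
  shows "mcoeff (F ^ n) m = 0"
  using assms(2)
proof (induction n arbitrary: m)
  case (Suc n)
  have "mcoeff F a * mcoeff (F ^ n) b = 0" if "a + b = m" for a b
  proof (cases "a = {#}")
    case True
    then show ?thesis using assms by (simp add: Fil1_def)
  next
    case False
    then have "size b < n" using that Suc.prems by (auto simp: nonempty_has_size)
    then show ?thesis using Suc.IH by simp
  qed
  then show ?case by (auto simp: mcoeff_mult intro!: sum.neutral)
qed simp


subsection \<open>Agreement in low degree\<close>

definition agree :: "nat \<Rightarrow> 'r mps \<Rightarrow> 'r mps \<Rightarrow> bool" where
  "agree N F G \<longleftrightarrow> (\<forall>m. size m < N \<longrightarrow> mcoeff F m = mcoeff G m)"

lemma agree_refl [simp]: "agree N F F"
  by (simp add: agree_def)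

lemma agree_sym: "agree N F G \<Longrightarrow> agree N G F"
  by (simp add: agree_def)

lemma agree_trans [trans]: "agree N F G \<Longrightarrow> agree N G H \<Longrightarrow> agree N F H"
  by (simp add: agree_def)

lemma agree_mono: "agree N F G \<Longrightarrow> M \<le> N \<Longrightarrow> agree M F G"
  by (simp add: agree_def)

lemma agree_mult:
  fixes F G :: "'r::comm_ring_1 mps"
  assumes "agree N F F'" "agree N G G'"
  shows "agree N (F * G) (F' * G')"
  unfolding agree_def mcoeff_mult
  using assms by (auto simp: agree_def intro!: sum.cong)

text \<open>A splitting of a monomial contributes to a product of series without constant term only if
  both factors have strictly smaller degree, so multiplication gains one degree of agreement.\<close>

lemma agree_mult_Fil1:
  fixes F G :: "'r::comm_ring_1 mps"
  assumes "agree N F F'" "agree N G G'" "F \<in> Fil1" "F' \<in> Fil1" "G \<in> Fil1" "G' \<in> Fil1"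
  shows "agree (Suc N) (F * G) (F' * G')"
  unfolding agree_def
proof (intro allI impI)
  fix m :: "nat multiset" assume m: "size m < Suc N"
  have "mcoeff F a * mcoeff G b = mcoeff F' a * mcoeff G' b" if "a + b = m" for a b
  proof (cases "a = {#} \<or> b = {#}")
    case True
    then show ?thesis using assms(3-6) by (auto simp: Fil1_def)
  next
    case False
    then have "size a < N" "size b < N" using that m by (auto simp: nonempty_has_size)
    then show ?thesis using assms(1,2) by (simp add: agree_def)
  qed
  then show "mcoeff (F * G) m = mcoeff (F' * G') m"
    unfolding mcoeff_mult by (auto intro!: sum.cong)
qed

lemma agree_power:
  "agree N F F' \<Longrightarrow> agree N (F ^ n) (F' ^ n)" for F F' :: "'r::comm_ring_1 mps"
  by (induction n) (auto intro: agree_mult)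

lemma agree_sum:
  "(\<And>x. x \<in> S \<Longrightarrow> agree N (f x) (g x)) \<Longrightarrow> agree N (sum f S) (sum g S)"
  for f g :: "_ \<Rightarrow> 'r::comm_ring_1 mps"
  by (simp add: agree_def mcoeff_sum)

lemma agree_prod:
  "(\<And>x. x \<in> S \<Longrightarrow> agree N (f x) (g x)) \<Longrightarrow> agree N (prod f S) (prod g S)"
  for f g :: "_ \<Rightarrow> 'r::comm_ring_1 mps"
  by (induction S rule: infinite_finite_induct) (auto intro: agree_mult)


subsection \<open>The exponential over \<open>\<complex>\<close>\<close>

definition cexp :: "complex mps \<Rightarrow> complex mps" where
  "cexp G = Mps (\<lambda>m. \<Sum>n\<le>size m. mcoeff (G ^ n) m / fact n)"

lemma mcoeff_cexp:
  assumes "G \<in> Fil1" "size m \<le> N"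
  shows "mcoeff (cexp G) m = (\<Sum>n\<le>N. mcoeff (G ^ n) m / fact n)"
  unfolding cexp_def mcoeff_Mps
  by (rule sum.mono_neutral_left) (use assms mcoeff_power_eq_0[OF assms(1)] in \<open>auto simp: not_le\<close>)

lemma mcoeff_cexp_empty [simp]: "mcoeff (cexp G) {#} = 1"
  by (simp add: cexp_def)

lemma agree_cexp: "agree N F G \<Longrightarrow> agree N (cexp F) (cexp G)"
  unfolding agree_def[of N "cexp F"] cexp_def mcoeff_Mps
  using agree_power[of N F G] by (auto simp: agree_def intro!: sum.cong)

text \<open>The derivation \<open>\<Sum>\<^sub>i t\<^sub>i \<partial>/\<partial>t\<^sub>i\<close>. The exponential is the solution of a first-order linear equation for
  it, which determines a series from its constant term; this gives the functional equation without
  any rearrangement of sums.\<close>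

definition euler_deriv :: "complex mps \<Rightarrow> complex mps" where
  "euler_deriv F = Mps (\<lambda>m. of_nat (size m) * mcoeff F m)"

lemma mcoeff_euler_deriv [simp]: "mcoeff (euler_deriv F) m = of_nat (size m) * mcoeff F m"
  by (simp add: euler_deriv_def)

lemma euler_deriv_mult: "euler_deriv (F * G) = euler_deriv F * G + F * euler_deriv G"
proof (rule mps_eqI)
  fix m
  have "of_nat (size m) * (\<Sum>(a, b) | a + b = m. mcoeff F a * mcoeff G b) =
      (\<Sum>(a, b) | a + b = m. (of_nat (size a) * mcoeff F a) * mcoeff G b) +
      (\<Sum>(a, b) | a + b = m. mcoeff F a * (of_nat (size b) * mcoeff G b))"
    unfolding sum_distrib_left sum.distrib[symmetric]
    by (intro sum.cong) (auto simp: algebra_simps)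
  then show "mcoeff (euler_deriv (F * G)) m = mcoeff (euler_deriv F * G + F * euler_deriv G) m"
    by (simp add: mcoeff_mult)
qed

lemma euler_deriv_add: "euler_deriv (F + G) = euler_deriv F + euler_deriv G"
  by (rule mps_eqI) (simp add: algebra_simps)

lemma euler_deriv_power: "euler_deriv (G ^ Suc n) = of_nat (Suc n) * (euler_deriv G * G ^ n)"
proof (induction n)
  case (Suc n)
  have "euler_deriv (G ^ Suc (Suc n)) = euler_deriv G * G ^ Suc n + G * euler_deriv (G ^ Suc n)"
    by (subst power_Suc) (rule euler_deriv_mult)
  also have "\<dots> = of_nat (Suc (Suc n)) * (euler_deriv G * G ^ Suc n)"
    unfolding Suc.IH by (simp add: algebra_simps)
  finally show ?case .
qed simp

lemma euler_deriv_cexp: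
  assumes "G \<in> Fil1"
  shows "euler_deriv (cexp G) = euler_deriv G * cexp G"
proof (rule mps_eqI)
  fix m :: "nat multiset"
  let ?N = "size m"
  have "mcoeff (euler_deriv (cexp G)) m = (\<Sum>n\<le>Suc ?N. mcoeff (euler_deriv (G ^ n)) m / fact n)"
    by (simp add: mcoeff_cexp[OF assms, of m "Suc ?N"] sum_distrib_left del: sum.atMost_Suc)
  also have "\<dots> = (\<Sum>n\<le>?N. mcoeff (euler_deriv (G ^ Suc n)) m / fact (Suc n))"
    by (subst sum.atMost_Suc_shift) simp
  also have "\<dots> = (\<Sum>n\<le>?N. mcoeff (euler_deriv G * G ^ n) m / fact n)"
    unfolding euler_deriv_power mcoeff_of_nat_mult
    by (intro sum.cong) (simp_all add: divide_simps del: of_nat_Suc)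
  also have "\<dots> = (\<Sum>(a, b) | a + b = m. \<Sum>n\<le>?N. mcoeff (euler_deriv G) a * mcoeff (G ^ n) b / fact n)"
    unfolding mcoeff_mult sum_divide_distrib case_prod_unfold by (rule sum.swap)
  also have "\<dots> = mcoeff (euler_deriv G * cexp G) m"
    unfolding mcoeff_mult
    by (auto simp: mcoeff_cexp[OF assms, of _ ?N] sum_distrib_left intro!: sum.cong)
  finally show "mcoeff (euler_deriv (cexp G)) m = mcoeff (euler_deriv G * cexp G) m" .
qed

text \<open>The coefficient of a monomial of degree \<open>n > 0\<close> is multiplied by \<open>n\<close> on the left and expressed by
  coefficients of lower degree on the right.\<close>

lemma euler_deriv_eq_unique:
  assumes "euler_deriv E = P * E" "euler_deriv E' = P * E'" "P \<in> Fil1"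
    and "mcoeff E {#} = mcoeff E' {#}"
  shows "E = E'"
proof (rule mps_eqI)
  fix m show "mcoeff E m = mcoeff E' m"
  proof (induction "size m" arbitrary: m rule: less_induct)
    case less
    show ?case
    proof (cases "m = {#}")
      case False
      have "mcoeff P a * mcoeff E b = mcoeff P a * mcoeff E' b" if "a + b = m" for a b
        using less[of b] that assms(3) by (cases "a = {#}") (auto simp: Fil1_def nonempty_has_size)
      then have "mcoeff (P * E) m = mcoeff (P * E') m"
        unfolding mcoeff_mult by (auto intro!: sum.cong)
      then have "of_nat (size m) * mcoeff E m = of_nat (size m) * mcoeff E' m"
        using arg_cong[OF assms(1), of "\<lambda>F. mcoeff F m"] arg_cong[OF assms(2), of "\<lambda>F. mcoeff F m"]
        by simp
      then show ?thesis using False by simp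
    qed (use assms in simp)
  qed
qed

lemma cexp_add:
  assumes "F \<in> Fil1" "G \<in> Fil1"
  shows "cexp (F + G) = cexp F * cexp G"
proof (rule euler_deriv_eq_unique)
  show "euler_deriv (cexp (F + G)) = (euler_deriv F + euler_deriv G) * cexp (F + G)"
    using assms by (subst euler_deriv_cexp) (auto simp: Fil1_def euler_deriv_add)
  show "euler_deriv (cexp F * cexp G) = (euler_deriv F + euler_deriv G) * (cexp F * cexp G)"
    using assms by (simp add: euler_deriv_mult euler_deriv_cexp algebra_simps)
qed (auto simp: Fil1_def)

lemma cexp_0: "cexp 0 = 1"
  by (rule euler_deriv_eq_unique[of _ 0])
    (auto intro!: mps_eqI simp: Fil1_def cexp_def power_0_left if_distrib[of "\<lambda>x. mcoeff x _"] cong: if_cong)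

lemma cexp_sum:
  assumes "finite S" "\<And>x. x \<in> S \<Longrightarrow> f x \<in> Fil1"
  shows "cexp (sum f S) = (\<Prod>x\<in>S. cexp (f x))"
  using assms
  by (induction S rule: finite_induct) (auto simp: cexp_0 cexp_add Fil1_sum)


subsection \<open>The substitution \<open>t\<^sub>n \<mapsto> t\<^sub>n\<^sup>j\<close>\<close>

text \<open>The action of the Adams operation \<open>p\<^sub>j\<close> on the variables. Its action on \<open>W(\<complex>)\<close> is accounted for separately,
  by passing from the ghost component \<open>k\<close> to \<open>j k\<close>.\<close>

definition psi :: "nat \<Rightarrow> 'r::comm_ring_1 mps \<Rightarrow> 'r mps" where
  "psi j F = Mps (\<lambda>m. \<Sum>n | repeat_mset j n = m. mcoeff F n)"

lemma mcoeff_psi: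
  assumes "j \<ge> 1"
  shows "mcoeff (psi j F) (repeat_mset j n) = mcoeff F n"
    and "(\<And>n. m \<noteq> repeat_mset j n) \<Longrightarrow> mcoeff (psi j F) m = 0"
proof -
  have "{n'. repeat_mset j n' = repeat_mset j n} = {n}"
    using assms by (auto simp: repeat_mset_cancel1)
  then show "mcoeff (psi j F) (repeat_mset j n) = mcoeff F n"
    by (simp add: psi_def)
  assume "\<And>n. m \<noteq> repeat_mset j n"
  then have "{n. repeat_mset j n = m} = {}" by auto
  then show "mcoeff (psi j F) m = 0" unfolding psi_def mcoeff_Mps by (metis sum.empty)
qed

lemma psi_cases:
  assumes "j \<ge> 1"
  obtains n where "m = repeat_mset j n" "\<And>F :: 'r::comm_ring_1 mps. mcoeff (psi j F) m = mcoeff F n"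
  | "\<And>n. m \<noteq> repeat_mset j n" "\<And>F :: 'r::comm_ring_1 mps. mcoeff (psi j F) m = 0"
  using mcoeff_psi[OF assms] by metis

lemma psi_eqI:
  assumes "j \<ge> 1" "\<And>n. mcoeff G (repeat_mset j n) = mcoeff F n"
    and "\<And>m. (\<And>n. m \<noteq> repeat_mset j n) \<Longrightarrow> mcoeff G m = 0"
  shows "psi j F = G"
  by (rule mps_eqI) (metis assms mcoeff_psi)

lemma psi_add: "j \<ge> 1 \<Longrightarrow> psi j (F + G) = psi j F + psi j G"
  by (rule psi_eqI) (auto simp: mcoeff_psi)

lemma psi_0: "psi j 0 = 0"
  by (auto intro!: mps_eqI simp: psi_def)

lemma psi_1: "j \<ge> 1 \<Longrightarrow> psi j 1 = 1"
proof (rule psi_eqI)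
  fix m :: "nat multiset" assume "\<And>n. m \<noteq> repeat_mset j n"
  from this[of "{#}"] show "mcoeff 1 m = 0" by simp
qed (auto simp: repeat_mset_eq_empty_iff)

lemma psi_const_mult: "j \<ge> 1 \<Longrightarrow> psi j (mps_const c * F) = mps_const c * psi j F"
  by (rule psi_eqI) (auto simp: mcoeff_psi)

lemma psi_mult:
  assumes j: "j \<ge> 1"
  shows "psi j (F * G) = psi j F * psi j G"
proof (rule psi_eqI[OF j])
  fix n :: "nat multiset"
  let ?r = "repeat_mset j :: nat multiset \<Rightarrow> _"
  have "mcoeff (psi j F * psi j G) (?r n) =
      (\<Sum>(a, b) \<in> map_prod ?r ?r ` {(a, b). a + b = n}. mcoeff (psi j F) a * mcoeff (psi j G) b)"
    unfolding mcoeff_mult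
  proof (rule sum.mono_neutral_right)
    show "\<forall>p\<in>{(a, b). a + b = ?r n} - map_prod ?r ?r ` {(a, b). a + b = n}.
        (case p of (a, b) \<Rightarrow> mcoeff (psi j F) a * mcoeff (psi j G) b) = 0"
    proof safe
      fix a b :: "nat multiset"
      assume ab: "a + b = ?r n" "(a, b) \<notin> map_prod ?r ?r ` {(a, b). a + b = n}"
      have "\<not> (a = ?r a' \<and> b = ?r b')" for a' b'
      proof
        assume *: "a = ?r a' \<and> b = ?r b'"
        then have "?r (a' + b') = ?r n" using ab by simp
        then have "a' + b' = n" using j repeat_mset_cancel1[of j "a' + b'" n] by auto
        then show False using ab(2) * by force
      qed
      then consider "\<And>n. a \<noteq> ?r n" | "\<And>n. b \<noteq> ?r n" by blast
      then show "mcoeff (psi j F) a * mcoeff (psi j G) b = 0"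
        by cases (simp_all add: mcoeff_psi(2)[OF j])
    qed
  qed (auto simp: finite_mset_splits simp flip: repeat_mset_distrib2)
  also have "\<dots> = (\<Sum>(a, b) | a + b = n. mcoeff F a * mcoeff G b)"
    using j by (subst sum.reindex)
      (auto simp: inj_on_def repeat_mset_cancel1 case_prod_unfold mcoeff_psi)
  finally show "mcoeff (psi j F * psi j G) (?r n) = mcoeff (F * G) n"
    by (simp add: mcoeff_mult)
next
  fix m :: "nat multiset" assume m: "\<And>n. m \<noteq> repeat_mset j n"
  have "mcoeff (psi j F) a * mcoeff (psi j G) b = 0" if "a + b = m" for a b
  proof -
    have "\<not> (a = repeat_mset j a' \<and> b = repeat_mset j b')" for a' b'
      using m[of "a' + b'"] that by auto
    then consider "\<And>n. a \<noteq> repeat_mset j n" | "\<And>n. b \<noteq> repeat_mset j n" by blast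
    then show ?thesis by cases (simp_all add: mcoeff_psi(2)[OF j])
  qed
  then show "mcoeff (psi j F * psi j G) m = 0"
    unfolding mcoeff_mult by (auto intro!: sum.neutral)
qed

lemma psi_sum_distrib: "j \<ge> 1 \<Longrightarrow> psi j (sum f S) = (\<Sum>x\<in>S. psi j (f x))"
  by (induction S rule: infinite_finite_induct) (auto simp: psi_0 psi_add)

lemma psi_power: "j \<ge> 1 \<Longrightarrow> psi j (F ^ n) = psi j F ^ n"
  by (induction n) (auto simp: psi_1 psi_mult)

lemma psi_psi: "i \<ge> 1 \<Longrightarrow> j \<ge> 1 \<Longrightarrow> psi i (psi j F) = psi (i * j) F"
proof (rule psi_eqI[symmetric])
  assume ij: "i \<ge> 1" "j \<ge> 1"
  show "mcoeff (psi i (psi j F)) (repeat_mset (i * j) n) = mcoeff F n" for n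
    using mcoeff_psi(1)[OF ij(1), of "psi j F" "repeat_mset j n"] mcoeff_psi(1)[OF ij(2), of F n]
    by simp
  fix m :: "nat multiset" assume m: "\<And>n. m \<noteq> repeat_mset (i * j) n"
  show "mcoeff (psi i (psi j F)) m = 0"
  proof (cases rule: psi_cases[OF ij(1), of m, where 'r = 'a])
    case (1 n)
    then have "n \<noteq> repeat_mset j n'" for n' using m[of n'] by auto
    then have "mcoeff (psi j F) n = 0" by (rule mcoeff_psi(2)[OF ij(2)])
    then show ?thesis using 1(2)[of "psi j F"] by simp
  qed auto
qed simp

lemma psi_in_Fil1: "j \<ge> 1 \<Longrightarrow> F \<in> Fil1 \<Longrightarrow> psi j F \<in> Fil1"
  using mcoeff_psi(1)[of j F "{#}"] by (simp add: Fil1_def)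

lemma agree_psi: "j \<ge> 1 \<Longrightarrow> agree N F G \<Longrightarrow> agree N (psi j F) (psi j G)"
  unfolding agree_def
proof (intro allI impI)
  fix m :: "nat multiset"
  assume j: "j \<ge> 1" and a: "\<forall>m. size m < N \<longrightarrow> mcoeff F m = mcoeff G m" and m: "size m < N"
  show "mcoeff (psi j F) m = mcoeff (psi j G) m"
  proof (cases rule: psi_cases[OF j, of m, where 'r = 'a])
    case (1 n)
    then have "size n \<le> size m" using j by (cases j) auto
    then have "size n < N" using m by simp
    then show ?thesis unfolding 1(2) using a by blast
  qed simp
qed

lemma mcoeff_psi_eq_0:
  assumes "F \<in> Fil1" "size m < j"
  shows "mcoeff (psi j F) m = 0"
proof -
  have j: "j \<ge> 1" using assms by simp
  show ?thesis
  proof (cases rule: psi_cases[OF j, of m, where 'r = 'a])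
    case (1 n)
    then have "n = {#}" using assms(2) by (auto simp: nonempty_has_size)
    then show ?thesis using 1 assms(1) by (simp add: Fil1_def)
  qed auto
qed

lemma psi_cexp:
  assumes "j \<ge> 1" "G \<in> Fil1"
  shows "psi j (cexp G) = cexp (psi j G)"
proof (rule psi_eqI[OF assms(1)])
  fix n :: "nat multiset"
  have "size n \<le> size (repeat_mset j n)" using assms(1) by (cases j) auto
  then have "mcoeff (cexp G) n = (\<Sum>i\<le>size (repeat_mset j n). mcoeff (G ^ i) n / fact i)"
    using mcoeff_cexp assms by blast
  then show "mcoeff (cexp (psi j G)) (repeat_mset j n) = mcoeff (cexp G) n"
    by (simp add: cexp_def psi_power[OF assms(1), symmetric] mcoeff_psi(1)[OF assms(1)])
next
  fix m :: "nat multiset" assume "\<And>n. m \<noteq> repeat_mset j n"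
  then show "mcoeff (cexp (psi j G)) m = 0"
    by (simp add: cexp_def psi_power[OF assms(1), symmetric] mcoeff_psi(2)[OF assms(1)])
qed


section \<open>Ghost components of integrals\<close>

lemma div_ge_1: "(d :: nat) dvd k \<Longrightarrow> k \<ge> 1 \<Longrightarrow> k div d \<ge> 1"
  using dvd_imp_le[of d k] dvd_pos_nat[of k d] div_greater_zero_iff[of k d] by linarith

lemma ghost_sum: "ghost (sum f S) k = (\<Sum>x\<in>S. ghost (f x) k)"
  by (induction S rule: infinite_finite_induct) auto

lemma ghost_of_nat: "k \<ge> 1 \<Longrightarrow> ghost (of_nat n) k = of_nat n"
  by (induction n) auto

lemma ghost_divide [simp]: "k \<ge> 1 \<Longrightarrow> ghost (w / v) k = ghost w k / ghost v k"
  by (simp add: divide_witt_def)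

lemma ghost_witt_adams [simp]: "k \<ge> 1 \<Longrightarrow> ghost (witt_adams i w) k = ghost w (i * k)"
  by (simp add: witt_adams_def)

text \<open>Convergence in \<^typ>\<open>witt\<close> is convergence of each ghost component, so an infinite sum exists as soon as
  each ghost component has only finitely many nonzero terms.\<close>

lemma ghost_infsum:
  assumes fin: "\<And>k. k \<ge> 1 \<Longrightarrow> finite {q \<in> Q. ghost (f q) k \<noteq> 0}" and "k \<ge> 1"
  shows "ghost (infsum f Q) k = (\<Sum>q | q \<in> Q \<and> ghost (f q) k \<noteq> 0. ghost (f q) k)"
proof -
  define w where "w = of_ghost (\<lambda>k. \<Sum>q | q \<in> Q \<and> ghost (f q) k \<noteq> 0. ghost (f q) k)"
  have "((\<lambda>q. ghost (f q) k) has_sum ghost w k) Q" if "k \<ge> 1" for k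
    by (rule has_sum_finite_neutralI[OF fin[OF that]]) (use that in \<open>auto simp: w_def\<close>)
  then have "(f has_sum w) Q"
    unfolding has_sum_def tendsto_witt_iff ghost_sum by blast
  then have "infsum f Q = w" by (rule infsumI)
  then show ?thesis using assms(2) by (simp add: w_def)
qed

lemma fps_nth_compose_X_power:
  fixes a :: "'r::comm_ring_1 fps"
  assumes "n \<ge> 1"
  shows "fps_nth (fps_compose a (fps_X ^ n)) k = (if n dvd k then fps_nth a (k div n) else 0)"
proof -
  have "fps_nth (fps_compose a (fps_X ^ n)) k = (\<Sum>i=0..k. fps_nth a i * (if k = n * i then 1 else 0))"
    by (simp add: fps_compose_nth fps_X_power_nth flip: power_mult)
  also have "\<dots> = (\<Sum>i=0..k. if i = k div n then (if n dvd k then fps_nth a (k div n) else 0) else 0)"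
    using assms by (intro sum.cong) auto
  also have "\<dots> = (if n dvd k then fps_nth a (k div n) else 0)"
    by (simp add: sum.delta)
  finally show ?thesis .
qed

lemma ghost_witt_subst:
  assumes "n \<ge> 1"
  shows "ghost (witt_subst n w) k = (if n dvd k then of_nat n * ghost w (k div n) else 0)"
proof -
  let ?w = "witt_series w" and ?Y = "fps_X ^ n :: complex fps"
  have Y0: "fps_nth ?Y 0 = 0" using assms by simp
  have ser: "witt_series (witt_subst n w) = fps_compose ?w ?Y"
    unfolding witt_subst_def using assms by (subst Witt_inverse) auto
  have "fps_X * fps_deriv (fps_compose ?w ?Y) =
      of_nat n * (fps_compose (fps_deriv ?w) ?Y * (fps_X * fps_X ^ (n - 1)))"
    by (simp add: fps_compose_deriv[OF Y0] fps_deriv_power fps_of_nat ac_simps)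
  also have "fps_X * fps_X ^ (n - 1) = ?Y"
    using assms by (simp flip: power_Suc)
  also have "fps_compose (fps_deriv ?w) ?Y * ?Y = fps_compose (fps_X * fps_deriv ?w) ?Y"
    using Y0 by (simp add: fps_compose_mult_distrib[OF Y0] mult.commute)
  also have "\<dots> = fps_compose (Abs_fps (ghost w)) ?Y * fps_compose ?w ?Y"
    by (simp add: ghost_series fps_compose_mult_distrib[OF Y0])
  finally have "ghost (witt_subst n w) = fps_nth (of_nat n * fps_compose (Abs_fps (ghost w)) ?Y)"
    by (intro ghost_unique) (simp add: ser mult.assoc)
  then show ?thesis
    by (simp add: fps_nth_compose_X_power[OF assms] fps_of_nat[symmetric] del: fps_of_nat)
qed

lemma witt_subst_1_eq: "n \<ge> 1 \<Longrightarrow> witt_subst n 1 = Witt (inverse (1 - fps_X ^ n))"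
proof -
  assume "n \<ge> 1"
  then have Y0: "fps_nth (fps_X ^ n :: complex fps) 0 = 0" by simp
  show ?thesis
    by (simp add: witt_subst_def one_witt_def Witt_inverse fps_inverse_compose[OF Y0]
        fps_compose_sub_distrib)
       (use \<open>n \<ge> 1\<close> in simp)
qed

lemma zorbits_card:
  assumes "admissible V" "q \<in> zorbits V" "v \<in> q"
  shows "v \<in> pts V" "card q = zdeg V v" "zorbit V v = q"
proof -
  obtain u where u: "u \<in> pts V" "q = zorbit V u" using assms(2) by (auto simp: zorbits_eq)
  then show "v \<in> pts V" using zorbit_sub[OF assms(1)] assms(3) by auto
  show "zorbit V v = q" using zorbit_eq_of_mem[OF assms(1) u(1)] u(2) assms(3) by simp
  then show "card q = zdeg V v" by (simp add: zdeg_def)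
qed

lemma zorbits_nonempty: "admissible V \<Longrightarrow> q \<in> zorbits V \<Longrightarrow> q \<noteq> {}"
  using zorbit_self by (fastforce simp: zorbits_eq)

lemma orbits_of_fixed_pts:
  assumes V: "admissible V"
  shows "zorbit V ` fixed_pts k V = {q \<in> zorbits V. card q dvd k}"
  by (auto simp: zorbits_eq fixed_pts_iff[OF V] zdeg_def)

lemma sum_fixed_pts_by_orbits:
  fixes g :: "'v set \<Rightarrow> complex"
  assumes V: "admissible V" and k: "k \<ge> 1"
  shows "(\<Sum>v\<in>fixed_pts k V. g (zorbit V v)) = (\<Sum>q | q \<in> zorbits V \<and> card q dvd k. of_nat (card q) * g q)"
proof -
  have "(\<Sum>v\<in>fixed_pts k V. g (zorbit V v)) =
      (\<Sum>q\<in>zorbit V ` fixed_pts k V. \<Sum>v | v \<in> fixed_pts k V \<and> zorbit V v = q. g (zorbit V v))"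
    by (rule sum.image_gen[OF finite_fixed_pts[OF V k]])
  also have "\<dots> = (\<Sum>q | q \<in> zorbits V \<and> card q dvd k. of_nat (card q) * g q)"
    unfolding orbits_of_fixed_pts[OF V]
  proof (rule sum.cong[OF refl])
    fix q assume q: "q \<in> {q \<in> zorbits V. card q dvd k}"
    have "v \<in> fixed_pts k V \<and> zorbit V v = q \<longleftrightarrow> v \<in> q" for v
    proof
      assume "v \<in> fixed_pts k V \<and> zorbit V v = q"
      then show "v \<in> q" using zorbit_self[OF V, of v] by (simp add: fixed_pts_iff[OF V])
    next
      assume "v \<in> q"
      then show "v \<in> fixed_pts k V \<and> zorbit V v = q"
        using zorbits_card[OF V, of q v] q by (simp add: fixed_pts_iff[OF V])
    qed
    then have "{v \<in> fixed_pts k V. zorbit V v = q} = q" by blast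
    moreover have "(\<Sum>v | v \<in> fixed_pts k V \<and> zorbit V v = q. g (zorbit V v)) =
        (\<Sum>v | v \<in> fixed_pts k V \<and> zorbit V v = q. g q)"
      by (rule sum.cong) auto
    ultimately show "(\<Sum>v | v \<in> fixed_pts k V \<and> zorbit V v = q. g (zorbit V v)) = of_nat (card q) * g q"
      by simp
  qed
  finally show ?thesis .
qed

lemma CW_zorbit:
  assumes "f \<in> CW V" "v \<in> pts V"
  shows "f ` zorbit V v = {f v}"
  using assms by (auto simp: CW_def zorbit_eq image_image)

text \<open>An orbit of cardinality \<open>n\<close> contributes \<open>f(t\<^sup>n)\<close>, whose \<open>k\<close>-th ghost component is \<open>n\<close> times a ghost component of
  \<open>f\<close> when \<open>n\<close> divides \<open>k\<close> and vanishes otherwise. The factor \<open>n\<close> turns the sum over orbits into a sum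
  over points.\<close>

lemma ghost_orbit_sum:
  assumes V: "admissible V" and f: "f \<in> CW V" and k: "k \<ge> 1"
  shows "ghost (\<Sum>\<^sub>\<infinity>q\<in>zorbits V. witt_subst (card q) (the_elem (f ` q))) k =
    (\<Sum>v\<in>fixed_pts k V. ghost (f v) (k div zdeg V v))"
proof -
  let ?F = "\<lambda>q. witt_subst (card q) (the_elem (f ` q))"
  let ?Q = "\<lambda>k. {q \<in> zorbits V. card q dvd k}"
  have gh: "ghost (?F q) k = (if card q dvd k then of_nat (card q) * ghost (the_elem (f ` q)) (k div card q) else 0)"
    if q: "q \<in> zorbits V" for q k
  proof -
    obtain v where "v \<in> q" using zorbits_nonempty[OF V q] by auto
    then have "card q \<ge> 1" using zorbits_card[OF V q] zdeg_pos[OF V] by metis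
    then show ?thesis by (rule ghost_witt_subst)
  qed
  have sub: "{q \<in> zorbits V. ghost (?F q) k \<noteq> 0} \<subseteq> ?Q k" for k
    using gh by (auto split: if_splits)
  have fin: "finite (?Q k)" if "k \<ge> 1" for k
    unfolding orbits_of_fixed_pts[OF V, symmetric] using finite_fixed_pts[OF V that] by simp
  have "ghost (infsum ?F (zorbits V)) k = (\<Sum>q | q \<in> zorbits V \<and> ghost (?F q) k \<noteq> 0. ghost (?F q) k)"
    using finite_subset[OF sub fin] k by (intro ghost_infsum) auto
  also have "\<dots> = (\<Sum>q\<in>?Q k. ghost (?F q) k)"
    using fin[OF k] sub by (intro sum.mono_neutral_left) auto
  also have "\<dots> = (\<Sum>q\<in>?Q k. of_nat (card q) * ghost (the_elem (f ` q)) (k div card q))"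
    by (intro sum.cong) (auto simp: gh)
  also have "\<dots> = (\<Sum>v\<in>fixed_pts k V. ghost (the_elem (f ` zorbit V v)) (k div card (zorbit V v)))"
    by (rule sum_fixed_pts_by_orbits[OF V k, symmetric])
  also have "\<dots> = (\<Sum>v\<in>fixed_pts k V. ghost (f v) (k div zdeg V v))"
    using f by (intro sum.cong) (auto simp: CW_zorbit fixed_pts_iff[OF V] zdeg_def)
  finally show ?thesis .
qed

text \<open>The same count for the constant function \<open>1\<close>, since \<open>1 \<in> W(\<complex>)\<close> is the series \<open>1 / (1 - t)\<close>.\<close>

lemma ghost_zclass:
  assumes V: "admissible V" and k: "k \<ge> 1"
  shows "ghost (zclass V) k = of_nat (card (fixed_pts k V))"
proof -
  have "zclass V = (\<Sum>\<^sub>\<infinity>q\<in>zorbits V. witt_subst (card q) (the_elem ((\<lambda>_. 1) ` q)))"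
    unfolding zclass_def
  proof (rule infsum_cong)
    fix q assume q: "q \<in> zorbits V"
    obtain v where "v \<in> q" using zorbits_nonempty[OF V q] by auto
    moreover from this have "card q \<ge> 1" using zorbits_card[OF V q] zdeg_pos[OF V] by metis
    ultimately show "Witt (inverse (1 - fps_X ^ card q)) = witt_subst (card q) (the_elem ((\<lambda>_. 1) ` q))"
      by (auto simp: witt_subst_1_eq image_constant_conv)
  qed
  moreover have "k div zdeg V v \<ge> 1" if "v \<in> fixed_pts k V" for v
    using that k by (auto simp: fixed_pts_iff[OF V] elim!: dvdE)
  ultimately show ?thesis
    using ghost_orbit_sum[OF V, of "\<lambda>_. 1" k] k by (simp add: CW_def)
qed

definition fiber_pts :: "'v zset \<Rightarrow> ('v \<Rightarrow> 'b) \<Rightarrow> nat \<Rightarrow> 'b \<Rightarrow> 'v set" where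
  "fiber_pts V \<phi> k b = {v \<in> fixed_pts k V. \<phi> v = b}"

text \<open>For \<open>K\<close> a multiple of the degree of \<open>v\<close>, the \<open>(K / deg v)\<close>-th ghost component at \<open>v\<close> is the natural
  coordinate of a function: it is preserved by pullback, and integration over fibers becomes the sum
  over the points of the fiber fixed by \<open>K\<int>\<close>.\<close>

context
  fixes V :: "'v zset" and B :: "'b zset" and \<phi> :: "'v \<Rightarrow> 'b" and f :: "'v \<Rightarrow> witt" and b :: 'b and K :: nat
  assumes V: "admissible V" and B: "admissible B" and \<phi>: "zmorphism V B \<phi>" and b: "b \<in> pts B"
    and f: "f \<in> CW V" and K: "K \<ge> 1" "zdeg B b dvd K"
begin

private lemma K_div: "K div zdeg B b \<ge> 1" "K div zdeg B b * zdeg B b = K"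
  using K by (auto elim!: dvdE)

lemma finite_fiber_pts: "finite (fiber_pts V \<phi> K b)"
  unfolding fiber_pts_def using finite_fixed_pts[OF V K(1)] by simp

lemma ghost_fiber_int:
  "ghost (fiber_int V B \<phi> f b) (K div zdeg B b) =
    (\<Sum>v\<in>fiber_pts V \<phi> K b. ghost (f v) (K div zdeg V v))"
proof -
  have "f \<in> CW (fiber V B \<phi> b)"
    using f by (auto simp: CW_def fiber_def scale_def)
  from ghost_orbit_sum[OF admissible_fiber[OF V B \<phi> b] this K_div(1)]
  have "ghost (fiber_int V B \<phi> f b) (K div zdeg B b) =
      (\<Sum>v\<in>fiber_pts V \<phi> K b. ghost (f v) (K div zdeg B b div zdeg (fiber V B \<phi> b) v))"
    by (simp add: fiber_int_def fixed_pts_fiber[OF V B \<phi> b] K_div fiber_pts_def)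
  also have "\<dots> = (\<Sum>v\<in>fiber_pts V \<phi> K b. ghost (f v) (K div zdeg V v))"
    by (intro sum.cong)
      (auto simp: fiber_pts_def fixed_pts_iff[OF V] zdeg_fiber[OF V B \<phi> b] div_mult2_eq)
  finally show ?thesis .
qed

lemma ghost_expect:
  "ghost (expect V B \<phi> f b) (K div zdeg B b) =
    (\<Sum>v\<in>fiber_pts V \<phi> K b. ghost (f v) (K div zdeg V v)) / of_nat (card (fiber_pts V \<phi> K b))"
  unfolding expect_def ghost_divide[OF K_div(1)] ghost_fiber_int
  by (simp add: ghost_zclass[OF admissible_fiber[OF V B \<phi> b] K_div(1)]
      fixed_pts_fiber[OF V B \<phi> b] K_div fiber_pts_def)

end

lemma ghost_pullback:
  assumes "admissible V" "admissible B" "zmorphism V B \<phi>" "v \<in> pts V" "zdeg V v dvd K" "K \<ge> 1"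
  shows "ghost (pullback V B \<phi> g v) (K div zdeg V v) = ghost (g (\<phi> v)) (K div zdeg B (\<phi> v))"
proof -
  obtain e where e: "K = zdeg V v * e" using assms(5) by blast
  obtain c where c: "zdeg V v = zdeg B (\<phi> v) * c"
    using zdeg_dvd_of_zmorphism[OF assms(1-4)] by blast
  have "e \<ge> 1" "c \<ge> 1" "zdeg B (\<phi> v) \<ge> 1" "zdeg V v \<ge> 1"
    using assms(6) e c zdeg_pos[OF assms(1,4)] by (auto simp: Suc_le_eq intro!: Nat.gr0I)
  then show ?thesis
    by (simp add: pullback_def e c)
qed

lemma pullback_in_CW:
  assumes "admissible V" "admissible B" "zmorphism V B \<phi>" "g \<in> CW B"
  shows "pullback V B \<phi> g \<in> CW V"
proof -
  have "\<phi> v \<in> pts B \<and> \<phi> (act V j v) = act B j (\<phi> v)" if "v \<in> pts V" for v j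
    using assms(3) that by (auto simp: zmorphism_def)
  then show ?thesis
    using assms(4) zdeg_act[OF assms(1)] zdeg_act[OF assms(2)]
    by (auto simp: CW_def pullback_def)
qed


section \<open>The plethystic exponential\<close>

text \<open>For \<open>k \<ge> 1\<close> these are ring homomorphisms, and together they are injective. The plethystic exponential
  becomes an ordinary one, at the price of mixing the components \<open>k, 2 k, 3 k, \<dots>\<close>.\<close>

definition gmap :: "nat \<Rightarrow> witt mps \<Rightarrow> complex mps" where
  "gmap k F = Mps (\<lambda>m. ghost (mcoeff F m) k)"

lemma mcoeff_gmap [simp]: "mcoeff (gmap k F) m = ghost (mcoeff F m) k"
  by (simp add: gmap_def)

lemma gmap_in_Fil1: "F \<in> Fil1 \<Longrightarrow> gmap k F \<in> Fil1"
  by (simp add: Fil1_def)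

lemma gmap_mult: "gmap k (F * G) = gmap k F * gmap k G"
  by (rule mps_eqI) (simp add: mcoeff_mult ghost_sum case_prod_unfold)

lemma gmap_power: "k \<ge> 1 \<Longrightarrow> gmap k (F ^ n) = gmap k F ^ n"
proof (induction n)
  case 0
  then show ?case by (auto intro!: mps_eqI)
qed (simp add: gmap_mult)

lemma agree_witt_iff: "agree N F G \<longleftrightarrow> (\<forall>k\<ge>1. agree N (gmap k F) (gmap k G))"
  unfolding agree_def by (auto intro: ghost_eqI)

lemma gmap_mps_adams: "i \<ge> 1 \<Longrightarrow> k \<ge> 1 \<Longrightarrow> gmap k (mps_adams i F) = psi i (gmap (i * k) F)"
  by (rule mps_eqI) (simp add: mps_adams_def psi_def ghost_sum)

lemma mcoeff_mps_adams_eq_0: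
  assumes "F \<in> Fil1" "size m < i"
  shows "mcoeff (mps_adams i F) m = 0"
proof (rule ghost_eqI)
  fix k :: nat assume "k \<ge> 1"
  then have "ghost (mcoeff (mps_adams i F) m) k = mcoeff (psi i (gmap (i * k) F)) m"
    using assms(2) by (simp flip: gmap_mps_adams)
  then show "ghost (mcoeff (mps_adams i F) m) k = ghost 0 k"
    using mcoeff_psi_eq_0[OF gmap_in_Fil1[OF assms(1)] assms(2)] by simp
qed

lemma witt_zero_divide [simp]: "0 / (w :: witt) = 0"
  by (rule ghost_eqI) simp

lemma mcoeff_mps_exp:
  assumes "G \<in> Fil1"
  shows "mcoeff (mps_exp G) m = (\<Sum>n\<le>size m. mcoeff (G ^ n) m / of_nat (fact n))"
  unfolding mps_exp_def mcoeff_Mps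
  by (rule suminf_finite) (use mcoeff_power_eq_0[OF assms] in auto)

lemma gmap_mps_exp:
  assumes "G \<in> Fil1" "k \<ge> 1"
  shows "gmap k (mps_exp G) = cexp (gmap k G)"
proof (rule mps_eqI)
  fix m
  have "ghost (mcoeff (G ^ n) m) k = mcoeff (gmap k G ^ n) m" for n
    by (simp flip: gmap_power[OF assms(2)])
  then show "mcoeff (gmap k (mps_exp G)) m = mcoeff (cexp (gmap k G)) m"
    using assms(2) by (simp add: mcoeff_mps_exp[OF assms(1)] ghost_sum ghost_of_nat cexp_def)
qed

definition exp_arg :: "witt mps \<Rightarrow> witt mps" where
  "exp_arg F = Mps (\<lambda>m. \<Sum>j. mcoeff (mps_adams (Suc j) F) m / of_nat (Suc j))"

lemma Exp_sigma_eq: "Exp_sigma F = mps_exp (exp_arg F)"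
  by (simp add: Exp_sigma_def exp_arg_def)

lemma mcoeff_exp_arg:
  assumes "F \<in> Fil1"
  shows "mcoeff (exp_arg F) m = (\<Sum>j<size m. mcoeff (mps_adams (Suc j) F) m / of_nat (Suc j))"
  unfolding exp_arg_def mcoeff_Mps
  by (rule suminf_finite) (use mcoeff_mps_adams_eq_0[OF assms] in auto)

lemma exp_arg_in_Fil1: "F \<in> Fil1 \<Longrightarrow> exp_arg F \<in> Fil1"
  using mcoeff_exp_arg[of F "{#}"] by (simp add: Fil1_def)

lemma mcoeff_Exp_sigma_empty:
  assumes "F \<in> Fil1"
  shows "mcoeff (Exp_sigma F) {#} = 1"
proof (rule ghost_eqI)
  fix k :: nat assume "k \<ge> 1"
  then have "ghost (mcoeff (Exp_sigma F) {#}) k = mcoeff (cexp (gmap k (exp_arg F))) {#}"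
    by (simp add: Exp_sigma_eq flip: gmap_mps_exp[OF exp_arg_in_Fil1[OF assms]])
  then show "ghost (mcoeff (Exp_sigma F) {#}) k = ghost 1 k"
    using \<open>k \<ge> 1\<close> by simp
qed

text \<open>The exponent of \<open>Exp\<^sub>\<sigma>\<close>, cut off after \<open>N\<close> terms. In the applications \<open>Y j\<close> is a ghost component whose index is a
  multiple of \<open>j\<close>.\<close>

definition adams_sum :: "nat \<Rightarrow> (nat \<Rightarrow> complex mps) \<Rightarrow> complex mps" where
  "adams_sum N Y = (\<Sum>j=1..N. mps_const (1 / of_nat j) * psi j (Y j))"

lemma adams_sum_in_Fil1: "(\<And>j. j \<ge> 1 \<Longrightarrow> Y j \<in> Fil1) \<Longrightarrow> adams_sum N Y \<in> Fil1"
  unfolding adams_sum_def by (intro Fil1_sum Fil1_mult psi_in_Fil1) auto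

text \<open>In degree at most \<open>N\<close> only the first \<open>N\<close> Adams operations contribute, so the exponent may be replaced
  by a finite sum.\<close>

lemma agree_exp_arg:
  assumes "F \<in> Fil1" "k \<ge> 1"
  shows "agree (Suc N) (gmap k (exp_arg F)) (adams_sum N (\<lambda>j. gmap (j * k) F))"
  unfolding agree_def
proof (intro allI impI)
  fix m :: "nat multiset" assume m: "size m < Suc N"
  let ?t = "\<lambda>j. mcoeff (psi j (gmap (j * k) F)) m / of_nat j"
  have "ghost (mcoeff (mps_adams (Suc j) F) m) k = mcoeff (psi (Suc j) (gmap (Suc j * k) F)) m" for j
    using gmap_mps_adams[of "Suc j" k F] assms(2) by (metis mcoeff_gmap le_add1 plus_1_eq_Suc)
  then have "mcoeff (gmap k (exp_arg F)) m = (\<Sum>j<size m. ?t (Suc j))"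
    using assms by (simp add: mcoeff_exp_arg ghost_sum ghost_of_nat del: of_nat_Suc mult_Suc)
  also have "\<dots> = (\<Sum>j=1..size m. ?t j)"
    by (rule sum.reindex_bij_witness[where i = "\<lambda>j. j - 1" and j = Suc]) auto
  also have "\<dots> = (\<Sum>j=1..N. ?t j)"
    by (rule sum.mono_neutral_left)
      (use m mcoeff_psi_eq_0[OF gmap_in_Fil1[OF assms(1)]] in auto)
  finally show "mcoeff (gmap k (exp_arg F)) m = mcoeff (adams_sum N (\<lambda>j. gmap (j * k) F)) m"
    by (simp add: adams_sum_def mcoeff_sum)
qed

lemma agree_Exp_sigma:
  assumes "F \<in> Fil1" "k \<ge> 1"
  shows "agree (Suc N) (gmap k (Exp_sigma F)) (cexp (adams_sum N (\<lambda>j. gmap (j * k) F)))"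
  using agree_cexp[OF agree_exp_arg[OF assms]]
  by (simp add: Exp_sigma_eq gmap_mps_exp[OF exp_arg_in_Fil1[OF assms(1)] assms(2)])


subsection \<open>The plethystic logarithm\<close>

text \<open>Solve \<open>T F = H\<close> by iterating \<open>F \<mapsto> F + (H - T F)\<close>: each step makes one more degree correct, because the
  degree \<open>N\<close> part of \<open>T F - F\<close> depends only on lower degrees of \<open>F\<close>.\<close>

lemma bij_betw_Fil1_if_unitriangular:
  fixes T :: "'r::comm_ring_1 mps \<Rightarrow> 'r mps"
  assumes Fil1: "\<And>F. F \<in> Fil1 \<Longrightarrow> T F \<in> Fil1"
    and tri: "\<And>N F G. F \<in> Fil1 \<Longrightarrow> G \<in> Fil1 \<Longrightarrow> agree N F G \<Longrightarrow> agree (Suc N) (T F - F) (T G - G)"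
  shows "bij_betw T Fil1 Fil1"
  unfolding bij_betw_def
proof
  show "inj_on T Fil1"
  proof (rule inj_onI)
    fix F G assume FG: "F \<in> Fil1" "G \<in> Fil1" "T F = T G"
    have "agree N F G" for N
    proof (induction N)
      case (Suc N)
      from tri[OF FG(1,2) this] show ?case by (simp add: agree_def FG(3))
    qed (simp add: agree_def)
    then show "F = G" unfolding agree_def by (intro mps_eqI) blast
  qed
  show "T ` Fil1 = Fil1"
  proof
    show "Fil1 \<subseteq> T ` Fil1"
    proof
      fix H :: "'r mps" assume H: "H \<in> Fil1"
      define S where "S = (\<lambda>F. F + (H - T F))"
      define f where "f = (\<lambda>n. (S ^^ n) 0)"
      have S: "agree (Suc N) (S F) (S G)" if "F \<in> Fil1" "G \<in> Fil1" "agree N F G" for N F G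
        using tri[OF that] by (simp add: agree_def S_def algebra_simps)
      have f_Suc: "f (Suc n) = S (f n)" for n by (simp add: f_def)
      have f_Fil1: "f n \<in> Fil1" for n
      proof (induction n)
        case (Suc n)
        then show ?case using H Fil1[OF Suc] unfolding f_Suc by (simp add: Fil1_def S_def)
      qed (simp add: f_def Fil1_def)
      have step: "agree n (f n) (f (Suc n))" for n
      proof (induction n)
        case (Suc n)
        then show ?case using S[OF f_Fil1 f_Fil1] f_Suc by metis
      qed (simp add: agree_def)
      have stable: "agree n (f n) (f (n + i))" for n i
      proof (induction i)
        case (Suc i)
        then show ?case using agree_mono[OF step[of "n + i"], of n] agree_trans by fastforce
      qed simp
      define F where "F = Mps (\<lambda>m. mcoeff (f (Suc (size m))) m)"
      have F: "agree n F (f n)" for n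
        unfolding agree_def
      proof (intro allI impI)
        fix m :: "nat multiset" assume "size m < n"
        then obtain i where "n = Suc (size m) + i" by (metis less_iff_Suc_add add_Suc)
        then show "mcoeff F m = mcoeff (f n) m"
          using stable[of "Suc (size m)" i] by (simp add: F_def agree_def)
      qed
      have F1: "F \<in> Fil1" using f_Fil1[of 1] by (simp add: F_def Fil1_def)
      have "agree (Suc n) (S F) F" for n
        using agree_trans[OF S[OF F1 f_Fil1 F[of n], folded f_Suc] agree_sym[OF F]] .
      then have "S F = F" unfolding agree_def by (intro mps_eqI) blast
      then have "T F = H" by (simp add: S_def)
      then show "H \<in> T ` Fil1" using F1 by blast
    qed
  qed (use Fil1 in auto)
qed

text \<open>All terms but \<open>1\<close> and the argument are products of at least two series without constant term.\<close>

lemma agree_cexp_minus_arg: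
  assumes "F \<in> Fil1" "G \<in> Fil1" "agree N F G"
  shows "agree (Suc N) (cexp F - F) (cexp G - G)"
  unfolding agree_def
proof (intro allI impI)
  fix m :: "nat multiset" assume m: "size m < Suc N"
  have ex: "mcoeff (cexp X - X) m = mcoeff 1 m + (\<Sum>n\<le>N. mcoeff (X ^ Suc (Suc n)) m / fact (Suc (Suc n)))"
    if "X \<in> Fil1" for X
    using m by (simp add: mcoeff_cexp[OF that, of m "Suc (Suc N)"] sum.atMost_Suc_shift
        del: sum.atMost_Suc fact_Suc power_Suc)
  have "agree (Suc N) (F * F ^ Suc n) (G * G ^ Suc n)" for n
    by (rule agree_mult_Fil1[OF assms(3) agree_power[OF assms(3)] assms(1,2)])
      (use assms(1,2) in \<open>simp_all add: Fil1_def mcoeff_power_empty\<close>)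
  then have "mcoeff (F ^ Suc (Suc n)) m = mcoeff (G ^ Suc (Suc n)) m" for n
    using m by (simp add: agree_def)
  then show "mcoeff (cexp F - F) m = mcoeff (cexp G - G) m"
    unfolding ex[OF assms(1)] ex[OF assms(2)] by simp
qed

text \<open>The substitution multiplies degrees by \<open>j\<close>, so a coefficient comes from one of at most half its degree.\<close>

lemma agree_psi_ge2:
  assumes "F \<in> Fil1" "G \<in> Fil1" "agree N F G" "j \<ge> 2"
  shows "agree (Suc N) (psi j F) (psi j G)"
  unfolding agree_def
proof (intro allI impI)
  fix m :: "nat multiset" assume m: "size m < Suc N"
  have j: "j \<ge> 1" using assms(4) by simp
  show "mcoeff (psi j F) m = mcoeff (psi j G) m"
  proof (cases rule: psi_cases[OF j, of m, where 'r = 'a])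
    case (1 n)
    have "mcoeff F n = mcoeff G n"
    proof (cases "n = {#}")
      case False
      have "2 * size n \<le> j * size n" using assms(4) by simp
      moreover have "j * size n = size m" using 1(1) by simp
      moreover have "size n > 0" using False by (simp add: nonempty_has_size)
      ultimately have "size n < N" using m by linarith
      then show ?thesis using assms(3) by (simp add: agree_def)
    qed (use assms(1,2) in \<open>simp add: Fil1_def\<close>)
    then show ?thesis using 1(2) by simp
  qed simp
qed

lemma agree_exp_arg_minus_arg:
  assumes "F \<in> Fil1" "G \<in> Fil1" "agree N F G"
  shows "agree (Suc N) (exp_arg F - F) (exp_arg G - G)"
  unfolding agree_witt_iff[of "Suc N"]
proof (intro allI impI)
  fix k :: nat assume k: "k \<ge> 1"
  define R where "R = (\<lambda>X. \<Sum>j=2..Suc N. mps_const (1 / of_nat j) * psi j (gmap (j * k) X))"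
  have psi1: "psi 1 X = X" for X :: "complex mps"
    by (rule mps_eqI) (use mcoeff_psi(1)[of 1 X] in simp)
  have "adams_sum (Suc N) (\<lambda>j. gmap (j * k) X) = gmap k X + R X" for X
    unfolding adams_sum_def R_def
    by (subst sum.atLeast_Suc_atMost) (auto simp: psi1[simplified] numeral_2_eq_2 intro!: mps_eqI)
  then have ex: "agree (Suc N) (gmap k (exp_arg X)) (gmap k X + R X)" if "X \<in> Fil1" for X
    using agree_mono[OF agree_exp_arg[OF that k, of "Suc N"], of "Suc N"] by simp
  have "agree (Suc N) (R F) (R G)"
    unfolding R_def
  proof (intro agree_sum agree_mult agree_refl agree_psi_ge2 gmap_in_Fil1 assms)
    show "agree N (gmap (j * k) F) (gmap (j * k) G)" for j
      using assms(3) by (simp add: agree_def)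
  qed auto
  then show "agree (Suc N) (gmap k (exp_arg F - F)) (gmap k (exp_arg G - G))"
    using ex[OF assms(1)] ex[OF assms(2)] by (simp add: agree_def)
qed

lemma agree_Exp_sigma_minus_arg:
  assumes "F \<in> Fil1" "G \<in> Fil1" "agree N F G"
  shows "agree (Suc N) (Exp_sigma F - F) (Exp_sigma G - G)"
  unfolding agree_witt_iff[of "Suc N"]
proof (intro allI impI)
  fix k :: nat assume k: "k \<ge> 1"
  let ?E = "\<lambda>X. gmap k (exp_arg X)"
  have E: "agree (Suc N) (gmap k (exp_arg F - F)) (gmap k (exp_arg G - G))"
    using agree_exp_arg_minus_arg[OF assms] k by (simp add: agree_witt_iff[of "Suc N"])
  have "agree N (?E F) (?E G)"
    unfolding agree_def
  proof (intro allI impI)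
    fix m :: "nat multiset" assume m: "size m < N"
    then have "mcoeff (gmap k (exp_arg F - F)) m = mcoeff (gmap k (exp_arg G - G)) m"
      using E by (simp add: agree_def)
    moreover have "mcoeff F m = mcoeff G m" using assms(3) m by (simp add: agree_def)
    ultimately show "mcoeff (?E F) m = mcoeff (?E G) m" by simp
  qed
  then have "agree (Suc N) (cexp (?E F) - ?E F) (cexp (?E G) - ?E G)"
    by (intro agree_cexp_minus_arg gmap_in_Fil1 exp_arg_in_Fil1 assms)
  then have "agree (Suc N) (cexp (?E F) - ?E F + gmap k (exp_arg F - F))
      (cexp (?E G) - ?E G + gmap k (exp_arg G - G))"
    using E by (simp add: agree_def)
  moreover have "gmap k (Exp_sigma X - X) = cexp (?E X) - ?E X + gmap k (exp_arg X - X)"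
    if "X \<in> Fil1" for X
    using gmap_mps_exp[OF exp_arg_in_Fil1[OF that] k, symmetric]
    by (intro mps_eqI) (simp add: Exp_sigma_eq)
  ultimately show "agree (Suc N) (gmap k (Exp_sigma F - F)) (gmap k (Exp_sigma G - G))"
    using assms by simp
qed

lemma bij_Exp_sigma: "bij_betw (\<lambda>F. Exp_sigma F - 1) Fil1 Fil1"
proof (rule bij_betw_Fil1_if_unitriangular)
  show "Exp_sigma F - 1 \<in> Fil1" if "F \<in> Fil1" for F
    using mcoeff_Exp_sigma_empty[OF that] by (simp add: Fil1_def)
  show "agree (Suc N) (Exp_sigma F - 1 - F) (Exp_sigma G - 1 - G)"
    if "F \<in> Fil1" "G \<in> Fil1" "agree N F G" for N F G
    using agree_Exp_sigma_minus_arg[OF that] by (simp add: agree_def algebra_simps)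
qed

lemma inj_Exp_sigma: "inj_on Exp_sigma Fil1"
  using bij_Exp_sigma unfolding bij_betw_def inj_on_def by auto

lemma Log_sigma_Exp_sigma: "F \<in> Fil1 \<Longrightarrow> Log_sigma (Exp_sigma F) = F"
  unfolding Log_sigma_def by (rule the_inv_into_f_f[OF inj_Exp_sigma])

lemma Log_sigma:
  assumes "mcoeff H {#} = 1"
  shows Log_sigma_in_Fil1: "Log_sigma H \<in> Fil1" and Exp_sigma_Log_sigma: "Exp_sigma (Log_sigma H) = H"
proof -
  have "H - 1 \<in> Fil1" using assms by (simp add: Fil1_def)
  then have "H - 1 \<in> (\<lambda>F. Exp_sigma F - 1) ` Fil1"
    using bij_Exp_sigma by (simp add: bij_betw_def)
  then obtain F where F: "F \<in> Fil1" "H = Exp_sigma F" by auto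
  then show "Log_sigma H \<in> Fil1" "Exp_sigma (Log_sigma H) = H"
    using F(1) by (simp_all add: Log_sigma_Exp_sigma)
qed


section \<open>Orbit representatives\<close>

text \<open>The choice depends only on the orbit as a set, so equivalent points get the same representative.\<close>

definition orbit_rep :: "'v zset \<Rightarrow> 'v \<Rightarrow> 'v" where
  "orbit_rep V v = (SOME w. w \<in> zorbit V v)"

definition orbit_reps :: "'v zset \<Rightarrow> 'v set \<Rightarrow> 'v set" where
  "orbit_reps V W = orbit_rep V ` W"

definition invariant_subset :: "'v zset \<Rightarrow> 'v set \<Rightarrow> bool" where
  "invariant_subset V W \<longleftrightarrow> W \<subseteq> pts V \<and> (\<forall>v\<in>W. \<forall>j. act V j v \<in> W)"

context
  fixes V :: "'v zset" and W :: "'v set"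
  assumes V: "admissible V" and W: "invariant_subset V W"
begin

lemma orbit_rep:
  assumes "v \<in> W"
  shows "orbit_rep V v \<in> orbit_reps V W" "zorbit V (orbit_rep V v) = zorbit V v"
    "\<exists>j. v = act V j (orbit_rep V v)"
proof -
  have v: "v \<in> pts V" using assms W by (auto simp: invariant_subset_def)
  have "orbit_rep V v \<in> zorbit V v"
    unfolding orbit_rep_def using zorbit_self[OF V v] by (rule someI)
  then show eq: "zorbit V (orbit_rep V v) = zorbit V v" by (rule zorbit_eq_of_mem[OF V v])
  show "orbit_rep V v \<in> orbit_reps V W" using assms by (simp add: orbit_reps_def)
  show "\<exists>j. v = act V j (orbit_rep V v)"
    using zorbit_self[OF V v] unfolding eq[symmetric] by (auto simp: zorbit_eq)
qed

lemma orbit_reps_subset: "orbit_reps V W \<subseteq> W"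
proof
  fix r assume "r \<in> orbit_reps V W"
  then obtain v where v: "v \<in> W" "r = orbit_rep V v" by (auto simp: orbit_reps_def)
  then have pts: "v \<in> pts V" using W by (auto simp: invariant_subset_def)
  have "r \<in> zorbit V v"
    unfolding v(2) orbit_rep_def using zorbit_self[OF V pts] by (rule someI)
  then show "r \<in> W" using W v(1) by (auto simp: zorbit_eq invariant_subset_def)
qed

lemma orbit_rep_fiber:
  assumes r: "r \<in> orbit_reps V W"
  shows "{v \<in> W. orbit_rep V v = r} = zorbit V r"
proof (intro subset_antisym subsetI)
  fix v assume "v \<in> {v \<in> W. orbit_rep V v = r}"
  then have v: "v \<in> W" "orbit_rep V v = r" by auto
  then have "v \<in> pts V" using W by (auto simp: invariant_subset_def)
  then show "v \<in> zorbit V r" using orbit_rep(2)[OF v(1)] v(2) zorbit_self[OF V] by simp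
next
  fix v assume v: "v \<in> zorbit V r"
  obtain u where u: "u \<in> W" "r = orbit_rep V u" using r by (auto simp: orbit_reps_def)
  have rW: "r \<in> W" using r orbit_reps_subset by blast
  then have "v \<in> W" using v W by (auto simp: zorbit_eq invariant_subset_def)
  have "r \<in> pts V" using rW W by (auto simp: invariant_subset_def)
  then have "zorbit V v = zorbit V u"
    using zorbit_eq_of_mem[OF V _ v] orbit_rep(2)[OF u(1)] u(2) by simp
  then have "orbit_rep V v = r" by (simp add: orbit_rep_def u(2))
  then show "v \<in> {v \<in> W. orbit_rep V v = r}" using \<open>v \<in> W\<close> by simp
qed

lemma sum_over_orbit_reps:
  fixes h :: "'v \<Rightarrow> 'r::comm_ring_1"
  assumes fin: "finite W" and h: "\<And>v j. v \<in> W \<Longrightarrow> h (act V j v) = h v"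
  shows "sum h W = (\<Sum>r\<in>orbit_reps V W. of_nat (zdeg V r) * h r)"
proof -
  have "sum h W = (\<Sum>r\<in>orbit_reps V W. \<Sum>v | v \<in> W \<and> orbit_rep V v = r. h v)"
    unfolding orbit_reps_def by (rule sum.image_gen[OF fin])
  also have "\<dots> = (\<Sum>r\<in>orbit_reps V W. of_nat (zdeg V r) * h r)"
  proof (rule sum.cong[OF refl])
    fix r assume r: "r \<in> orbit_reps V W"
    then have "r \<in> W" using orbit_reps_subset by blast
    have "(\<Sum>v | v \<in> W \<and> orbit_rep V v = r. h v) = (\<Sum>v\<in>zorbit V r. h r)"
      unfolding orbit_rep_fiber[OF r]
      by (rule sum.cong) (auto simp: zorbit_eq h[OF \<open>r \<in> W\<close>])
    then show "(\<Sum>v | v \<in> W \<and> orbit_rep V v = r. h v) = of_nat (zdeg V r) * h r"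
      by (simp add: zdeg_def)
  qed
  finally show ?thesis .
qed

end


section \<open>Euler products\<close>

text \<open>The points that matter in degree at most \<open>N\<close>.\<close>

definition trunc_pts :: "nat \<Rightarrow> nat \<Rightarrow> 'b zset \<Rightarrow> 'b set" where
  "trunc_pts N k B = (\<Union>j\<in>{1..N}. fixed_pts (j * k) B)"

context
  fixes B :: "'b zset" and k :: nat
  assumes B: "admissible B" and k: "k \<ge> 1"
begin

lemma finite_trunc_pts: "finite (trunc_pts N k B)"
  unfolding trunc_pts_def using finite_fixed_pts[OF B] k by auto

lemma invariant_trunc_pts: "invariant_subset (scale k B) (trunc_pts N k B)"
  using act_closed[OF B] zdeg_act[OF B]
  by (auto simp: invariant_subset_def trunc_pts_def fixed_pts_iff[OF B] scale_def)

lemma mem_fixed_pts_iff_zdeg_scale: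
  "b \<in> pts B \<Longrightarrow> b \<in> fixed_pts (j * k) B \<longleftrightarrow> zdeg (scale k B) b dvd j"
  by (simp add: fixed_pts_iff[OF B] zdeg_scale_dvd_iff[OF B k] mult.commute)

lemma zdeg_scale_pos: "b \<in> pts B \<Longrightarrow> zdeg (scale k B) b \<ge> 1"
  using zdeg_pos[OF admissible_scale[OF B k]] by (simp add: scale_def)

lemma trunc_pts_subset: "trunc_pts N k B \<subseteq> pts B"
  by (auto simp: trunc_pts_def fixed_pts_def)

text \<open>A point \<open>b\<close> whose \<open>k\<int>\<close>-orbit has size \<open>c\<close> contributes to the terms indexed by the multiples \<open>j = i c\<close>
  of \<open>c\<close>. Those terms are \<open>1/c\<close> times the substitution \<open>t \<mapsto> t\<^sup>c\<close> in a sum of the same shape over \<open>i\<close>, and the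
  factor \<open>1/c\<close> is absorbed by passing from points to orbits.\<close>

lemma adams_sum_by_orbits:
  assumes Y: "\<And>j b. j \<ge> 1 \<Longrightarrow> b \<in> trunc_pts N k B \<Longrightarrow> Y j b \<in> Fil1"
    and inv: "\<And>i j b. b \<in> trunc_pts N k B \<Longrightarrow> Y j (act (scale k B) i b) = Y j b"
  shows "agree (Suc N) (adams_sum N (\<lambda>j. \<Sum>b\<in>fixed_pts (j * k) B. Y j b))
    (\<Sum>r\<in>orbit_reps (scale k B) (trunc_pts N k B).
      psi (zdeg (scale k B) r) (adams_sum N (\<lambda>i. Y (i * zdeg (scale k B) r) r)))"
proof -
  let ?W = "trunc_pts N k B" and ?S = "scale k B"
  define c where "c = zdeg ?S"
  have S: "admissible ?S" by (rule admissible_scale[OF B k])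
  have c1: "c b \<ge> 1" if "b \<in> ?W" for b
    unfolding c_def using that trunc_pts_subset zdeg_scale_pos by blast
  define t where "t = (\<lambda>j b. mps_const (1 / of_nat j) * psi j (Y j b))"
  define h where "h = (\<lambda>b. mps_const (1 / of_nat (c b)) * psi (c b) (adams_sum N (\<lambda>i. Y (i * c b) b)))"
  have "adams_sum N (\<lambda>j. \<Sum>b\<in>fixed_pts (j * k) B. Y j b) = (\<Sum>j=1..N. \<Sum>b\<in>fixed_pts (j * k) B. t j b)"
    unfolding adams_sum_def t_def by (intro sum.cong) (auto simp: psi_sum_distrib sum_distrib_left)
  also have "\<dots> = (\<Sum>j=1..N. \<Sum>b\<in>?W. if c b dvd j then t j b else 0)"
  proof (rule sum.cong[OF refl])
    fix j assume j: "j \<in> {1..N}"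
    have "fixed_pts (j * k) B = {b \<in> ?W. c b dvd j}"
      using j mem_fixed_pts_iff_zdeg_scale trunc_pts_subset[of N]
      by (auto simp: trunc_pts_def c_def fixed_pts_def)
    then show "(\<Sum>b\<in>fixed_pts (j * k) B. t j b) = (\<Sum>b\<in>?W. if c b dvd j then t j b else 0)"
      by (simp add: sum.inter_filter[OF finite_trunc_pts])
  qed
  also have "\<dots> = (\<Sum>b\<in>?W. \<Sum>j=1..N. if c b dvd j then t j b else 0)"
    by (rule sum.swap)
  also have "agree (Suc N) \<dots> (\<Sum>b\<in>?W. h b)"
  proof (rule agree_sum)
    fix b assume b: "b \<in> ?W"
    have c: "c b \<ge> 1" by (rule c1[OF b])
    have "h b = (\<Sum>i=1..N. t (i * c b) b)"
      unfolding h_def adams_sum_def psi_sum_distrib[OF c] sum_distrib_left t_def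
    proof (rule sum.cong[OF refl])
      fix i assume "i \<in> {1..N}"
      then have "psi (c b) (psi i (Y (i * c b) b)) = psi (i * c b) (Y (i * c b) b)"
        using psi_psi[OF c, of i] by (simp add: mult.commute)
      then show "mps_const (1 / of_nat (c b)) * psi (c b) (mps_const (1 / of_nat i) * psi i (Y (i * c b) b)) =
          mps_const (1 / of_nat (i * c b)) * psi (i * c b) (Y (i * c b) b)"
        by (intro mps_eqI) (simp add: psi_const_mult[OF c])
    qed
    moreover have "agree (Suc N) (\<Sum>j=1..N. if c b dvd j then t j b else 0) (\<Sum>i=1..N. t (i * c b) b)"
      unfolding agree_def mcoeff_sum
    proof (intro allI impI)
      fix m :: "nat multiset" assume m: "size m < Suc N"
      have z: "mcoeff (t j b) m = 0" if "N < j" for j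
        using mcoeff_psi_eq_0[OF Y, of j b m] b that m by (simp add: t_def)
      have "(\<Sum>j=1..N. mcoeff (if c b dvd j then t j b else 0) m) =
          (\<Sum>j=1..N. if c b dvd j then mcoeff (t j b) m else 0)"
        by (intro sum.cong) auto
      also have "\<dots> = (\<Sum>j | j \<in> {1..N} \<and> c b dvd j. mcoeff (t j b) m)"
        by (rule sum.inter_filter[symmetric]) simp
      also have "\<dots> = (\<Sum>i | i \<in> {1..N} \<and> i * c b \<le> N. mcoeff (t (i * c b) b) m)"
      proof (rule sum.reindex_bij_witness[where i = "\<lambda>i. i * c b" and j = "\<lambda>j. j div c b"])
        fix j assume j: "j \<in> {j \<in> {1..N}. c b dvd j}"
        then show "j div c b * c b = j" by simp
        then show "mcoeff (t (j div c b * c b) b) m = mcoeff (t j b) m" by simp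
        have "j div c b \<ge> 1" using j by (intro div_ge_1) auto
        moreover have "j div c b \<le> N" using j by (auto intro: le_trans[OF div_le_dividend])
        ultimately show "j div c b \<in> {i \<in> {1..N}. i * c b \<le> N}" using j by simp
      next
        fix i assume i: "i \<in> {i \<in> {1..N}. i * c b \<le> N}"
        then show "i * c b div c b = i" using c by simp
        have "i * c b \<ge> 1" using i c by simp
        then show "i * c b \<in> {j \<in> {1..N}. c b dvd j}" using i by simp
      qed
      also have "\<dots> = (\<Sum>i=1..N. mcoeff (t (i * c b) b) m)"
        by (rule sum.mono_neutral_left) (auto intro: z)
      finally show "(\<Sum>j=1..N. mcoeff (if c b dvd j then t j b else 0) m) =
          (\<Sum>i=1..N. mcoeff (t (i * c b) b) m)" .
    qed
    ultimately show "agree (Suc N) (\<Sum>j=1..N. if c b dvd j then t j b else 0) (h b)" by simp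
  qed
  also have "(\<Sum>b\<in>?W. h b) = (\<Sum>r\<in>orbit_reps ?S ?W. of_nat (c r) * h r)"
    unfolding c_def
  proof (rule sum_over_orbit_reps[OF S invariant_trunc_pts finite_trunc_pts])
    fix v j assume v: "v \<in> ?W"
    then have "v \<in> pts ?S" using trunc_pts_subset by (auto simp: scale_def)
    then show "h (act ?S j v) = h v"
      by (simp add: h_def c_def zdeg_act[OF S] inv[OF v])
  qed
  also have "\<dots> = (\<Sum>r\<in>orbit_reps ?S ?W. psi (c r) (adams_sum N (\<lambda>i. Y (i * c r) r)))"
  proof (rule sum.cong[OF refl])
    fix r assume "r \<in> orbit_reps ?S ?W"
    then have "c r \<ge> 1" using c1 orbit_reps_subset[OF S invariant_trunc_pts] by blast
    then show "of_nat (c r) * h r = psi (c r) (adams_sum N (\<lambda>i. Y (i * c r) r))"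
      by (intro mps_eqI) (simp add: h_def mcoeff_of_nat_mult)
  qed
  finally show ?thesis by (simp add: c_def)
qed

text \<open>The exponential of the preceding decomposition. The series \<open>F b\<close> enters through its ghost components at
  the indices \<open>j k / \<delta> b\<close>. The two cases of interest are \<open>\<delta> b = deg b\<close>, for an Euler product over \<open>B\<close>, and \<open>\<delta> b = deg
  (ev\<^sub>d(u, b))\<close>, for the integral over the fiber at a point \<open>u\<close> of \<open>U\<^sub>d\<close>; this is why \<open>\<delta>\<close> is arbitrary.\<close>

lemma Euler_factorization:
  assumes F: "\<And>b. b \<in> trunc_pts N k B \<Longrightarrow> F b \<in> Fil1"
    and F_inv: "\<And>b j. b \<in> trunc_pts N k B \<Longrightarrow> F (act (scale k B) j b) = F b"
    and \<delta>: "\<And>b. b \<in> trunc_pts N k B \<Longrightarrow> \<delta> b dvd zdeg (scale k B) b * k"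
    and \<delta>_inv: "\<And>b j. b \<in> trunc_pts N k B \<Longrightarrow> \<delta> (act (scale k B) j b) = \<delta> b"
  shows "agree (Suc N) (cexp (adams_sum N (\<lambda>j. \<Sum>b\<in>fixed_pts (j * k) B. gmap (j * k div \<delta> b) (F b))))
    (\<Prod>r\<in>orbit_reps (scale k B) (trunc_pts N k B).
      psi (zdeg (scale k B) r) (gmap (zdeg (scale k B) r * k div \<delta> r) (Exp_sigma (F r))))"
proof -
  let ?W = "trunc_pts N k B" and ?S = "scale k B"
  let ?R = "orbit_reps ?S ?W"
  define c where "c = zdeg ?S"
  define \<Lambda> where "\<Lambda> = (\<lambda>r. adams_sum N (\<lambda>i. gmap (i * c r * k div \<delta> r) (F r)))"
  have R: "r \<in> ?W" if "r \<in> ?R" for r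
    using that orbit_reps_subset[OF admissible_scale[OF B k] invariant_trunc_pts] by blast
  have c: "c r \<ge> 1" if "r \<in> ?R" for r
    using zdeg_scale_pos trunc_pts_subset R[OF that] by (auto simp: c_def)
  have \<Lambda>: "\<Lambda> r \<in> Fil1" if "r \<in> ?R" for r
    unfolding \<Lambda>_def using F[OF R[OF that]] by (intro adams_sum_in_Fil1 gmap_in_Fil1)
  have "agree (Suc N) (adams_sum N (\<lambda>j. \<Sum>b\<in>fixed_pts (j * k) B. gmap (j * k div \<delta> b) (F b)))
      (\<Sum>r\<in>?R. psi (c r) (\<Lambda> r))"
    unfolding \<Lambda>_def c_def
    by (rule adams_sum_by_orbits) (auto simp: F_inv \<delta>_inv intro: gmap_in_Fil1 F)
  from agree_cexp[OF this]
  have "agree (Suc N) (cexp (adams_sum N (\<lambda>j. \<Sum>b\<in>fixed_pts (j * k) B. gmap (j * k div \<delta> b) (F b))))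
      (cexp (\<Sum>r\<in>?R. psi (c r) (\<Lambda> r)))" .
  also have "cexp (\<Sum>r\<in>?R. psi (c r) (\<Lambda> r)) = (\<Prod>r\<in>?R. psi (c r) (cexp (\<Lambda> r)))"
    using c \<Lambda> finite_trunc_pts
    by (subst cexp_sum) (auto simp: orbit_reps_def psi_cexp intro: psi_in_Fil1)
  also have "agree (Suc N) \<dots> (\<Prod>r\<in>?R. psi (c r) (gmap (c r * k div \<delta> r) (Exp_sigma (F r))))"
  proof (intro agree_prod agree_psi)
    fix r assume r: "r \<in> ?R"
    show "1 \<le> c r" by (rule c[OF r])
    obtain e where e: "c r * k = \<delta> r * e" using \<delta>[OF R[OF r]] by (auto simp: c_def)
    then have pos: "\<delta> r \<ge> 1" "e \<ge> 1" using c[OF r] k by (auto simp: Suc_le_eq intro!: Nat.gr0I)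
    have "i * c r * k div \<delta> r = i * e" for i
      using e pos by (metis mult.assoc mult.left_commute nonzero_mult_div_cancel_left not_one_le_zero)
    then have "\<Lambda> r = adams_sum N (\<lambda>i. gmap (i * e) (F r))" by (simp add: \<Lambda>_def)
    moreover have "c r * k div \<delta> r = e" using e pos by simp
    ultimately show "agree (Suc N) (cexp (\<Lambda> r)) (gmap (c r * k div \<delta> r) (Exp_sigma (F r)))"
      using agree_sym[OF agree_Exp_sigma[OF F[OF R[OF r]] pos(2)]] by simp
  qed
  finally show ?thesis by (simp add: c_def)
qed

end


section \<open>Sections and averages over them\<close>

lemma sections_on_iff:
  "s \<in> sections_on A B \<pi> W \<longleftrightarrow> s \<in> extensional W \<and> (\<forall>b\<in>W. s b \<in> pts A \<and> \<pi> (s b) = b) \<and>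
    (\<forall>b\<in>W. \<forall>j. s (act B j b) = act A j (s b))"
  by (auto simp: sections_on_def zmorphism_def)

text \<open>A section is determined by its values at representatives of the orbits. The value at \<open>r\<close> may be
  any point over \<open>r\<close> fixed by the stabilizer of \<open>r\<close>.\<close>

lemma bij_betw_sections_on:
  assumes A: "admissible A" and B: "admissible B" and \<pi>: "zmorphism A B \<pi>" and W: "invariant_subset B W"
  shows "bij_betw (\<lambda>s. restrict s (orbit_reps B W)) (sections_on A B \<pi> W)
    (PiE (orbit_reps B W) (\<lambda>r. fiber_pts A \<pi> (zdeg B r) r))"
proof -
  let ?R = "orbit_reps B W" and ?P = "\<lambda>r. fiber_pts A \<pi> (zdeg B r) r"
  have Wp: "b \<in> pts B" if "b \<in> W" for b using W that by (auto simp: invariant_subset_def)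
  have RW: "r \<in> W" if "r \<in> ?R" for r using orbit_reps_subset[OF B W] that by blast
  have inj: "inj_on (\<lambda>s. restrict s ?R) (sections_on A B \<pi> W)"
  proof (rule inj_onI)
    fix s s' assume s: "s \<in> sections_on A B \<pi> W" "s' \<in> sections_on A B \<pi> W"
      and eq: "restrict s ?R = restrict s' ?R"
    have "s b = s' b" if b: "b \<in> W" for b
    proof -
      obtain j where j: "b = act B j (orbit_rep B b)" using orbit_rep(3)[OF B W b] by blast
      have r: "orbit_rep B b \<in> ?R" by (rule orbit_rep(1)[OF B W b])
      then have "s (orbit_rep B b) = s' (orbit_rep B b)" using eq by (metis restrict_apply')
      moreover have "s b = act A j (s (orbit_rep B b))" "s' b = act A j (s' (orbit_rep B b))"
        using s RW[OF r] j by (metis sections_on_iff)+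
      ultimately show ?thesis by simp
    qed
    then show "s = s'" using s by (auto simp: sections_on_iff intro: extensionalityI)
  qed
  have maps: "restrict s ?R \<in> PiE ?R ?P" if s: "s \<in> sections_on A B \<pi> W" for s
  proof -
    have "s r \<in> ?P r" if r: "r \<in> ?R" for r
    proof -
      have "act A (int (zdeg B r) * j) (s r) = s r" for j
        using s RW[OF r] act_fixed_iff[OF B Wp[OF RW[OF r]], of "int (zdeg B r) * j"]
        by (metis dvd_triv_left sections_on_iff)
      then show ?thesis
        using s RW[OF r] by (auto simp: fiber_pts_def fixed_pts_def sections_on_iff)
    qed
    then show ?thesis by auto
  qed
  have surj: "g \<in> (\<lambda>s. restrict s ?R) ` sections_on A B \<pi> W" if g: "g \<in> PiE ?R ?P" for g
  proof -
    define J where "J = (\<lambda>b. SOME j. b = act B j (orbit_rep B b))"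
    define s where "s = restrict (\<lambda>b. act A (J b) (g (orbit_rep B b))) W"
    have gP: "g r \<in> pts A" "\<pi> (g r) = r" "zdeg A (g r) dvd zdeg B r" if "r \<in> ?R" for r
      using PiE_mem[OF g that] by (auto simp: fiber_pts_def fixed_pts_iff[OF A])
    have s_eq: "s b = act A j (g (orbit_rep B b))" if b: "b \<in> W" "b = act B j (orbit_rep B b)" for b j
    proof -
      let ?r = "orbit_rep B b"
      have r: "?r \<in> ?R" by (rule orbit_rep(1)[OF B W b(1)])
      have "b = act B (J b) ?r" unfolding J_def using b(2) by (rule someI)
      then have "act B (J b - j) ?r = ?r"
        using act_eq_iff[OF B Wp[OF RW[OF r]], of "J b" j] b(2) by simp
      then have "int (zdeg A (g ?r)) dvd J b - j"
        using act_fixed_iff[OF B Wp[OF RW[OF r]]] gP(3)[OF r]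
        by (meson dvd_trans of_nat_dvd_iff)
      then have "act A (J b) (g ?r) = act A j (g ?r)"
        using act_eq_iff[OF A gP(1)[OF r]] act_fixed_iff[OF A gP(1)[OF r]] by simp
      then show ?thesis using b(1) by (simp add: s_def)
    qed
    have "s \<in> sections_on A B \<pi> W"
      unfolding sections_on_iff
    proof (intro conjI ballI allI)
      show "s \<in> extensional W" by (simp add: s_def)
    next
      fix b assume b: "b \<in> W"
      let ?r = "orbit_rep B b"
      have r: "?r \<in> ?R" by (rule orbit_rep(1)[OF B W b])
      obtain j where j: "b = act B j ?r" using orbit_rep(3)[OF B W b] by blast
      show "s b \<in> pts A" unfolding s_eq[OF b j] by (rule act_closed[OF A gP(1)[OF r]])
      have "\<pi> (act A j (g ?r)) = act B j ?r"
        using \<pi> gP(1,2)[OF r] by (simp add: zmorphism_def)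
      then show "\<pi> (s b) = b" unfolding s_eq[OF b j] using j by simp
      fix i
      have ib: "act B i b \<in> W" using b W by (simp add: invariant_subset_def)
      have rep: "orbit_rep B (act B i b) = ?r"
        by (simp add: orbit_rep_def zorbit_act[OF B Wp[OF b]])
      have "act B i b = act B (i + j) (orbit_rep B (act B i b))"
        using j act_add[OF B Wp[OF RW[OF r]], of i j] by (simp add: rep)
      from s_eq[OF ib this] show "s (act B i b) = act A i (s b)"
        unfolding s_eq[OF b j] rep by (simp add: act_add[OF A gP(1)[OF r]])
    qed
    moreover have "restrict s ?R = g"
    proof (rule extensionalityI[of _ ?R])
      show "g \<in> extensional ?R" using g by (auto simp: PiE_def)
      fix r assume r: "r \<in> ?R"
      have "r \<in> zorbit B r" by (rule zorbit_self[OF B Wp[OF RW[OF r]]])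
      then have rep: "orbit_rep B r = r" using orbit_rep_fiber[OF B W r] by blast
      have "s r = act A 0 (g (orbit_rep B r))"
        by (rule s_eq[OF RW[OF r]]) (simp add: rep act_0[OF B Wp[OF RW[OF r]]])
      then show "restrict s ?R r = g r" using r by (simp add: rep act_0[OF A gP(1)[OF r]])
    qed simp
    ultimately show ?thesis by (metis image_eqI)
  qed
  show ?thesis
    unfolding bij_betw_def by (intro conjI inj subset_antisym image_subsetI subsetI maps surj)
qed

text \<open>On a finite set the convergence of measures is the convergence of the mass of each point, and an average
  over the source is an integral against the image of its uniform measure.\<close>

lemma tendsto_average:
  fixes h :: "'s \<Rightarrow> complex" and S :: "'i \<Rightarrow> 'u set" and f :: "'i \<Rightarrow> 'u \<Rightarrow> 's"
  assumes lim: "\<And>s. s \<in> T \<Longrightarrow>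
      ((\<lambda>d. pmf (map_pmf (f d) (pmf_of_set (S d))) s) \<longlongrightarrow> pmf (pmf_of_set T) s) \<F>"
    and ev: "\<forall>\<^sub>F d in \<F>. finite (S d) \<and> S d \<noteq> {} \<and> f d ` S d \<subseteq> T"
    and T: "finite T" "T \<noteq> {}"
  shows "((\<lambda>d. (\<Sum>u\<in>S d. h (f d u)) / of_nat (card (S d))) \<longlongrightarrow> (\<Sum>s\<in>T. h s) / of_nat (card T)) \<F>"
proof -
  let ?p = "\<lambda>d s. pmf (map_pmf (f d) (pmf_of_set (S d))) s"
  have "((\<lambda>d. \<Sum>s\<in>T. of_real (?p d s) * h s) \<longlongrightarrow> (\<Sum>s\<in>T. of_real (pmf (pmf_of_set T) s) * h s)) \<F>"
    by (intro tendsto_sum tendsto_mult tendsto_of_real lim tendsto_const)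
  also have "(\<Sum>s\<in>T. of_real (pmf (pmf_of_set T) s) * h s) = (\<Sum>s\<in>T. h s) / of_nat (card T)"
    using T by (simp add: sum_divide_distrib)
  finally have L: "((\<lambda>d. \<Sum>s\<in>T. of_real (?p d s) * h s) \<longlongrightarrow> (\<Sum>s\<in>T. h s) / of_nat (card T)) \<F>" .
  have "\<forall>\<^sub>F d in \<F>. (\<Sum>s\<in>T. of_real (?p d s) * h s) = (\<Sum>u\<in>S d. h (f d u)) / of_nat (card (S d))"
    using ev
  proof eventually_elim
    case (elim d)
    have p: "?p d s = card {u \<in> S d. f d u = s} / card (S d)" for s
    proof -
      have "S d \<inter> f d -` {s} = {u \<in> S d. f d u = s}" by auto
      then show ?thesis using elim by (simp add: pmf_map measure_pmf_of_set)
    qed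
    have "(\<Sum>u\<in>S d. h (f d u)) = (\<Sum>s\<in>T. \<Sum>u | u \<in> S d \<and> f d u = s. h (f d u))"
      using elim T by (intro sum.group[symmetric]) auto
    also have "\<dots> = (\<Sum>s\<in>T. of_nat (card {u \<in> S d. f d u = s}) * h s)"
      by (intro sum.cong) auto
    finally show ?case by (simp add: p sum_divide_distrib)
  qed
  then show ?thesis using L by (rule Lim_transform_eventually[rotated])
qed


section \<open>Means over fibers\<close>

definition fiber_mean :: "'v zset \<Rightarrow> ('v \<Rightarrow> 'b) \<Rightarrow> nat \<Rightarrow> ('v \<Rightarrow> complex mps) \<Rightarrow> 'b \<Rightarrow> complex mps" where
  "fiber_mean V \<phi> K g b =
     mps_const (1 / of_nat (card (fiber_pts V \<phi> K b))) * (\<Sum>v\<in>fiber_pts V \<phi> K b. g v)"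

lemma psi_fiber_mean: "j \<ge> 1 \<Longrightarrow> psi j (fiber_mean V \<phi> K g b) = fiber_mean V \<phi> K (\<lambda>v. psi j (g v)) b"
  by (simp add: fiber_mean_def psi_const_mult psi_sum_distrib)

lemma mcoeff_coeffwise [simp]: "mcoeff (coeffwise T F b) m = T (\<lambda>v. mcoeff (F v) m) b"
  by (simp add: coeffwise_def)

lemma mcoeff_in_CW: "H \<in> CW V \<Longrightarrow> (\<lambda>v. mcoeff (H v) m) \<in> CW V"
  by (simp add: CW_def)

context
  fixes V :: "'v zset" and B :: "'b zset" and \<phi> :: "'v \<Rightarrow> 'b"
  assumes V: "admissible V" and B: "admissible B" and \<phi>: "zmorphism V B \<phi>"
begin

lemma gmap_coeffwise_fiber_int:
  assumes "H \<in> CW V" "b \<in> pts B" "K \<ge> 1" "zdeg B b dvd K"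
  shows "gmap (K div zdeg B b) (coeffwise (fiber_int V B \<phi>) H b) =
    (\<Sum>v\<in>fiber_pts V \<phi> K b. gmap (K div zdeg V v) (H v))"
  by (rule mps_eqI)
    (simp add: ghost_fiber_int[OF V B \<phi> assms(2) mcoeff_in_CW[OF assms(1)] assms(3,4)] mcoeff_sum)

lemma gmap_coeffwise_expect:
  assumes "H \<in> CW V" "b \<in> pts B" "K \<ge> 1" "zdeg B b dvd K"
  shows "gmap (K div zdeg B b) (coeffwise (expect V B \<phi>) H b) =
    fiber_mean V \<phi> K (\<lambda>v. gmap (K div zdeg V v) (H v)) b"
  by (rule mps_eqI)
    (simp add: ghost_expect[OF V B \<phi> assms(2) mcoeff_in_CW[OF assms(1)] assms(3,4)] mcoeff_sum
      fiber_mean_def)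

lemma bij_betw_act_fiber_pts:
  assumes b: "b \<in> pts B"
  shows "bij_betw (act V j) (fiber_pts V \<phi> K b) (fiber_pts V \<phi> K (act B j b))"
proof (rule bij_betw_byWitness[where f' = "act V (- j)"])
  have \<phi>_act: "\<phi> (act V i v) = act B i (\<phi> v)" if "v \<in> pts V" for v i
    using \<phi> that by (simp add: zmorphism_def)
  show "act V j ` fiber_pts V \<phi> K b \<subseteq> fiber_pts V \<phi> K (act B j b)"
    by (auto simp: fiber_pts_def fixed_pts_iff[OF V] act_closed[OF V] zdeg_act[OF V] \<phi>_act)
  show "act V (- j) ` fiber_pts V \<phi> K (act B j b) \<subseteq> fiber_pts V \<phi> K b"
    using b by (auto simp: fiber_pts_def fixed_pts_iff[OF V] act_closed[OF V] zdeg_act[OF V] \<phi>_act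
        act_cancel[OF B])
qed (auto simp: fiber_pts_def fixed_pts_iff[OF V] act_cancel[OF V])

lemma sum_fiber_pts_act:
  assumes "b \<in> pts B" "\<And>v. v \<in> pts V \<Longrightarrow> g (act V j v) = g v"
  shows "sum g (fiber_pts V \<phi> K (act B j b)) = sum g (fiber_pts V \<phi> K b)"
proof -
  have "sum g (fiber_pts V \<phi> K (act B j b)) = (\<Sum>v\<in>fiber_pts V \<phi> K b. g (act V j v))"
    by (rule sum.reindex_bij_betw[OF bij_betw_act_fiber_pts[OF assms(1)], symmetric])
  also have "\<dots> = sum g (fiber_pts V \<phi> K b)"
    using assms(2) by (intro sum.cong) (auto simp: fiber_pts_def fixed_pts_def)
  finally show ?thesis .
qed

lemma integral_in_CW:
  assumes f: "f \<in> CW V"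
  shows fiber_int_in_CW: "fiber_int V B \<phi> f \<in> CW B" and expect_in_CW: "expect V B \<phi> f \<in> CW B"
proof -
  { fix j b assume b: "b \<in> pts B"
    let ?b = "act B j b"
    have b': "?b \<in> pts B" by (rule act_closed[OF B b])
    have deg: "zdeg B ?b = zdeg B b" by (rule zdeg_act[OF B b])
    have card: "card (fiber_pts V \<phi> K ?b) = card (fiber_pts V \<phi> K b)" for K
      using bij_betw_same_card[OF bij_betw_act_fiber_pts[OF b]] by metis
    have sum: "(\<Sum>v\<in>fiber_pts V \<phi> K ?b. ghost (f v) (K div zdeg V v)) =
        (\<Sum>v\<in>fiber_pts V \<phi> K b. ghost (f v) (K div zdeg V v))" for K
      by (rule sum_fiber_pts_act[OF b]) (use f in \<open>simp add: CW_def zdeg_act[OF V]\<close>)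
    have "ghost (fiber_int V B \<phi> f ?b) k = ghost (fiber_int V B \<phi> f b) k \<and>
        ghost (expect V B \<phi> f ?b) k = ghost (expect V B \<phi> f b) k" if k: "k \<ge> 1" for k
    proof -
      have K: "k * zdeg B b \<ge> 1" "zdeg B b dvd k * zdeg B b" "zdeg B ?b dvd k * zdeg B b"
        "k * zdeg B b div zdeg B b = k"
        using k zdeg_pos[OF B b] deg by simp_all
      show ?thesis
        using ghost_fiber_int[OF V B \<phi> b f K(1,2)] ghost_fiber_int[OF V B \<phi> b' f K(1,3)]
          ghost_expect[OF V B \<phi> b f K(1,2)] ghost_expect[OF V B \<phi> b' f K(1,3)]
        by (simp only: deg K(4) card sum)
    qed
    then have "fiber_int V B \<phi> f ?b = fiber_int V B \<phi> f b \<and> expect V B \<phi> f ?b = expect V B \<phi> f b"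
      by (blast intro: ghost_eqI) }
  then show "fiber_int V B \<phi> f \<in> CW B" "expect V B \<phi> f \<in> CW B"
    by (simp_all add: CW_def)
qed

lemma coeffwise_expect_in_CW:
  assumes "H \<in> CW V"
  shows "coeffwise (expect V B \<phi>) H \<in> CW B"
  using expect_in_CW[OF mcoeff_in_CW[OF assms]] by (auto simp: CW_def intro!: mps_eqI)

text \<open>The section supplies the points that keep the means over the fibers from being empty.\<close>

lemma fiber_pts_nonempty:
  assumes "has_section V B \<phi>" "b \<in> pts B" "zdeg B b dvd K"
  shows "fiber_pts V \<phi> K b \<noteq> {}"
proof -
  obtain s where s: "zmorphism B V s" "\<And>b. b \<in> pts B \<Longrightarrow> \<phi> (s b) = b"
    using assms(1) unfolding has_section_def by blast
  have "s b \<in> pts V" using s(1) assms(2) by (auto simp: zmorphism_def)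
  then have "s b \<in> fiber_pts V \<phi> K b"
    using zdeg_dvd_of_zmorphism[OF B V s(1) assms(2)] assms(3) s(2)[OF assms(2)]
    by (auto simp: fiber_pts_def fixed_pts_iff[OF V])
  then show ?thesis by blast
qed

lemma expect_const_1:
  assumes sec: "has_section V B \<phi>" and b: "b \<in> pts B"
  shows "expect V B \<phi> (\<lambda>_. 1) b = 1"
proof (rule ghost_eqI)
  fix k :: nat assume k: "k \<ge> 1"
  let ?K = "k * zdeg B b"
  have K: "?K \<ge> 1" "zdeg B b dvd ?K" "?K div zdeg B b = k"
    using k zdeg_pos[OF B b] by simp_all
  have "(\<Sum>v\<in>fiber_pts V \<phi> ?K b. ghost 1 (?K div zdeg V v)) = of_nat (card (fiber_pts V \<phi> ?K b))"
  proof -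
    have "ghost 1 (?K div zdeg V v) = 1" if "v \<in> fiber_pts V \<phi> ?K b" for v
      using that K(1) by (intro ghost_one div_ge_1) (simp_all add: fiber_pts_def fixed_pts_iff[OF V])
    then show ?thesis by simp
  qed
  moreover have "card (fiber_pts V \<phi> ?K b) \<noteq> 0"
    using fiber_pts_nonempty[OF sec b K(2)] finite_fiber_pts[OF V B \<phi> b _ K(1,2), of "\<lambda>_. 1"]
    by (simp add: CW_def)
  ultimately show "ghost (expect V B \<phi> (\<lambda>_. 1) b) k = ghost 1 k"
    using ghost_expect[OF V B \<phi> b _ K(1,2), of "\<lambda>_. 1"] k by (simp add: K(3) CW_def)
qed

end

lemma adams_sum_cong:
  "(\<And>j. 1 \<le> j \<Longrightarrow> j \<le> N \<Longrightarrow> Y j = Y' j) \<Longrightarrow> adams_sum N Y = adams_sum N Y'"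
  by (auto simp: adams_sum_def intro!: sum.cong)

text \<open>The exponent involves only the components at multiples of the given index. This compares the
  exponentials of a function and of its pullback, whose components are the same up to reindexing.\<close>

lemma gmap_Exp_sigma_const_h1_cong:
  assumes "p \<ge> 1" "q \<ge> 1" and eq: "\<And>j. j \<ge> 1 \<Longrightarrow> ghost x (j * p) = ghost y (j * q)"
  shows "gmap p (Exp_sigma (mps_const x * h1)) = gmap q (Exp_sigma (mps_const y * h1))"
proof (rule mps_eqI)
  fix m :: "nat multiset"
  let ?N = "size m"
  have "agree (Suc ?N) (gmap p (Exp_sigma (mps_const x * h1)))
      (cexp (adams_sum ?N (\<lambda>j. gmap (j * p) (mps_const x * h1))))"
    by (rule agree_Exp_sigma[OF const_h1_in_Fil1 assms(1)])
  also have "adams_sum ?N (\<lambda>j. gmap (j * p) (mps_const x * h1)) =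
      adams_sum ?N (\<lambda>j. gmap (j * q) (mps_const y * h1))"
  proof (rule adams_sum_cong, rule mps_eqI)
    fix j :: nat and n assume "1 \<le> j"
    then show "mcoeff (gmap (j * p) (mps_const x * h1)) n = mcoeff (gmap (j * q) (mps_const y * h1)) n"
      using eq by (simp add: mcoeff_const_h1 del: mcoeff_const_mult)
  qed
  also have "agree (Suc ?N) (cexp \<dots>) (gmap q (Exp_sigma (mps_const y * h1)))"
    by (rule agree_sym[OF agree_Exp_sigma[OF const_h1_in_Fil1 assms(2)]])
  finally have "agree (Suc ?N) (gmap p (Exp_sigma (mps_const x * h1))) (gmap q (Exp_sigma (mps_const y * h1)))" .
  then show "mcoeff (gmap p (Exp_sigma (mps_const x * h1))) m = mcoeff (gmap q (Exp_sigma (mps_const y * h1))) m"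
    unfolding agree_def by blast
qed

lemma fiber_int_0: "fiber_int V B \<phi> (\<lambda>_. 0) b = 0"
proof -
  have "witt_subst (card q) (the_elem ((\<lambda>_. 0) ` q)) = 0" if "q \<in> zorbits (fiber V B \<phi> b)" for q
  proof -
    have "q \<noteq> {}" using that by (auto simp: zorbits_eq zorbit_eq)
    then show ?thesis
      by (simp add: image_constant_conv witt_subst_def zero_witt_def Witt_inverse)
  qed
  then show ?thesis by (simp add: fiber_int_def cong: infsum_cong)
qed

lemma coeffwise_fiber_int_const_h1:
  "coeffwise (fiber_int V B \<phi>) (\<lambda>v. mps_const (f v) * h1) b = mps_const (fiber_int V B \<phi> f b) * h1"
  by (rule mps_eqI) (simp add: mcoeff_h1 fiber_int_0)

text \<open>\<open>Log\<^sub>\<sigma>\<close> undoes the exponential, and coefficientwise integration of \<open>f h\<^sub>1\<close>, whose coefficients are \<open>f\<close> and \<open>0\<close>,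
  integrates \<open>f\<close>.\<close>

lemma euler_prod_Exp_sigma_const_h1:
  "euler_prod V B \<phi> (\<lambda>v. Exp_sigma (mps_const (f v) * h1)) b = Exp_sigma (mps_const (fiber_int V B \<phi> f b) * h1)"
  by (simp add: euler_prod_def Log_sigma_Exp_sigma[OF const_h1_in_Fil1] coeffwise_fiber_int_const_h1)

lemma fiber_pts_zpoint: "fiber_pts V (\<lambda>_. ()) k () = fixed_pts k V"
  by (simp add: fiber_pts_def)

text \<open>Factoring over the orbits recombines the logarithms in the definition of the Euler product into values of
  \<open>H\<close> itself.\<close>

lemma ghost_euler_prod_zpoint:
  assumes B: "admissible B" and k: "k \<ge> 1"
    and H: "H \<in> CW B" "\<And>b. b \<in> pts B \<Longrightarrow> mcoeff (H b) {#} = 1"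
  shows "ghost (mcoeff (euler_prod B zpoint (\<lambda>_. ()) H ()) m) k =
    mcoeff (\<Prod>r\<in>orbit_reps (scale k B) (trunc_pts (size m) k B).
      psi (zdeg (scale k B) r) (gmap (zdeg (scale k B) r * k div zdeg B r) (H r))) m"
proof -
  let ?N = "size m" and ?S = "scale k B"
  let ?W = "trunc_pts ?N k B"
  define F where "F = (\<lambda>b. Log_sigma (H b))"
  have F: "F b \<in> Fil1" "Exp_sigma (F b) = H b" if "b \<in> pts B" for b
    using Log_sigma[OF H(2)[OF that]] by (simp_all add: F_def)
  have F_CW: "F \<in> CW B" using H(1) by (simp add: F_def CW_def)
  define G where "G = coeffwise (fiber_int B zpoint (\<lambda>_. ())) F ()"
  have pt: "() \<in> pts zpoint" by (simp add: zpoint_def)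
  have G_gmap: "gmap K G = (\<Sum>b\<in>fixed_pts K B. gmap (K div zdeg B b) (F b))" if "K \<ge> 1" for K
    using gmap_coeffwise_fiber_int[OF B admissible_zpoint zmorphism_zpoint F_CW pt that]
    by (simp add: G_def zdeg_zpoint fiber_pts_zpoint)
  have "mcoeff G {#} = 0"
  proof (rule ghost_eqI)
    fix K :: nat assume "K \<ge> 1"
    have "ghost (mcoeff G {#}) K = mcoeff (gmap K G) {#}" by simp
    also have "\<dots> = (\<Sum>b\<in>fixed_pts K B. ghost (mcoeff (F b) {#}) (K div zdeg B b))"
      unfolding G_gmap[OF \<open>K \<ge> 1\<close>] by (simp add: mcoeff_sum)
    also have "\<dots> = 0"
      using F(1) by (intro sum.neutral) (auto simp: Fil1_def fixed_pts_def)
    finally show "ghost (mcoeff G {#}) K = ghost 0 K" by simp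
  qed
  then have G: "G \<in> Fil1" by (simp add: Fil1_def)
  have "agree (Suc ?N) (gmap k (Exp_sigma G)) (cexp (adams_sum ?N (\<lambda>j. gmap (j * k) G)))"
    by (rule agree_Exp_sigma[OF G k])
  also have "adams_sum ?N (\<lambda>j. gmap (j * k) G) =
      adams_sum ?N (\<lambda>j. \<Sum>b\<in>fixed_pts (j * k) B. gmap (j * k div zdeg B b) (F b))"
    using k by (intro adams_sum_cong G_gmap) simp
  also have "agree (Suc ?N) (cexp \<dots>)
      (\<Prod>r\<in>orbit_reps ?S ?W. psi (zdeg ?S r) (gmap (zdeg ?S r * k div zdeg B r) (Exp_sigma (F r))))"
  proof (rule Euler_factorization[OF B k])
    fix b assume "b \<in> ?W"
    then have b: "b \<in> pts B" using trunc_pts_subset[OF B k] by blast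
    show "F b \<in> Fil1" by (rule F[OF b])
    show "zdeg B b dvd zdeg ?S b * k"
      using zdeg_scale_dvd_iff[OF B k b, of "zdeg ?S b"] by (simp add: mult.commute)
    fix j
    show "F (act ?S j b) = F b" "zdeg B (act ?S j b) = zdeg B b"
      using F_CW b zdeg_act[OF B b] by (auto simp: CW_def scale_def)
  qed
  also have "(\<Prod>r\<in>orbit_reps ?S ?W. psi (zdeg ?S r) (gmap (zdeg ?S r * k div zdeg B r) (Exp_sigma (F r)))) =
      (\<Prod>r\<in>orbit_reps ?S ?W. psi (zdeg ?S r) (gmap (zdeg ?S r * k div zdeg B r) (H r)))"
    using orbit_reps_subset[OF admissible_scale[OF B k] invariant_trunc_pts[OF B k]] trunc_pts_subset[OF B k]
    by (intro prod.cong refl) (metis F(2) subsetD)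
  finally have "mcoeff (gmap k (Exp_sigma G)) m =
      mcoeff (\<Prod>r\<in>orbit_reps ?S ?W. psi (zdeg ?S r) (gmap (zdeg ?S r * k div zdeg B r) (H r))) m"
    unfolding agree_def by blast
  then show ?thesis by (simp add: euler_prod_def G_def F_def)
qed


section \<open>Equidistribution\<close>

context
  fixes A :: "'a zset" and B :: "'b zset" and \<pi> :: "'a \<Rightarrow> 'b"
    and I :: "'i set" and le :: "'i \<Rightarrow> 'i \<Rightarrow> bool"
    and U :: "'i \<Rightarrow> 'u zset" and evd :: "'i \<Rightarrow> 'u \<times> 'b \<Rightarrow> 'a" and \<X> :: "'a \<Rightarrow> witt"
  assumes A: "admissible A" and B: "admissible B"
    and \<pi>: "zmorphism A B \<pi>" and sec: "has_section A B \<pi>"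
    and dir: "directed_set I le"
    and U: "\<And>d. d \<in> I \<Longrightarrow> admissible (U d)"
    and evd: "\<And>d. d \<in> I \<Longrightarrow> zmorphism (zprod (U d) B) A (evd d)"
    and over: "\<And>d u b. d \<in> I \<Longrightarrow> u \<in> pts (U d) \<Longrightarrow> b \<in> pts B \<Longrightarrow> \<pi> (evd d (u, b)) = b"
    and equi: "equidistributes I le U evd A B \<pi>"
    and \<X>: "\<X> \<in> CW A"
begin

lemma eventually_in_I: "\<forall>\<^sub>F d in net I le. d \<in> I"
  using dir unfolding eventually_net[OF dir] by (auto simp: directed_set_def)

lemma evd_pts: "d \<in> I \<Longrightarrow> u \<in> pts (U d) \<Longrightarrow> b \<in> pts B \<Longrightarrow> evd d (u, b) \<in> pts A"
  using evd[of d] by (auto simp: zmorphism_def zprod_def)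

lemma evd_act:
  "d \<in> I \<Longrightarrow> u \<in> pts (U d) \<Longrightarrow> b \<in> pts B \<Longrightarrow> evd d (act (U d) j u, act B j b) = act A j (evd d (u, b))"
  using evd[of d] by (fastforce simp: zmorphism_def zprod_def)

lemma evd_section:
  assumes "d \<in> I" "u \<in> fixed_pts k (U d)" "invariant_subset (scale k B) W"
  shows "restrict (\<lambda>b. evd d (u, b)) W \<in> sections_on (scale k A) (scale k B) \<pi> W"
proof -
  have W: "b \<in> pts B" "act B (int k * j) b \<in> W" if "b \<in> W" for b j
    using assms(3) that by (auto simp: invariant_subset_def scale_def)
  have u: "u \<in> pts (U d)" "act (U d) (int k * j) u = u" for j
    using assms(2) by (auto simp: fixed_pts_def)
  have "evd d (u, act B (int k * j) b) = act A (int k * j) (evd d (u, b))" if "b \<in> W" for b j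
    using evd_act[OF assms(1) u(1) W(1)[OF that], of "int k * j"] u(2) by simp
  then show ?thesis
    using W over[OF assms(1) u(1)] evd_pts[OF assms(1) u(1)]
    by (auto simp: sections_on_iff scale_def)
qed

text \<open>For the empty set there is exactly one section, so the convergence holds there as well; this case
  occurs for the constant coefficient, for instance.\<close>

lemma tendsto_pmf_sections:
  assumes k: "k \<ge> 1" and W: "finite W" "invariant_subset (scale k B) W"
    and s: "s \<in> sections_on (scale k A) (scale k B) \<pi> W"
  shows "((\<lambda>d. pmf (map_pmf (\<lambda>u. restrict (\<lambda>b. evd d (u, b)) W) (pmf_of_set (fixed_pts k (U d)))) s)
    \<longlongrightarrow> pmf (pmf_of_set (sections_on (scale k A) (scale k B) \<pi> W)) s) (net I le)"
proof (cases "W = {}")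
  case True
  have "sections_on (scale k A) (scale k B) \<pi> {} = {\<lambda>_. undefined}"
    by (auto simp: sections_on_iff extensional_def)
  then show ?thesis
    using s by (simp add: True restrict_def pmf_of_set_singleton map_pmf_const)
next
  case False
  have "admissible ((scale k B)\<lparr>pts := W\<rparr>)"
    using W(2) by (intro admissible_scaled_subset[OF B k]) (auto simp: invariant_subset_def scale_def)
  then show ?thesis
    using equi k W False s unfolding equidistributes_def
    by (auto simp: invariant_subset_def scale_def)
qed

text \<open>A uniformly random section takes independent uniformly distributed values at the orbit
  representatives, so the mean of a product is the product of the means.\<close>

lemma tendsto_mean_of_prod:
  assumes k: "k \<ge> 1" and W: "finite W" "invariant_subset (scale k B) W"
  defines "R \<equiv> orbit_reps (scale k B) W"
  shows "((\<lambda>d. (\<Sum>u\<in>fixed_pts k (U d). mcoeff (\<Prod>r\<in>R. g r (evd d (u, r))) m) / of_nat (card (fixed_pts k (U d))))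
    \<longlongrightarrow> mcoeff (\<Prod>r\<in>R. fiber_mean A \<pi> (zdeg (scale k B) r * k) (g r) r) m) (net I le)"
proof -
  let ?A = "scale k A" and ?B = "scale k B"
  let ?T = "sections_on ?A ?B \<pi> W"
  define P where "P = (\<lambda>r. fiber_pts A \<pi> (zdeg ?B r * k) r)"
  have SA: "admissible ?A" and SB: "admissible ?B" by (rule admissible_scale[OF A k], rule admissible_scale[OF B k])
  have S\<pi>: "zmorphism ?A ?B \<pi>" using \<pi> by (auto simp: zmorphism_def scale_def)
  have RW: "R \<subseteq> W" unfolding R_def by (rule orbit_reps_subset[OF SB W(2)])
  have Rp: "r \<in> pts B" if "r \<in> R" for r
    using RW W(2) that by (auto simp: invariant_subset_def scale_def)
  have finR: "finite R" using RW W(1) by (rule finite_subset)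
  have "fiber_pts ?A \<pi> n r = fiber_pts A \<pi> (n * k) r" for n r
    by (auto simp: fiber_pts_def fixed_pts_def scale_def ac_simps)
  then have bij: "bij_betw (\<lambda>s. restrict s R) ?T (PiE R P)"
    using bij_betw_sections_on[OF SA SB S\<pi> W(2)] by (simp add: P_def R_def)
  have P: "finite (P r)" "P r \<noteq> {}" if r: "r \<in> R" for r
  proof -
    have "zdeg B r dvd zdeg ?B r * k"
      using zdeg_scale_dvd_iff[OF B k Rp[OF r], of "zdeg ?B r"] by (simp add: mult.commute)
    then show "P r \<noteq> {}" unfolding P_def by (rule fiber_pts_nonempty[OF A B \<pi> sec Rp[OF r]])
    have "zdeg ?B r * k \<ge> 1" using zdeg_scale_pos[OF B k Rp[OF r]] k by simp
    then show "finite (P r)" using finite_fixed_pts[OF A] by (simp add: P_def fiber_pts_def)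
  qed
  have T: "finite ?T" "?T \<noteq> {}"
  proof -
    show "finite ?T" using bij_betw_finite[OF bij] finite_PiE[OF finR] P(1) by blast
    have "PiE R P \<noteq> {}" using P(2) by (simp add: PiE_eq_empty_iff)
    then show "?T \<noteq> {}" using bij by (auto simp: bij_betw_def)
  qed
  define h where "h = (\<lambda>s. mcoeff (\<Prod>r\<in>R. g r (s r)) m)"
  have h_restrict: "h (restrict s R) = h s" "h (restrict s W) = h s" for s
    unfolding h_def using RW by (auto intro!: arg_cong[where f = "\<lambda>F. mcoeff F m"] prod.cong)
  have "\<forall>\<^sub>F d in net I le. fixed_pts 1 (U d) \<noteq> {}"
    using equi by (simp add: equidistributes_def)
  then have "\<forall>\<^sub>F d in net I le. finite (fixed_pts k (U d)) \<and> fixed_pts k (U d) \<noteq> {} \<and>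
      (\<lambda>u. restrict (\<lambda>b. evd d (u, b)) W) ` fixed_pts k (U d) \<subseteq> ?T"
    using eventually_in_I
  proof eventually_elim
    case (elim d)
    have "fixed_pts 1 (U d) \<subseteq> fixed_pts k (U d)" by (auto simp: fixed_pts_def)
    then show ?case
      using elim finite_fixed_pts[OF U k] evd_section[OF _ _ W(2)] by auto
  qed
  from tendsto_average[OF tendsto_pmf_sections[OF k W] this T, of h]
  have lim: "((\<lambda>d. (\<Sum>u\<in>fixed_pts k (U d). h (\<lambda>b. evd d (u, b))) / of_nat (card (fixed_pts k (U d))))
      \<longlongrightarrow> (\<Sum>s\<in>?T. h s) / of_nat (card ?T)) (net I le)"
    by (simp add: h_restrict)
  have "(\<Sum>s\<in>?T. h s) = (\<Sum>x\<in>PiE R P. h x)"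
    using sum.reindex_bij_betw[OF bij, of h] by (simp add: h_restrict)
  also have "\<dots> = mcoeff (\<Prod>r\<in>R. \<Sum>a\<in>P r. g r a) m"
    using P(1) by (simp add: h_def mcoeff_sum prod_sum_PiE[OF finR])
  finally have num: "(\<Sum>s\<in>?T. h s) = mcoeff (\<Prod>r\<in>R. \<Sum>a\<in>P r. g r a) m" .
  have den: "card ?T = (\<Prod>r\<in>R. card (P r))"
    using bij_betw_same_card[OF bij] by (simp add: card_PiE[OF finR])
  have "(\<Prod>r\<in>Q. mps_const (1 / of_nat (card (P r))) * (\<Sum>a\<in>P r. g r a)) =
      mps_const (1 / of_nat (\<Prod>r\<in>Q. card (P r))) * (\<Prod>r\<in>Q. \<Sum>a\<in>P r. g r a)" for Q
  proof (induction Q rule: infinite_finite_induct)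
    case (insert x Q)
    have "mps_const a * F * (mps_const b * G) = mps_const (a * b) * (F * G)" for a b :: complex and F G
    proof -
      have "mps_const a * (mps_const b * (F * G)) = mps_const (a * b) * (F * G)"
        by (rule mps_eqI) simp
      then show ?thesis by (simp add: ac_simps)
    qed
    with insert show ?case by simp
  qed (auto intro!: mps_eqI simp: mps_const_def)
  then have "(\<Prod>r\<in>R. fiber_mean A \<pi> (zdeg ?B r * k) (g r) r) =
      mps_const (1 / of_nat (card ?T)) * (\<Prod>r\<in>R. \<Sum>a\<in>P r. g r a)"
    unfolding den fiber_mean_def P_def by blast
  then show ?thesis using lim[unfolded num, unfolded h_def] by simp
qed

text \<open>In the notation of the theorem, \<open>X_ev d\<close> is \<open>\<X>\<^sub>d\<close> and \<open>X_int d\<close> is \<open>X\<^sub>d\<close>.\<close>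

abbreviation Exp_X :: "'a \<Rightarrow> witt mps" where
  "Exp_X \<equiv> \<lambda>a. Exp_sigma (mps_const (\<X> a) * h1)"

lemma Exp_X_in_CW: "Exp_X \<in> CW A"
  using \<X> by (simp add: CW_def)

abbreviation mean_Exp_X :: "'b \<Rightarrow> witt mps" where
  "mean_Exp_X \<equiv> coeffwise (expect A B \<pi>) Exp_X"

lemma mcoeff_mean_Exp_X_empty: "b \<in> pts B \<Longrightarrow> mcoeff (mean_Exp_X b) {#} = 1"
  using expect_const_1[OF A B \<pi> sec]
  by (simp add: mcoeff_Exp_sigma_empty[OF const_h1_in_Fil1])

abbreviation X_ev :: "'i \<Rightarrow> 'u \<times> 'b \<Rightarrow> witt" where
  "X_ev d \<equiv> pullback (zprod (U d) B) A (evd d) \<X>"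

abbreviation X_int :: "'i \<Rightarrow> 'u \<Rightarrow> witt" where
  "X_int d \<equiv> fiber_int (zprod (U d) B) (U d) fst (X_ev d)"

lemma X_ev_in_CW: "d \<in> I \<Longrightarrow> X_ev d \<in> CW (zprod (U d) B)"
  using admissible_zprod(1)[OF U B] evd \<X> by (intro pullback_in_CW A) auto

lemma X_int_in_CW: "d \<in> I \<Longrightarrow> X_int d \<in> CW (U d)"
  using admissible_zprod(1)[OF U B] U by (intro fiber_int_in_CW zmorphism_fst X_ev_in_CW) auto

lemma ghost_X_int:
  assumes d: "d \<in> I" and u: "u \<in> fixed_pts K (U d)" and K: "K \<ge> 1"
  shows "ghost (X_int d u) (K div zdeg (U d) u) =
    (\<Sum>b\<in>fixed_pts K B. ghost (\<X> (evd d (u, b))) (K div zdeg A (evd d (u, b))))"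
proof -
  let ?UB = "zprod (U d) B"
  have UB: "admissible ?UB" by (rule admissible_zprod(1)[OF U[OF d] B])
  have u': "u \<in> pts (U d)" "zdeg (U d) u dvd K"
    using u by (simp_all add: fixed_pts_iff[OF U[OF d]])
  have "ghost (X_int d u) (K div zdeg (U d) u) = (\<Sum>x\<in>fiber_pts ?UB fst K u. ghost (X_ev d x) (K div zdeg ?UB x))"
    by (rule ghost_fiber_int[OF UB U[OF d] zmorphism_fst u'(1) X_ev_in_CW[OF d] K u'(2)])
  also have "fiber_pts ?UB fst K u = (\<lambda>b. (u, b)) ` fixed_pts K B"
    using u by (auto simp: fiber_pts_def fixed_pts_zprod[OF U[OF d] B])
  also have "(\<Sum>x\<in>(\<lambda>b. (u, b)) ` fixed_pts K B. ghost (X_ev d x) (K div zdeg ?UB x)) =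
      (\<Sum>b\<in>fixed_pts K B. ghost (X_ev d (u, b)) (K div zdeg ?UB (u, b)))"
    by (subst sum.reindex) (auto simp: inj_on_def)
  also have "\<dots> = (\<Sum>b\<in>fixed_pts K B. ghost (\<X> (evd d (u, b))) (K div zdeg A (evd d (u, b))))"
  proof (rule sum.cong[OF refl])
    fix b assume "b \<in> fixed_pts K B"
    then have "(u, b) \<in> fixed_pts K ?UB" using u by (simp add: fixed_pts_zprod[OF U[OF d] B])
    then have "(u, b) \<in> pts ?UB" "zdeg ?UB (u, b) dvd K" by (simp_all add: fixed_pts_iff[OF UB])
    then show "ghost (X_ev d (u, b)) (K div zdeg ?UB (u, b)) =
        ghost (\<X> (evd d (u, b))) (K div zdeg A (evd d (u, b)))"
      by (rule ghost_pullback[OF UB A evd[OF d] _ _ K])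
  qed
  finally show ?thesis .
qed

text \<open>A point \<open>u\<close> fixed by \<open>k\<int>\<close> makes \<open>b \<mapsto> ev\<^sub>d(u, b)\<close> equivariant for \<open>k\<int>\<close>, so the integral over the fiber at \<open>u\<close>
  is a sum of the kind that factors over the \<open>k\<int>\<close>-orbits in \<open>B\<close>.\<close>

lemma ghost_Exp_sigma_X_int:
  assumes d: "d \<in> I" and u: "u \<in> fixed_pts k (U d)" and k: "k \<ge> 1"
  shows "ghost (mcoeff (Exp_sigma (mps_const (X_int d u) * h1)) m) (k div zdeg (U d) u) =
    mcoeff (\<Prod>r\<in>orbit_reps (scale k B) (trunc_pts (size m) k B).
      psi (zdeg (scale k B) r)
        (gmap (zdeg (scale k B) r * k div zdeg A (evd d (u, r))) (Exp_X (evd d (u, r))))) m"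
proof -
  let ?N = "size m" and ?S = "scale k B"
  let ?W = "trunc_pts ?N k B"
  define e where "e = k div zdeg (U d) u"
  define F where "F = (\<lambda>b. mps_const (\<X> (evd d (u, b))) * h1)"
  define \<delta> where "\<delta> = (\<lambda>b. zdeg A (evd d (u, b)))"
  have u': "u \<in> pts (U d)" "zdeg (U d) u dvd k"
    using u by (simp_all add: fixed_pts_iff[OF U[OF d]])
  have e: "e \<ge> 1" unfolding e_def by (rule div_ge_1[OF u'(2) k])
  have G: "gmap (j * e) (mps_const (X_int d u) * h1) = (\<Sum>b\<in>fixed_pts (j * k) B. gmap (j * k div \<delta> b) (F b))"
    if "j \<ge> 1" for j
  proof (rule mps_eqI)
    fix n
    have "u \<in> fixed_pts (j * k) (U d)" using u' by (simp add: fixed_pts_iff[OF U[OF d]])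
    moreover have "j * k \<ge> 1" using that k by simp
    moreover have "j * e = j * k div zdeg (U d) u"
      unfolding e_def by (rule div_mult_swap[OF u'(2)])
    ultimately have *: "ghost (X_int d u) (j * e) =
        (\<Sum>b\<in>fixed_pts (j * k) B. ghost (\<X> (evd d (u, b))) (j * k div \<delta> b))"
      using ghost_X_int[OF d] by (simp add: \<delta>_def)
    show "mcoeff (gmap (j * e) (mps_const (X_int d u) * h1)) n =
        mcoeff (\<Sum>b\<in>fixed_pts (j * k) B. gmap (j * k div \<delta> b) (F b)) n"
      by (simp add: F_def mcoeff_sum mcoeff_const_h1 * del: mcoeff_const_mult)
  qed
  have "agree (Suc ?N) (gmap e (Exp_sigma (mps_const (X_int d u) * h1)))
      (cexp (adams_sum ?N (\<lambda>j. gmap (j * e) (mps_const (X_int d u) * h1))))"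
    by (rule agree_Exp_sigma[OF const_h1_in_Fil1 e])
  also have "adams_sum ?N (\<lambda>j. gmap (j * e) (mps_const (X_int d u) * h1)) =
      adams_sum ?N (\<lambda>j. \<Sum>b\<in>fixed_pts (j * k) B. gmap (j * k div \<delta> b) (F b))"
    by (intro adams_sum_cong G)
  also have "agree (Suc ?N) (cexp \<dots>)
      (\<Prod>r\<in>orbit_reps ?S ?W. psi (zdeg ?S r) (gmap (zdeg ?S r * k div \<delta> r) (Exp_sigma (F r))))"
  proof (rule Euler_factorization[OF B k])
    fix b assume "b \<in> ?W"
    then have b: "b \<in> pts B" using trunc_pts_subset[OF B k] by blast
    let ?a = "evd d (u, b)"
    have a: "?a \<in> pts A" by (rule evd_pts[OF d u'(1) b])
    show "F b \<in> Fil1" by (simp add: F_def const_h1_in_Fil1)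
    have c: "zdeg B b dvd zdeg ?S b * k"
      using zdeg_scale_dvd_iff[OF B k b, of "zdeg ?S b"] by (simp add: mult.commute)
    have "act A (int (zdeg ?S b * k)) ?a = ?a"
      using evd_act[OF d u'(1) b, of "int (zdeg ?S b * k)"] c u'(2)
        act_fixed_iff[OF B b, of "int (zdeg ?S b * k)"]
        act_fixed_iff[OF U[OF d] u'(1), of "int (zdeg ?S b * k)"]
      by (metis dvd_mult of_nat_dvd_iff)
    then show "\<delta> b dvd zdeg ?S b * k"
      using act_fixed_iff[OF A a] by (metis \<delta>_def of_nat_dvd_iff)
    fix j
    have "evd d (u, act ?S j b) = act A (int k * j) ?a"
      using evd_act[OF d u'(1) b, of "int k * j"] u by (simp add: scale_def fixed_pts_def)
    then show "F (act ?S j b) = F b" "\<delta> (act ?S j b) = \<delta> b"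
      using \<X> a zdeg_act[OF A a] by (simp_all add: F_def \<delta>_def CW_def)
  qed
  finally have "mcoeff (gmap e (Exp_sigma (mps_const (X_int d u) * h1))) m =
      mcoeff (\<Prod>r\<in>orbit_reps ?S ?W. psi (zdeg ?S r) (gmap (zdeg ?S r * k div \<delta> r) (Exp_sigma (F r)))) m"
    unfolding agree_def by blast
  then show ?thesis by (simp add: e_def F_def \<delta>_def)
qed

text \<open>Both sides factor over the orbits of \<open>k\<int>\<close> on the
  relevant points of \<open>B\<close>, and equidistribution turns the mean over \<open>U\<^sub>d\<close> into the mean over sections.\<close>

lemma tendsto_expect_Exp_sigma_X_int:
  "((\<lambda>d. mcoeff (coeffwise (expect (U d) zpoint (\<lambda>_. ())) (\<lambda>u. Exp_sigma (mps_const (X_int d u) * h1)) ()) m)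
    \<longlongrightarrow> mcoeff (euler_prod B zpoint (\<lambda>_. ()) mean_Exp_X ()) m) (net I le)"
  unfolding tendsto_witt_iff
proof (intro allI impI)
  fix k :: nat assume k: "k \<ge> 1"
  let ?S = "scale k B" and ?W = "trunc_pts (size m) k B"
  let ?R = "orbit_reps ?S ?W"
  let ?E = "\<lambda>d u. Exp_sigma (mps_const (X_int d u) * h1)"
  define g where "g = (\<lambda>r a. psi (zdeg ?S r) (gmap (zdeg ?S r * k div zdeg A a) (Exp_X a)))"
  have Rp: "r \<in> pts B" if "r \<in> ?R" for r
    using orbit_reps_subset[OF admissible_scale[OF B k] invariant_trunc_pts[OF B k]]
      trunc_pts_subset[OF B k] that by blast
  have ev: "\<forall>\<^sub>F d in net I le.
      (\<Sum>u\<in>fixed_pts k (U d). mcoeff (\<Prod>r\<in>?R. g r (evd d (u, r))) m) / of_nat (card (fixed_pts k (U d))) =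
      ghost (mcoeff (coeffwise (expect (U d) zpoint (\<lambda>_. ())) (?E d) ()) m) k"
    using eventually_in_I
  proof eventually_elim
    case (elim d)
    have "(\<lambda>u. mcoeff (?E d u) m) \<in> CW (U d)" using X_int_in_CW[OF elim] by (simp add: CW_def)
    from ghost_expect[OF U[OF elim] admissible_zpoint zmorphism_zpoint _ this k, of "()"]
    have "ghost (mcoeff (coeffwise (expect (U d) zpoint (\<lambda>_. ())) (?E d) ()) m) k =
        (\<Sum>u\<in>fixed_pts k (U d). ghost (mcoeff (?E d u) m) (k div zdeg (U d) u)) / of_nat (card (fixed_pts k (U d)))"
      by (simp add: zdeg_zpoint fiber_pts_zpoint) (simp add: zpoint_def)
    then show ?case
      using ghost_Exp_sigma_X_int[OF elim _ k] by (simp add: g_def)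
  qed
  have lim_eq: "mcoeff (\<Prod>r\<in>?R. fiber_mean A \<pi> (zdeg ?S r * k) (g r) r) m =
      ghost (mcoeff (euler_prod B zpoint (\<lambda>_. ()) mean_Exp_X ()) m) k"
  proof (subst ghost_euler_prod_zpoint[OF B k coeffwise_expect_in_CW[OF A B \<pi> Exp_X_in_CW]],
      erule mcoeff_mean_Exp_X_empty, intro arg_cong[where f = "\<lambda>F. mcoeff F m"] prod.cong refl)
    fix r assume r: "r \<in> ?R"
    let ?K = "zdeg ?S r * k"
    have c: "zdeg ?S r \<ge> 1" by (rule zdeg_scale_pos[OF B k Rp[OF r]])
    have "zdeg B r dvd ?K"
      using zdeg_scale_dvd_iff[OF B k Rp[OF r], of "zdeg ?S r"] by (simp add: mult.commute)
    moreover have "?K \<ge> 1" using c k by simp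
    ultimately show "fiber_mean A \<pi> ?K (g r) r = psi (zdeg ?S r) (gmap (?K div zdeg B r) (mean_Exp_X r))"
      using gmap_coeffwise_expect[OF A B \<pi> Exp_X_in_CW Rp[OF r]] c
      by (simp add: psi_fiber_mean g_def)
  qed
  show "((\<lambda>d. ghost (mcoeff (coeffwise (expect (U d) zpoint (\<lambda>_. ())) (?E d) ()) m) k)
      \<longlongrightarrow> ghost (mcoeff (euler_prod B zpoint (\<lambda>_. ()) mean_Exp_X ()) m) k) (net I le)"
    using tendsto_mean_of_prod[OF k finite_trunc_pts[OF B k, of "size m"] invariant_trunc_pts[OF B k],
        where g = g and m = m]
    unfolding lim_eq by (rule Lim_transform_eventually[OF _ ev])
qed

lemma gmap_Exp_sigma_X_ev:
  assumes d: "d \<in> I" and x: "x \<in> fixed_pts K (zprod (U d) B)" and K: "K \<ge> 1"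
  shows "gmap (K div zdeg (zprod (U d) B) x) (Exp_sigma (mps_const (X_ev d x) * h1)) =
    gmap (K div zdeg A (evd d x)) (Exp_X (evd d x))"
proof -
  let ?UB = "zprod (U d) B"
  have UB: "admissible ?UB" by (rule admissible_zprod(1)[OF U[OF d] B])
  have x': "x \<in> pts ?UB" "zdeg ?UB x dvd K" using x by (simp_all add: fixed_pts_iff[OF UB])
  then have a: "zdeg A (evd d x) dvd K"
    using zdeg_dvd_of_zmorphism[OF UB A evd[OF d] x'(1)] dvd_trans by blast
  show ?thesis
  proof (rule gmap_Exp_sigma_const_h1_cong)
    show "K div zdeg ?UB x \<ge> 1" "K div zdeg A (evd d x) \<ge> 1"
      by (rule div_ge_1[OF x'(2) K], rule div_ge_1[OF a K])
    show "ghost (X_ev d x) (j * (K div zdeg ?UB x)) = ghost (\<X> (evd d x)) (j * (K div zdeg A (evd d x)))"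
      if "j \<ge> 1" for j
      using ghost_pullback[OF UB A evd[OF d] x'(1), of "j * K"] that K x'(2)
      by (simp add: div_mult_swap[OF x'(2)] div_mult_swap[OF a])
  qed
qed

text \<open>Here equidistribution is applied to the single point \<open>b\<close>, which is fixed by the multiples of its
  degree.\<close>

lemma tendsto_expect_Exp_sigma_X_ev:
  assumes b: "b \<in> pts B"
  shows "((\<lambda>d. mcoeff (coeffwise (expect (zprod (U d) B) B snd) (\<lambda>x. Exp_sigma (mps_const (X_ev d x) * h1)) b) m)
    \<longlongrightarrow> mcoeff (mean_Exp_X b) m) (net I le)"
  unfolding tendsto_witt_iff
proof (intro allI impI)
  fix k :: nat assume k: "k \<ge> 1"
  let ?E = "\<lambda>d x. Exp_sigma (mps_const (X_ev d x) * h1)"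
  define K where "K = k * zdeg B b"
  have K: "K \<ge> 1" "zdeg B b dvd K" "K div zdeg B b = k"
    using k zdeg_pos[OF B b] by (simp_all add: K_def)
  have fix_b: "act B (int K * j) b = b" for j
    using act_fixed_iff[OF B b, of "int K * j"] K(2) by simp
  have inv: "invariant_subset (scale K B) {b}"
    using b fix_b by (simp add: invariant_subset_def scale_def)
  have orb: "zorbit (scale K B) b = {b}" using fix_b by (auto simp: zorbit_eq scale_def)
  have R: "orbit_reps (scale K B) {b} = {b}" by (simp add: orbit_reps_def orbit_rep_def orb)
  have deg: "zdeg (scale K B) b = 1" by (simp add: zdeg_def orb)
  define g where "g = (\<lambda>a. gmap (K div zdeg A a) (Exp_X a))"
  have ev: "\<forall>\<^sub>F d in net I le.
      (\<Sum>u\<in>fixed_pts K (U d). mcoeff (g (evd d (u, b))) m) / of_nat (card (fixed_pts K (U d))) =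
      ghost (mcoeff (coeffwise (expect (zprod (U d) B) B snd) (?E d) b) m) k"
    using eventually_in_I
  proof eventually_elim
    case (elim d)
    let ?UB = "zprod (U d) B"
    have UB: "admissible ?UB" by (rule admissible_zprod(1)[OF U[OF elim] B])
    have b_fix: "b \<in> fixed_pts K B" using b K(2) by (simp add: fixed_pts_iff[OF B])
    have fib: "fiber_pts ?UB snd K b = (\<lambda>u. (u, b)) ` fixed_pts K (U d)"
      using b_fix by (auto simp: fiber_pts_def fixed_pts_zprod[OF U[OF elim] B])
    have inj: "inj_on (\<lambda>u. (u, b)) (fixed_pts K (U d))" by (auto simp: inj_on_def)
    have "(\<lambda>x. mcoeff (?E d x) m) \<in> CW ?UB" using X_ev_in_CW[OF elim] by (simp add: CW_def)
    from ghost_expect[OF UB B zmorphism_snd b this K(1,2)]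
    have "ghost (mcoeff (coeffwise (expect ?UB B snd) (?E d) b) m) k =
        (\<Sum>u\<in>fixed_pts K (U d). mcoeff (gmap (K div zdeg ?UB (u, b)) (?E d (u, b))) m) / of_nat (card (fixed_pts K (U d)))"
      by (simp add: fib K(3) sum.reindex[OF inj] card_image[OF inj])
    also have "(\<Sum>u\<in>fixed_pts K (U d). mcoeff (gmap (K div zdeg ?UB (u, b)) (?E d (u, b))) m) =
        (\<Sum>u\<in>fixed_pts K (U d). mcoeff (g (evd d (u, b))) m)"
      using b_fix by (intro sum.cong refl)
        (simp only: g_def gmap_Exp_sigma_X_ev[OF elim _ K(1)] fixed_pts_zprod[OF U[OF elim] B] mem_Times_iff fst_conv snd_conv)
    finally show ?case by simp
  qed
  have lim_eq: "mcoeff (fiber_mean A \<pi> K g b) m = ghost (mcoeff (mean_Exp_X b) m) k"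
    using gmap_coeffwise_expect[OF A B \<pi> Exp_X_in_CW b K(1,2), symmetric]
    by (simp add: g_def K(3))
  have "((\<lambda>d. (\<Sum>u\<in>fixed_pts K (U d). mcoeff (g (evd d (u, b))) m) / of_nat (card (fixed_pts K (U d))))
      \<longlongrightarrow> mcoeff (fiber_mean A \<pi> K g b) m) (net I le)"
    using tendsto_mean_of_prod[OF K(1) _ inv, where g = "\<lambda>_. g" and m = m] by (simp add: R deg)
  then show "((\<lambda>d. ghost (mcoeff (coeffwise (expect (zprod (U d) B) B snd) (?E d) b) m) k)
      \<longlongrightarrow> ghost (mcoeff (mean_Exp_X b) m) k) (net I le)"
    unfolding lim_eq by (rule Lim_transform_eventually[OF _ ev])
qed

text \<open>The first two limits are limits of the same family, by the evaluation of motivic Euler products of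
  exponentials of \<open>f h\<^sub>1\<close>.\<close>

lemma limits_of_expectations:
  "\<exists>L1 L2 L3.
      L1 \<in> CW zpoint \<and> L2 \<in> CW zpoint \<and> L3 \<in> CW B \<and>
      series_tendsto zpoint
        (\<lambda>d. coeffwise (expect (U d) zpoint (\<lambda>_. ())) (\<lambda>u. Exp_sigma (mps_const (X_int d u) * h1)))
        L1 (net I le) \<and>
      series_tendsto zpoint
        (\<lambda>d. coeffwise (expect (U d) zpoint (\<lambda>_. ()))
               (euler_prod (zprod (U d) B) (U d) fst (\<lambda>x. Exp_sigma (mps_const (X_ev d x) * h1))))
        L2 (net I le) \<and>
      series_tendsto B
        (\<lambda>d. coeffwise (expect (zprod (U d) B) B snd) (\<lambda>x. Exp_sigma (mps_const (X_ev d x) * h1)))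
        L3 (net I le) \<and>
      L1 = L2 \<and>
      L2 = euler_prod B zpoint (\<lambda>_. ()) L3 \<and>
      euler_prod B zpoint (\<lambda>_. ()) L3 = euler_prod B zpoint (\<lambda>_. ()) mean_Exp_X"
proof -
  let ?L = "euler_prod B zpoint (\<lambda>_. ()) mean_Exp_X"
  have L: "?L \<in> CW zpoint" by (simp add: CW_def zpoint_def)
  have L3: "mean_Exp_X \<in> CW B"
    by (rule coeffwise_expect_in_CW[OF A B \<pi> Exp_X_in_CW])
  have lim_L: "series_tendsto zpoint
      (\<lambda>d. coeffwise (expect (U d) zpoint (\<lambda>_. ())) (\<lambda>u. Exp_sigma (mps_const (X_int d u) * h1))) ?L (net I le)"
    unfolding series_tendsto_def
  proof (intro ballI allI)
    fix b :: unit and m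
    show "((\<lambda>d. mcoeff (coeffwise (expect (U d) zpoint (\<lambda>_. ())) (\<lambda>u. Exp_sigma (mps_const (X_int d u) * h1)) b) m)
        \<longlongrightarrow> mcoeff (?L b) m) (net I le)"
      unfolding unit_eq[of b] by (rule tendsto_expect_Exp_sigma_X_int)
  qed
  have lim_L3: "series_tendsto B
      (\<lambda>d. coeffwise (expect (zprod (U d) B) B snd) (\<lambda>x. Exp_sigma (mps_const (X_ev d x) * h1))) mean_Exp_X (net I le)"
    unfolding series_tendsto_def by (intro ballI allI tendsto_expect_Exp_sigma_X_ev)
  show ?thesis
    unfolding euler_prod_Exp_sigma_const_h1
    by (rule exI[of _ ?L], rule exI[of _ ?L], rule exI[of _ mean_Exp_X]) (intro conjI refl L L3 lim_L lim_L3)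
qed

end

theorem theorem4p2p1:
  fixes A :: "'a zset" and B :: "'b zset" and \<pi> :: "'a \<Rightarrow> 'b"
    and I :: "'i set" and r :: "'i \<Rightarrow> 'i \<Rightarrow> bool"
    and U :: "'i \<Rightarrow> 'u zset" and evd :: "'i \<Rightarrow> 'u \<times> 'b \<Rightarrow> 'a"
    and \<X> :: "'a \<Rightarrow> witt"
    and \<X>d :: "'i \<Rightarrow> 'u \<times> 'b \<Rightarrow> witt" and Xd :: "'i \<Rightarrow> 'u \<Rightarrow> witt"
  assumes "admissible A" and "admissible B"
    and "zmorphism A B \<pi>" and "has_section A B \<pi>"
    and "directed_set I r"
    and "\<And>d. d \<in> I \<Longrightarrow> admissible (U d)"
    and "\<And>d. d \<in> I \<Longrightarrow> zmorphism (zprod (U d) B) A (evd d)"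
    and "\<And>d u b. d \<in> I \<Longrightarrow> u \<in> pts (U d) \<Longrightarrow> b \<in> pts B \<Longrightarrow> \<pi> (evd d (u, b)) = b"
    and "equidistributes I r U evd A B \<pi>"
    and "\<X> \<in> CW A"
  defines "\<X>d \<equiv> \<lambda>d. pullback (zprod (U d) B) A (evd d) \<X>"
    and "Xd \<equiv> \<lambda>d. fiber_int (zprod (U d) B) (U d) fst (\<X>d d)"
  shows "\<exists>L1 L2 L3.
      L1 \<in> CW zpoint \<and> L2 \<in> CW zpoint \<and> L3 \<in> CW B \<and>
      series_tendsto zpoint
        (\<lambda>d. coeffwise (expect (U d) zpoint (\<lambda>_. ()))
               (\<lambda>u. Exp_sigma (mps_const (Xd d u) * h1)))
        L1 (net I r) \<and>
      series_tendsto zpoint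
        (\<lambda>d. coeffwise (expect (U d) zpoint (\<lambda>_. ()))
               (euler_prod (zprod (U d) B) (U d) fst
                  (\<lambda>x. Exp_sigma (mps_const (\<X>d d x) * h1))))
        L2 (net I r) \<and>
      series_tendsto B
        (\<lambda>d. coeffwise (expect (zprod (U d) B) B snd)
               (\<lambda>x. Exp_sigma (mps_const (\<X>d d x) * h1)))
        L3 (net I r) \<and>
      L1 = L2 \<and>
      L2 = euler_prod B zpoint (\<lambda>_. ()) L3 \<and>
      euler_prod B zpoint (\<lambda>_. ()) L3 =
        euler_prod B zpoint (\<lambda>_. ())
          (coeffwise (expect A B \<pi>) (\<lambda>a. Exp_sigma (mps_const (\<X> a) * h1)))"
  unfolding Xd_def \<X>d_def by (rule limits_of_expectations[OF assms(1-10)])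

end
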